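(* Let $(\nu_t)_{t\ge0}$ be either (a) the Gaussian semigroup $(\mu_t)_{t\ge0}$ in an abstract Wiener space $(E,H,\mu)$ with $\dim H=\infty$, or (b) the convolution semigroup of a Lévy process on a Hilbert space $E$ as described in the context, satisfying hypotheses (HS) and (H). Then the "Cameron–Martin" space $H$ is a polar set for the associated Markov process on $E$ with transition function $P_tf(y)=\int_Ef(y+w)\nu_t(dw)$.
   Context: Case (a). Abstract Wiener space $(E,H,\mu)$: $H$ is a separable real Hilbert space with norm $|\cdot|$, continuously and densely embedded into a Banach space $(E,\|\cdot\|)$; identifying $H$ with its dual, $E'\subset H\subset E$; $\mu$ is a Gaussian probability measure on the Borel $\sigma$-algebra of $E$ such that every $l\in E'$ is, under $\mu$, normal with mean $0$ and variance $|l|^2$. $\mu_t$ is the image of $\mu$ under $z\mapsto\sqrt t\,z$ ($\mu_0=\delta_0$). The associated process is the path-continuous Brownian motion on $E$. Case (b). $(H,\langle\cdot,\cdot\rangle)$ is a separable real Hilbert space with norm $|\cdot|$; $E$ is a Hilbert space such that $H\subset E$ continuously and densely; identifying $H$ with $H'$, $E'\subset H\subset E$; ${}_{E'}\langle\xi,z\rangle_E=\xi(z)$. (HS): the embedding $H\subset E$ is Hilbert–Schmidt. $\psi:H\to\mathbb C$ is a continuous negative definite function (so that $e^{-t\psi}$ is positive definite for each $t>0$) with $\psi(0)=0$; $\nu_t$, $t>0$, is the probability measure on $(E,\mathcal B(E))$ with $\int_E e^{i\,{}_{E'}\langle\xi,z\rangle_E}\nu_t(dz)=e^{-t\psi(\xi)}$,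 $\xi\in E'$. The associated process is the càdlàg Lévy process on $E$. (H): (i) there is $C>0$ with $\int_E {}_{E'}\langle\xi,z\rangle_E^2\,\nu_t(dz)\le C(1+t^2)|\xi|^2$ for all $\xi\in E'$, $t>0$; (ii) $\nu_t(H)=0$ for all $t>0$. Polar: with $U_\alpha=\int_0^\infty e^{-\alpha t}P_t\,dt$, a Borel measurable $u:E\to[0,\infty]$ is $\mathcal U_\beta$-excessive ($\beta>0$) if $\alpha U_{\beta+\alpha}u\le u$ for all $\alpha>0$ and $\alpha U_{\beta+\alpha}u\to u$ pointwise as $\alpha\to\infty$. For Borel $M\subset E$, $R_\beta^M1=\inf\{u\ \mathcal U_\beta\text{-excessive}:u\ge1\text{ on }M\}$ and $\widehat{R_\beta^M}1=\sup_{\alpha>0}\alpha U_{\beta+\alpha}(R_\beta^M1)$. $M$ is polar if $\widehat{R_\beta^M}1=0$; equivalently, the hitting time $T_M=\inf\{t>0:X_t\in M\}$ of the associated process $X$ is infinite $P^y$-a.s. for every $y\in E$. *)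

theory Defs
  imports "HOL-Probability.Probability" "HOL-Library.Nonpos_Ints"
begin

section \<open>Densely embedded Hilbert spaces\<close>

text \<open>
  The inclusion of H into E is a map \<open>j\<close>; the subset H of E is \<open>range j\<close>.
  Separability of H is expressed by the class \<open>second_countable_topology\<close>. The same class
  constraint is put on E where measures on E occur; it is no restriction, since E has a dense
  subset that is a continuous image of a separable space.
\<close>

definition dense_embedding :: "('h::real_inner \<Rightarrow> 'e::real_normed_vector) \<Rightarrow> bool" where
  "dense_embedding j \<longleftrightarrow> bounded_linear j \<and> inj j \<and> closure (range j) = UNIV"

text \<open>
  The inclusion of E' into H that comes from identifying H with its dual: a functional on E is
  restricted to H and replaced by its Riesz representative. Existence and uniqueness of the
  representative are \<open>dual_emb_iff\<close> below.
\<close>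

definition dual_emb ::
    "('h::real_inner \<Rightarrow> 'e::real_normed_vector) \<Rightarrow> ('e \<Rightarrow>\<^sub>L real) \<Rightarrow> 'h" where
  "dual_emb j l = (THE h. \<forall>x. blinfun_apply l (j x) = inner h x)"

lemma riesz_representation:
  fixes f :: "'h::{real_inner, complete_space} \<Rightarrow> real"
  assumes "bounded_linear f"
  shows "\<exists>h. \<forall>x. f x = inner h x"
proof -
  interpret f: bounded_linear f by fact
  define F where "F x = (norm x)\<^sup>2 - 2 * f x" for x
  define m where "m = Inf (range F)"
  obtain K where K: "\<And>x. norm (f x) \<le> norm x * K" using f.bounded by blast
  have "- (K\<^sup>2) \<le> F x" for x
  proof -
    have "f x \<le> norm x * K" using K[of x] by simp
    moreover have "0 \<le> (norm x - K)\<^sup>2" by simp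
    ultimately show ?thesis unfolding F_def by (simp add: power2_diff)
  qed
  then have bdd: "bdd_below (range F)" by (intro bdd_belowI[of _ "- (K\<^sup>2)"]) auto
  have m_le: "m \<le> F x" for x unfolding m_def by (rule cINF_lower[OF bdd]) simp
  have par: "(norm (x - y))\<^sup>2 \<le> 2 * (F x - m) + 2 * (F y - m)" for x y
  proof -
    have "4 * m \<le> 4 * F ((1/2) *\<^sub>R (x + y))" using m_le by simp
    also have "\<dots> = (norm (x + y))\<^sup>2 - 4 * (f x + f y)"
      unfolding F_def norm_scaleR f.scaleR f.add by (simp add: power2_eq_square field_simps)
    also have "\<dots> = 2 * F x + 2 * F y - (norm (x - y))\<^sup>2"
      unfolding F_def
      by (simp add: power2_norm_eq_inner inner_simps inner_commute algebra_simps)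
    finally show ?thesis by simp
  qed
  have "\<exists>x. F x < m + inverse (real (Suc n))" for n
  proof (rule ccontr)
    assume "\<nexists>x. F x < m + inverse (real (Suc n))"
    then have "m + inverse (real (Suc n)) \<le> m"
      unfolding m_def[symmetric] by (subst (2) m_def, intro cINF_greatest) (auto simp: not_less)
    then show False by simp
  qed
  then obtain X where X: "\<And>n. F (X n) < m + inverse (real (Suc n))" by metis
  have "Cauchy X"
  proof (rule CauchyI)
    fix e :: real assume "0 < e"
    then obtain N where N: "inverse (real (Suc N)) < e\<^sup>2 / 4"
      using reals_Archimedean[of "e\<^sup>2 / 4"] by auto
    have "norm (X p - X q) < e" if "N \<le> p" "N \<le> q" for p q
    proof -
      have *: "F (X r) - m < e\<^sup>2 / 4" if "N \<le> r" for r
      proof -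
        have "inverse (real (Suc r)) \<le> inverse (real (Suc N))"
          using that by (intro le_imp_inverse_le) auto
        with X[of r] N show ?thesis by linarith
      qed
      have "(norm (X p - X q))\<^sup>2 < e\<^sup>2"
        using par[of "X p" "X q"] *[OF that(1)] *[OF that(2)] by (simp add: field_simps)
      then show ?thesis using \<open>0 < e\<close> by (meson less_imp_le power2_less_imp_less)
    qed
    then show "\<exists>M. \<forall>p\<ge>M. \<forall>q\<ge>M. norm (X p - X q) < e" by blast
  qed
  then obtain h where h: "X \<longlonglongrightarrow> h" using Cauchy_convergent convergent_def by blast
  have "(\<lambda>n. F (X n)) \<longlonglongrightarrow> F h"
    unfolding F_def by (intro tendsto_intros h f.tendsto)
  moreover have "(\<lambda>n. m + inverse (real (Suc n))) \<longlonglongrightarrow> m + 0"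
    by (intro tendsto_intros LIMSEQ_inverse_real_of_nat)
  ultimately have "F h \<le> m"
    using X by (intro LIMSEQ_le[of "\<lambda>n. F (X n)" _ "\<lambda>n. m + inverse (real (Suc n))"])
      (auto intro: less_imp_le)
  have "f x = inner h x" for x
  proof (rule ccontr)
    assume neq: "f x \<noteq> inner h x"
    define d where "d = f x - inner h x"
    have "d \<noteq> 0" using neq by (simp add: d_def)
    then have "x \<noteq> 0" by (auto simp: d_def f.zero)
    define t where "t = d / (norm x)\<^sup>2"
    have "F (h + t *\<^sub>R x) = F h + t\<^sup>2 * (norm x)\<^sup>2 - 2 * t * d"
      unfolding F_def d_def
      by (simp add: power2_norm_eq_inner inner_simps inner_commute f.add f.scaleR
          power2_eq_square[of t] algebra_simps)
    also have "\<dots> = F h - d\<^sup>2 / (norm x)\<^sup>2"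
      using \<open>x \<noteq> 0\<close> unfolding t_def by (simp add: field_simps power2_eq_square)
    also have "\<dots> < F h" using \<open>d \<noteq> 0\<close> \<open>x \<noteq> 0\<close> by simp
    finally show False using m_le[of "h + t *\<^sub>R x"] \<open>F h \<le> m\<close> by linarith
  qed
  then show ?thesis by blast
qed

lemma dual_emb_iff:
  fixes j :: "'h::{real_inner, complete_space} \<Rightarrow> 'e::real_normed_vector"
  assumes "bounded_linear j"
  shows "dual_emb j l = h \<longleftrightarrow> (\<forall>x. blinfun_apply l (j x) = inner h x)"
proof -
  have "bounded_linear (\<lambda>x. blinfun_apply l (j x))"
    using assms blinfun.bounded_linear_right bounded_linear_compose by blast
  then obtain k where k: "\<forall>x. blinfun_apply l (j x) = inner k x"
    using riesz_representation by blast
  have uniq: "g = k" if "\<forall>x. blinfun_apply l (j x) = inner g x" for g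
    using that k by (metis vector_eq_rdot)
  have "dual_emb j l = k"
    unfolding dual_emb_def using k uniq by (rule the_equality)
  with k uniq show ?thesis by metis
qed

definition orthonormal_basis :: "'h::real_inner set \<Rightarrow> bool" where
  "orthonormal_basis B \<longleftrightarrow>
     pairwise orthogonal B \<and> (\<forall>e\<in>B. norm e = 1) \<and> closure (span B) = UNIV"

text \<open>The sum below does not depend on the orthonormal basis.\<close>

definition hilbert_schmidt :: "('h::real_inner \<Rightarrow> 'e::real_inner) \<Rightarrow> bool" where
  "hilbert_schmidt j \<longleftrightarrow> bounded_linear j \<and>
     (\<exists>B. orthonormal_basis B \<and> (\<lambda>e. (norm (j e))\<^sup>2) summable_on B)"


section \<open>The two classes of convolution semigroups\<close>

text \<open>Normal law with mean \<open>a\<close> and variance \<open>v\<close>, the degenerate case \<open>v = 0\<close> included.\<close>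

definition normal_law :: "real \<Rightarrow> real \<Rightarrow> real measure" where
  "normal_law a v =
     (if v = 0 then return borel a else density lborel (normal_density a (sqrt v)))"

definition abstract_wiener_space ::
    "('h::real_inner \<Rightarrow> 'e::real_normed_vector) \<Rightarrow> 'e measure \<Rightarrow> bool" where
  "abstract_wiener_space j \<mu> \<longleftrightarrow>
     dense_embedding j \<and> prob_space \<mu> \<and> sets \<mu> = sets borel \<and>
     (\<forall>l. distr \<mu> borel (blinfun_apply l) = normal_law 0 ((norm (dual_emb j l))\<^sup>2))"

definition gaussian_semigroup :: "'e::real_normed_vector measure \<Rightarrow> real \<Rightarrow> 'e measure" where
  "gaussian_semigroup \<mu> t = distr \<mu> borel (\<lambda>z. sqrt t *\<^sub>R z)"

text \<open>
  Negative definiteness in the sense of Schoenberg (Berg and Forst): the matrices with entries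
  \<open>\<psi> (x i) + cnj (\<psi> (x k)) - \<psi> (x i - x k)\<close> are positive semidefinite Hermitian.
\<close>

definition negative_definite :: "('h::ab_group_add \<Rightarrow> complex) \<Rightarrow> bool" where
  "negative_definite \<psi> \<longleftrightarrow>
     (\<forall>(n::nat) (x::nat \<Rightarrow> 'h) (c::nat \<Rightarrow> complex).
        (\<Sum>i<n. \<Sum>k<n. (\<psi> (x i) + cnj (\<psi> (x k)) - \<psi> (x i - x k)) * c i * cnj (c k)) \<in> \<real>\<^sub>\<ge>\<^sub>0)"

definition levy_semigroup ::
    "('h::real_inner \<Rightarrow> 'e::real_inner) \<Rightarrow> ('h \<Rightarrow> complex) \<Rightarrow> (real \<Rightarrow> 'e measure) \<Rightarrow> bool" where
  "levy_semigroup j \<psi> \<nu> \<longleftrightarrow>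
     dense_embedding j \<and>
     continuous_on UNIV \<psi> \<and> negative_definite \<psi> \<and> \<psi> 0 = 0 \<and>
     \<nu> 0 = return borel 0 \<and>
     (\<forall>t>0. prob_space (\<nu> t) \<and> sets (\<nu> t) = sets borel \<and>
        (\<forall>\<xi>. (LINT z|\<nu> t. exp (\<i> * complex_of_real (blinfun_apply \<xi> z))) =
              exp (- (complex_of_real t * \<psi> (dual_emb j \<xi>)))))"

definition hypothesis_H ::
    "('h::real_inner \<Rightarrow> 'e::real_inner) \<Rightarrow> (real \<Rightarrow> 'e measure) \<Rightarrow> bool" where
  "hypothesis_H j \<nu> \<longleftrightarrow>
     (\<exists>C>0. \<forall>\<xi>. \<forall>t>0.
        (\<integral>\<^sup>+z. ennreal ((blinfun_apply \<xi> z)\<^sup>2) \<partial>\<nu> t)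
          \<le> ennreal (C * (1 + t\<^sup>2) * (norm (dual_emb j \<xi>))\<^sup>2)) \<and>
     (\<forall>t>0. emeasure (\<nu> t) (range j) = 0)"


section \<open>Potential theory of a convolution semigroup\<close>

definition transition ::
    "(real \<Rightarrow> 'e::real_normed_vector measure) \<Rightarrow> real \<Rightarrow> ('e \<Rightarrow> ennreal) \<Rightarrow> 'e \<Rightarrow> ennreal" where
  "transition \<nu> t f y = (\<integral>\<^sup>+w. f (y + w) \<partial>\<nu> t)"

definition resolvent ::
    "(real \<Rightarrow> 'e::real_normed_vector measure) \<Rightarrow> real \<Rightarrow> ('e \<Rightarrow> ennreal) \<Rightarrow> 'e \<Rightarrow> ennreal" where
  "resolvent \<nu> \<alpha> f y = (\<integral>\<^sup>+t\<in>{0..}. ennreal (exp (- \<alpha> * t)) * transition \<nu> t f y \<partial>lborel)"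

definition excessive ::
    "(real \<Rightarrow> 'e::real_normed_vector measure) \<Rightarrow> real \<Rightarrow> ('e \<Rightarrow> ennreal) \<Rightarrow> bool" where
  "excessive \<nu> \<beta> u \<longleftrightarrow>
     u \<in> borel_measurable borel \<and>
     (\<forall>\<alpha>>0. \<forall>y. ennreal \<alpha> * resolvent \<nu> (\<beta> + \<alpha>) u y \<le> u y) \<and>
     (\<forall>y. ((\<lambda>\<alpha>. ennreal \<alpha> * resolvent \<nu> (\<beta> + \<alpha>) u y) \<longlongrightarrow> u y) at_top)"

definition reduced ::
    "(real \<Rightarrow> 'e::real_normed_vector measure) \<Rightarrow> real \<Rightarrow> 'e set \<Rightarrow> 'e \<Rightarrow> ennreal" where
  "reduced \<nu> \<beta> M y = (INF u\<in>{u. excessive \<nu> \<beta> u \<and> (\<forall>x\<in>M. 1 \<le> u x)}. u y)"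

text \<open>
  The reduced function of a Borel set is universally measurable but in general not Borel. For a
  universally measurable function the nonnegative integral of the library, a supremum over simple
  functions below the integrand, agrees with the integral with respect to the completed measure,
  so the resolvent is the usual one here too.
\<close>

definition regularized_reduced ::
    "(real \<Rightarrow> 'e::real_normed_vector measure) \<Rightarrow> real \<Rightarrow> 'e set \<Rightarrow> 'e \<Rightarrow> ennreal" where
  "regularized_reduced \<nu> \<beta> M y =
     (SUP \<alpha>\<in>{0<..}. ennreal \<alpha> * resolvent \<nu> (\<beta> + \<alpha>) (reduced \<nu> \<beta> M) y)"

definition polar :: "(real \<Rightarrow> 'e::real_normed_vector measure) \<Rightarrow> 'e set \<Rightarrow> bool" where
  "polar \<nu> M \<longleftrightarrow> M \<in> sets borel \<and> (\<forall>\<beta>>0. \<forall>y. regularized_reduced \<nu> \<beta> M y = 0)"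

end

(*
  Let P_t be the transition semigroup and |x|_n^2 = sum_{i<n} L_i(x)^2 for functionals L_i on E
  that are orthonormal in H and separate points, so that H = {x. sup_n |x|_n < infinity}. With a
  standard Gaussian vector g_n in the span of L_0, ..., L_{n-1} one has

    P_s exp(-|.|_n^2 / 8)(y) = E exp(i <g_n/2, y> - s psi(g_n/2)).

  The beta-potential v_n of exp(-|.|_n^2 / 8) is excessive.
  Upper bound: P_t v_n <= phi_n(t) / beta with phi_n(t) = E exp(-t Re psi(g_n/2)).
  Lower bound: v_n >= c_R / (1 + E Re psi(g_n)) on the ball of radius R of H, because up to time
  1 / E Re psi(g_n) the symmetrized process stays near 0 with a fixed probability and the second
  moment bound prevents the process itself from drifting away.
  It remains to see that (1 + E Re psi(g_n)) phi_n(t) -> 0. By the second moment bound nu_t charges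
  no coset of H other than H itself, hence phi_n(t) -> 0. Since Re psi(x) <= 2 Re psi(y) + K |x-y|^2,
  Maurey's concentration inequality for Gaussian measures gives
  phi_n(s) <= exp(-s E Re psi(g_n/2) / 2) for small s, so that E Re psi(g_n) is at most logarithmic
  in 1 / phi_n. Summing suitably scaled v_n over the balls of H gives excessive functions that are
  >= 1 on H and have arbitrarily small image under P_t. The Gaussian case is psi(h) = |h|^2 / 2.
*)
theory Submission
  imports Defs
begin

section \<open>Maurey's inequality for Gaussian measures\<close>

text \<open>Both bounds on v_n decay with n, so everything depends on their ratio: phi_n(t) -> 0 is
  useless without a rate against E Re psi(g_n), and the nullness of H gives no rate. Concentration
  supplies one although neither quantity is known: Jensen gives phi_n(s) >= exp(-s E Re psi(g_n/2)),
  and Maurey's inequality reverses this up to a constant in the exponent, so a large mean forces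
  phi_n to be exponentially small in it. Re psi need not be Lipschitz. The one-sided estimate with a
  factor 2 and a quadratic error is what an inequality for pairs with u(x) v(y) <= exp(|x-y|^2/4)
  can use, the factor being absorbed by unequal exponents in u and v. The two scales g_n and g_n/2
  come from the lower bound: recentring twice by |x+y|_n^2 <= 2|x|_n^2 + 2|y|_n^2 costs a factor 4
  in a Gaussian exponent and turns exp(-|.|_n^2/2) into exp(-|.|_n^2/8). Letting n grow is possible
  because neither Maurey's inequality nor the second moment estimate has a constant depending on
  n.\<close>

text \<open>The translates \<open>A + b\<close> and \<open>a + B\<close> with \<open>a\<close> near \<open>Sup A\<close> and \<open>b\<close> near \<open>Inf B\<close> are
  almost disjoint subsets of the sumset.\<close>

lemma emeasure_sumset_ge:
  fixes A B C :: "real set"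
  assumes [measurable]: "A \<in> sets borel" "B \<in> sets borel" "C \<in> sets borel"
    and ne: "A \<noteq> {}" "B \<noteq> {}"
    and sum: "\<And>x y. x \<in> A \<Longrightarrow> y \<in> B \<Longrightarrow> x + y \<in> C"
  shows "emeasure lborel A + emeasure lborel B \<le> emeasure lborel C"
proof -
  have bounded_case: "emeasure lborel A + emeasure lborel B \<le> emeasure lborel C"
    if [measurable]: "A \<in> sets borel" "B \<in> sets borel" and ne: "A \<noteq> {}" "B \<noteq> {}"
      and bdd: "bdd_above A" "bdd_below B" and sum: "\<And>x y. x \<in> A \<Longrightarrow> y \<in> B \<Longrightarrow> x + y \<in> C"
    for A B
  proof (rule ennreal_le_epsilon)
    fix e :: real assume "0 < e"
    then obtain a where a: "a \<in> A" "Sup A - e / 2 < a"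
      using less_cSup_iff[OF ne(1) bdd(1), of "Sup A - e / 2"] by auto
    obtain b where b: "b \<in> B" "b < Inf B + e / 2"
      using cInf_less_iff[OF ne(2) bdd(2), of "Inf B + e / 2"] \<open>0 < e\<close> by auto
    have shift: "emeasure lborel ((+) c ` X) = emeasure lborel X" if "X \<in> sets borel"
      for c and X :: "real set"
    proof -
      have "emeasure lborel X = emeasure (distr lborel borel ((+) (- c))) X"
        using lborel_distr_plus[of "- c"] by simp
      also have "\<dots> = emeasure lborel ((+) (- c) -` X)"
        using that by (subst emeasure_distr) auto
      also have "(+) (- c) -` X = (+) c ` X" by (force simp: image_iff algebra_simps)
      finally show ?thesis ..
    qed
    have meas: "(+) c ` X \<in> sets borel" if "X \<in> sets borel" for c and X :: "real set"
    proof -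
      have "(+) c ` X = (+) (- c) -` X \<inter> space borel" by (force simp: image_iff algebra_simps)
      also have "\<dots> \<in> sets borel" using that by measurable
      finally show ?thesis .
    qed
    have "A \<subseteq> (A \<inter> {..<a}) \<union> {a..Sup A}" using bdd by (auto intro: cSup_upper)
    then have "emeasure lborel A \<le> emeasure lborel ((A \<inter> {..<a}) \<union> {a..Sup A})"
      by (intro emeasure_mono) auto
    also have "\<dots> \<le> emeasure lborel (A \<inter> {..<a}) + emeasure lborel {a..Sup A}"
      by (intro emeasure_subadditive) auto
    also have "\<dots> \<le> emeasure lborel (A \<inter> {..<a}) + ennreal (e / 2)"
      using a bdd cSup_upper[of a A] by (intro add_left_mono) (auto intro!: ennreal_leI)
    finally have 1: "emeasure lborel A \<le> emeasure lborel (A \<inter> {..<a}) + ennreal (e / 2)" .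
    have "B \<subseteq> (B \<inter> {b..}) \<union> {Inf B..b}" using bdd by (auto intro: cInf_lower)
    then have "emeasure lborel B \<le> emeasure lborel ((B \<inter> {b..}) \<union> {Inf B..b})"
      by (intro emeasure_mono) auto
    also have "\<dots> \<le> emeasure lborel (B \<inter> {b..}) + emeasure lborel {Inf B..b}"
      by (intro emeasure_subadditive) auto
    also have "\<dots> \<le> emeasure lborel (B \<inter> {b..}) + ennreal (e / 2)"
      using b bdd cInf_lower[of b B] by (intro add_left_mono) (auto intro!: ennreal_leI)
    finally have 2: "emeasure lborel B \<le> emeasure lborel (B \<inter> {b..}) + ennreal (e / 2)" .
    have "emeasure lborel (A \<inter> {..<a}) + emeasure lborel (B \<inter> {b..})
        = emeasure lborel ((+) b ` (A \<inter> {..<a})) + emeasure lborel ((+) a ` (B \<inter> {b..}))"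
      by (simp add: shift)
    \<comment> \<open>The first translate lies strictly to the left of \<open>a + b\<close>, the
      second at or to the right of it; hence the union is disjoint.\<close>
    also have "\<dots> = emeasure lborel ((+) b ` (A \<inter> {..<a}) \<union> (+) a ` (B \<inter> {b..}))"
      by (intro plus_emeasure) (auto intro!: meas)
    also have "\<dots> \<le> emeasure lborel C"
    proof (intro emeasure_mono subsetI)
      fix z assume "z \<in> (+) b ` (A \<inter> {..<a}) \<union> (+) a ` (B \<inter> {b..})"
      then consider x where "x \<in> A" "z = x + b" | y where "y \<in> B" "z = a + y" by auto
      then show "z \<in> C" using sum a b by cases auto
    qed auto
    finally have 3: "emeasure lborel (A \<inter> {..<a}) + emeasure lborel (B \<inter> {b..}) \<le> emeasure lborel C" .
    have "emeasure lborel A + emeasure lborel B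
        \<le> (emeasure lborel (A \<inter> {..<a}) + ennreal (e / 2)) + (emeasure lborel (B \<inter> {b..}) + ennreal (e / 2))"
      by (intro add_mono 1 2)
    also have "\<dots> = (emeasure lborel (A \<inter> {..<a}) + emeasure lborel (B \<inter> {b..})) + ennreal e"
      using \<open>0 < e\<close> by (simp add: ac_simps flip: ennreal_plus)
    also have "\<dots> \<le> emeasure lborel C + ennreal e" by (intro add_right_mono 3)
    finally show "emeasure lborel A + emeasure lborel B \<le> emeasure lborel C + ennreal e" .
  qed
  obtain a b where ab: "a \<in> A" "b \<in> B" using ne by auto
  \<comment> \<open>The bounded case asks for a bound of \<open>A\<close> from above and of
    \<open>B\<close> from below only, so one-sided truncation suffices; the points \<open>a\<close>
    and \<open>b\<close> keep the truncated sets nonempty.\<close>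
  define A' where "A' n = A \<inter> {..a + real n}" for n
  define B' where "B' n = B \<inter> {b - real n..}" for n
  have [measurable]: "A' n \<in> sets borel" "B' n \<in> sets borel" for n
    unfolding A'_def B'_def by auto
  have "(\<lambda>n. emeasure lborel (A' n)) \<longlonglongrightarrow> emeasure lborel (\<Union>n. A' n)"
    by (intro Lim_emeasure_incseq) (auto simp: incseq_def A'_def)
  also have "(\<Union>n. A' n) = A"
  proof -
    have "\<exists>n. x \<le> a + real n" for x using real_arch_simple[of "x - a"] by (auto simp: algebra_simps)
    then show ?thesis unfolding A'_def by auto
  qed
  finally have A: "(\<lambda>n. emeasure lborel (A' n)) \<longlonglongrightarrow> emeasure lborel A" .
  have "(\<lambda>n. emeasure lborel (B' n)) \<longlonglongrightarrow> emeasure lborel (\<Union>n. B' n)"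
    by (intro Lim_emeasure_incseq) (auto simp: incseq_def B'_def)
  also have "(\<Union>n. B' n) = B"
  proof -
    have "\<exists>n. b \<le> x + real n" for x using real_arch_simple[of "b - x"] by (auto simp: algebra_simps)
    then show ?thesis unfolding B'_def by (auto simp: algebra_simps)
  qed
  finally have B: "(\<lambda>n. emeasure lborel (B' n)) \<longlonglongrightarrow> emeasure lborel B" .
  show ?thesis
  proof (rule LIMSEQ_le_const2[OF tendsto_add[OF A B]], intro exI allI impI)
    fix n
    show "emeasure lborel (A' n) + emeasure lborel (B' n) \<le> emeasure lborel C"
      using ab sum unfolding A'_def B'_def
      by (intro bounded_case) (auto intro!: bdd_aboveI2 bdd_belowI2)
  qed
qed

lemma nn_integral_layer_cake:
  fixes f :: "real \<Rightarrow> real"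
  assumes [measurable]: "f \<in> borel_measurable borel" and "\<And>x. 0 \<le> f x"
  shows "(\<integral>\<^sup>+x. ennreal (f x) \<partial>lborel) = (\<integral>\<^sup>+l\<in>{0..}. emeasure lborel {x. l < f x} \<partial>lborel)"
proof -
  have "(\<integral>\<^sup>+x. ennreal (f x) \<partial>lborel) = (\<integral>\<^sup>+x. (\<integral>\<^sup>+l. indicator {0..} l * indicator {l. l < f x} l \<partial>lborel) \<partial>lborel)"
  proof (intro nn_integral_cong)
    fix x
    have "(\<integral>\<^sup>+l. indicator {0..} l * indicator {l. l < f x} l \<partial>lborel) = (\<integral>\<^sup>+l. indicator {0..<f x} l \<partial>lborel)"
      by (intro nn_integral_cong) (auto split: split_indicator)
    then show "ennreal (f x) = (\<integral>\<^sup>+l. indicator {0..} l * indicator {l. l < f x} l \<partial>lborel)"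
      using assms(2)[of x] by simp
  qed
  also have "\<dots> = (\<integral>\<^sup>+l. (\<integral>\<^sup>+x. indicator {0..} l * indicator {l. l < f x} l \<partial>lborel) \<partial>lborel)"
    by (rule lborel_pair.Fubini') measurable
  also have "\<dots> = (\<integral>\<^sup>+l\<in>{0..}. emeasure lborel {x. l < f x} \<partial>lborel)"
  proof (intro nn_integral_cong)
    fix l
    have "(\<integral>\<^sup>+x. indicator {0..} l * indicator {l. l < f x} l \<partial>lborel)
        = (\<integral>\<^sup>+x. indicator {0..} l * indicator {x. l < f x} x \<partial>lborel)"
      by (intro nn_integral_cong) (auto split: split_indicator)
    also have "\<dots> = emeasure lborel {x. l < f x} * indicator {0..} l"
      by (subst nn_integral_cmult) (auto simp: mult.commute)
    finally show "(\<integral>\<^sup>+x. indicator {0..} l * indicator {l. l < f x} l \<partial>lborel)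
        = emeasure lborel {x. l < f x} * indicator {0..} l" .
  qed
  finally show ?thesis .
qed

text \<open>Equal suprema make the level sets of \<open>U\<close> and \<open>V\<close> nonempty for
  the same levels l < 1, and their sumset lies in the level set of \<open>W\<close>; lengths
  therefore add level by level. This is why the conclusion bounds a sum of integrals and not just a
  product. Using \<open>x + y\<close> in place of the midpoint puts the usual factor 1/2 into
  \<open>W\<close>.\<close>

lemma prekopa_leindler_normalized:
  fixes U V W :: "real \<Rightarrow> real"
  assumes [measurable]: "U \<in> borel_measurable borel" "V \<in> borel_measurable borel" "W \<in> borel_measurable borel"
    and nonneg: "\<And>x. 0 \<le> U x" "\<And>x. 0 \<le> V x" "\<And>x. 0 \<le> W x"
    and U1: "(SUP x. U x) = 1" "bdd_above (range U)" and V1: "(SUP x. V x) = 1" "bdd_above (range V)"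
    and UVW: "\<And>x y. U x * V y \<le> (W (x + y))\<^sup>2"
  shows "(\<integral>\<^sup>+x. ennreal (U x) \<partial>lborel) + (\<integral>\<^sup>+x. ennreal (V x) \<partial>lborel) \<le> (\<integral>\<^sup>+x. ennreal (W x) \<partial>lborel)"
proof -
  have Ule: "U x \<le> 1" and Vle: "V x \<le> 1" for x
    using cSUP_upper[OF UNIV_I U1(2), of x] cSUP_upper[OF UNIV_I V1(2), of x] U1(1) V1(1) by auto
  have [measurable]: "{x. l < U x} \<in> sets borel" "{x. l < V x} \<in> sets borel" "{x. l < W x} \<in> sets borel" for l
    by measurable
  have 1: "emeasure lborel {x. l < U x} + emeasure lborel {x. l < V x} \<le> emeasure lborel {x. l < W x}"
    if "0 \<le> l" for l
  proof (cases "l < 1")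
    case False
    then have "{x. l < U x} = {}" "{x. l < V x} = {}" using Ule Vle by (auto simp: not_less intro: order.trans)
    then show ?thesis by simp
  next
    case True
    show ?thesis
    proof (intro emeasure_sumset_ge)
      show "{x. l < U x} \<noteq> {}" "{x. l < V x} \<noteq> {}"
        using True less_cSUP_iff[OF _ U1(2), of l] less_cSUP_iff[OF _ V1(2), of l] U1 V1 by auto
      fix x y assume "x \<in> {x. l < U x}" "y \<in> {x. l < V x}"
      then have "l\<^sup>2 < U x * V y" using \<open>0 \<le> l\<close> by (auto simp: power2_eq_square intro!: mult_strict_mono)
      then have "l\<^sup>2 < (W (x + y))\<^sup>2" using UVW[of x y] by simp
      then show "x + y \<in> {x. l < W x}" using nonneg(3) by (auto intro: power2_less_imp_less)
    qed auto
  qed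
  have m: "(\<lambda>l. emeasure lborel {x. l < f x}) \<in> borel_measurable lborel"
    if [measurable]: "f \<in> borel_measurable borel" for f :: "real \<Rightarrow> real"
  proof -
    have "(\<lambda>l. \<integral>\<^sup>+x. indicator {(l, x). l < f x} (l, x) \<partial>lborel) \<in> borel_measurable lborel"
      by measurable
    also have "(\<lambda>l. \<integral>\<^sup>+x. indicator {(l, x). l < f x} (l, x) \<partial>lborel) = (\<lambda>l. emeasure lborel {x. l < f x})"
    proof
      fix l
      have "(\<integral>\<^sup>+x. indicator {(l, x). l < f x} (l, x) \<partial>lborel) = (\<integral>\<^sup>+x. indicator {x. l < f x} x \<partial>lborel)"
        by (intro nn_integral_cong) (auto split: split_indicator)
      then show "(\<integral>\<^sup>+x. indicator {(l, x). l < f x} (l, x) \<partial>lborel) = emeasure lborel {x. l < f x}" by simp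
    qed
    finally show ?thesis .
  qed
  note [measurable] = m
  show ?thesis
    unfolding nn_integral_layer_cake[OF assms(1) nonneg(1)] nn_integral_layer_cake[OF assms(2) nonneg(2)]
      nn_integral_layer_cake[OF assms(3) nonneg(3)]
    by (subst nn_integral_add[symmetric])
      (auto intro!: nn_integral_mono 1 simp flip: distrib_right split: split_indicator)
qed

text \<open>The Gaussian densities are multiplied into \<open>u\<close> and \<open>v\<close>, and
  the Prekopa-Leindler inequality is applied after division by the suprema. A pair \<open>u\<close>,
  \<open>v\<close> replaces the usual function and its infimal convolution, so that no measurability
  of an infimum has to be shown.\<close>

lemma maurey_property_1d:
  fixes u v :: "real \<Rightarrow> ennreal"
  assumes [measurable]: "u \<in> borel_measurable borel" "v \<in> borel_measurable borel"
    and uv: "\<And>x y. u x * v y \<le> ennreal (exp ((x - y)\<^sup>2 / 4))"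
  shows "(\<integral>\<^sup>+x. u x \<partial>std_normal_distribution) * (\<integral>\<^sup>+x. v x \<partial>std_normal_distribution) \<le> 1"
proof (cases "(\<forall>x. u x = 0) \<or> (\<forall>x. v x = 0)")
  case True
  then show ?thesis by auto
next
  case False
  then obtain x0 y0 where x0: "u x0 \<noteq> 0" and y0: "v y0 \<noteq> 0" by auto
  have "u x \<noteq> \<top>" "v y \<noteq> \<top>" for x y
    using uv[of x y0] uv[of x0 y] x0 y0 by (auto simp: ennreal_mult_eq_top_iff top_unique ennreal_top_mult ennreal_mult_top)
  then have fin: "ennreal (enn2real (u x)) = u x" "ennreal (enn2real (v x)) = v x" for x
    by (auto simp: less_top)
  define U where "U x = enn2real (u x) * std_normal_density x" for x
  define V where "V x = enn2real (v x) * std_normal_density x" for x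
  \<comment> \<open>The parallelogram identity leaves -(x + y)^2 / 4 in the exponent of the product
    of \<open>U x\<close> and \<open>V y\<close>; \<open>W\<close> is the square root of the
    resulting Gaussian and has total mass 2.\<close>
  define W where "W z = exp (- (z\<^sup>2 / 8)) / sqrt (2 * pi)" for z :: real
  have [measurable]: "U \<in> borel_measurable borel" "V \<in> borel_measurable borel" "W \<in> borel_measurable borel"
    unfolding U_def V_def W_def by measurable
  have nonneg: "0 \<le> U x" "0 \<le> V x" "0 \<le> W x" for x
    by (auto simp: U_def V_def W_def)
  have U_int: "(\<integral>\<^sup>+x. u x \<partial>std_normal_distribution) = (\<integral>\<^sup>+x. U x \<partial>lborel)"
    by (subst nn_integral_density)
      (auto simp: U_def ennreal_mult' fin mult.commute normal_density_nonneg intro!: nn_integral_cong)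
  have V_int: "(\<integral>\<^sup>+x. v x \<partial>std_normal_distribution) = (\<integral>\<^sup>+x. V x \<partial>lborel)"
    by (subst nn_integral_density)
      (auto simp: V_def ennreal_mult' fin mult.commute normal_density_nonneg intro!: nn_integral_cong)
  have UVW: "U x * V y \<le> (W (x + y))\<^sup>2" for x y
  proof -
    have "ennreal (enn2real (u x) * enn2real (v y)) \<le> ennreal (exp ((x - y)\<^sup>2 / 4))"
      using uv[of x y] by (simp add: ennreal_mult fin)
    then have "enn2real (u x) * enn2real (v y) \<le> exp ((x - y)\<^sup>2 / 4)" by simp
    then have "(enn2real (u x) * enn2real (v y)) * (std_normal_density x * std_normal_density y)
      \<le> exp ((x - y)\<^sup>2 / 4) * (std_normal_density x * std_normal_density y)"
      by (intro mult_right_mono) auto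
    also have "\<dots> = exp ((x - y)\<^sup>2 / 4 + - x\<^sup>2 / 2 + - y\<^sup>2 / 2) / (2 * pi)"
      unfolding exp_add by (simp add: std_normal_density_def)
    also have "(x - y)\<^sup>2 / 4 + - x\<^sup>2 / 2 + - y\<^sup>2 / 2 = - ((x + y)\<^sup>2 / 8) + - ((x + y)\<^sup>2 / 8)"
      by (simp add: power2_eq_square field_simps)
    also have "exp (- ((x + y)\<^sup>2 / 8) + - ((x + y)\<^sup>2 / 8)) / (2 * pi) = (W (x + y))\<^sup>2"
      unfolding W_def power_divide exp_add by (simp add: power2_eq_square[of "exp _"])
    finally show ?thesis by (simp add: U_def V_def ac_simps)
  qed
  have Wle: "W z \<le> 1 / sqrt (2 * pi)" for z
    unfolding W_def by (intro divide_right_mono) auto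
  have W2: "(W z)\<^sup>2 \<le> 1 / (2 * pi)" for z
    using power_mono[OF Wle nonneg(3), of z 2] by (simp add: power_divide)
  have pos: "0 < U x0" "0 < V y0"
    using x0 y0 fin(1)[of x0] fin(2)[of y0]
      normal_density_pos[of 1 0 x0] normal_density_pos[of 1 0 y0]
    by (auto simp: U_def V_def less_le)
  \<comment> \<open>\<open>W\<close> is bounded, so a single positive value of \<open>V\<close>
    bounds all of \<open>U\<close>, and conversely.\<close>
  have bU: "bdd_above (range U)"
  proof (intro bdd_aboveI2)
    fix x show "U x \<le> 1 / (2 * pi) / V y0"
      using order.trans[OF UVW[of x y0] W2] pos by (simp add: pos_le_divide_eq ac_simps)
  qed
  have bV: "bdd_above (range V)"
  proof (intro bdd_aboveI2)
    fix y show "V y \<le> 1 / (2 * pi) / U x0"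
      using order.trans[OF UVW[of x0 y] W2] pos by (simp add: pos_le_divide_eq ac_simps)
  qed
  define p where "p = (SUP x. U x)"
  define q where "q = (SUP x. V x)"
  have p: "0 < p" unfolding p_def using pos(1) cSUP_upper[OF UNIV_I bU, of x0] by linarith
  have q: "0 < q" unfolding q_def using pos(2) cSUP_upper[OF UNIV_I bV, of y0] by linarith
  have sup1: "(SUP x. f x / c) = 1" if bdd: "bdd_above (range f)" and c: "c = (SUP x. f x)" "0 < c" for f :: "real \<Rightarrow> real" and c
  proof (rule cSup_eq_non_empty)
    show "y \<le> 1" if "y \<in> range (\<lambda>x. f x / c)" for y
      using that c cSUP_upper[OF UNIV_I bdd] by auto
    fix y assume *: "\<And>z. z \<in> range (\<lambda>x. f x / c) \<Longrightarrow> z \<le> y"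
    have "f x \<le> y * c" for x using *[of "f x / c"] \<open>0 < c\<close> by (auto simp: field_simps)
    then have "c \<le> y * c" by (subst c(1), intro cSUP_least) auto
    then show "1 \<le> y" using \<open>0 < c\<close> by simp
  qed auto
  have "(\<integral>\<^sup>+x. ennreal (U x / p) \<partial>lborel) + (\<integral>\<^sup>+x. ennreal (V x / q) \<partial>lborel)
      \<le> (\<integral>\<^sup>+x. ennreal (W x / sqrt (p * q)) \<partial>lborel)"
  proof (rule prekopa_leindler_normalized)
    show "(SUP x. U x / p) = 1" "(SUP x. V x / q) = 1"
      using sup1[OF bU p_def p] sup1[OF bV q_def q] by auto
    obtain m where "\<And>x. U x \<le> m" using bU unfolding bdd_above_def by auto
    then show "bdd_above (range (\<lambda>x. U x / p))" using p by (intro bdd_aboveI2[where M = "m / p"] divide_right_mono) auto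
    obtain m where "\<And>x. V x \<le> m" using bV unfolding bdd_above_def by auto
    then show "bdd_above (range (\<lambda>x. V x / q))" using q by (intro bdd_aboveI2[where M = "m / q"] divide_right_mono) auto
    show "U x / p * (V y / q) \<le> (W (x + y) / sqrt (p * q))\<^sup>2" for x y
      using UVW[of x y] p q by (simp add: power_divide divide_right_mono)
  qed (use p q nonneg in auto)
  also have "(\<integral>\<^sup>+x. ennreal (W x / sqrt (p * q)) \<partial>lborel) = ennreal (2 / sqrt (p * q))"
  proof -
    have "sqrt 8 = 2 * sqrt (2 :: real)" using real_sqrt_mult[of 4 2] by simp
    then have "W x / sqrt (p * q) = 2 / sqrt (p * q) * normal_density 0 2 x" for x
      by (simp add: W_def normal_density_def real_sqrt_mult)
    then have "(\<integral>\<^sup>+x. ennreal (W x / sqrt (p * q)) \<partial>lborel) = (\<integral>\<^sup>+x. ennreal (2 / sqrt (p * q)) * ennreal (normal_density 0 2 x) \<partial>lborel)"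
      using p q by (intro nn_integral_cong) (simp flip: ennreal_mult)
    also have "\<dots> = ennreal (2 / sqrt (p * q)) * (\<integral>\<^sup>+x. ennreal (normal_density 0 2 x) \<partial>lborel)"
      by (rule nn_integral_cmult) measurable
    also have "(\<integral>\<^sup>+x. ennreal (normal_density 0 2 x) \<partial>lborel) = 1"
      by (subst nn_integral_eq_integral) (auto simp: integrable_normal_density integral_normal_density)
    finally show ?thesis by simp
  qed
  finally have sum: "(\<integral>\<^sup>+x. ennreal (U x / p) \<partial>lborel) + (\<integral>\<^sup>+x. ennreal (V x / q) \<partial>lborel)
      \<le> ennreal (2 / sqrt (p * q))" .
  obtain a where a: "0 \<le> a" "(\<integral>\<^sup>+x. ennreal (U x / p) \<partial>lborel) = ennreal a"
    using sum by (cases "\<integral>\<^sup>+x. ennreal (U x / p) \<partial>lborel") (auto simp: top_unique)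
  obtain b where b: "0 \<le> b" "(\<integral>\<^sup>+x. ennreal (V x / q) \<partial>lborel) = ennreal b"
    using sum by (cases "\<integral>\<^sup>+x. ennreal (V x / q) \<partial>lborel") (auto simp: top_unique)
  have "a + b \<le> 2 / sqrt (p * q)" using sum p q a b by (simp flip: ennreal_plus)
  then have "(a + b)\<^sup>2 \<le> (2 / sqrt (p * q))\<^sup>2" using a b by (intro power_mono) auto
  then have "(a + b)\<^sup>2 \<le> 4 / (p * q)" using p q by (simp add: power_divide)
  \<comment> \<open>The arithmetic-geometric mean inequality turns the sum into a product, in which
    the normalizing suprema \<open>p\<close> and \<open>q\<close> cancel.\<close>
  moreover have "4 * (a * b) \<le> (a + b)\<^sup>2" using zero_le_power2[of "a - b"] by (simp add: power2_eq_square algebra_simps)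
  ultimately have "a * b \<le> 1 / (p * q)" by simp
  then have ab: "a * p * (b * q) \<le> 1" using p q by (simp add: field_simps)
  have "(\<integral>\<^sup>+x. ennreal (U x) \<partial>lborel) = (\<integral>\<^sup>+x. ennreal p * ennreal (U x / p) \<partial>lborel)"
    using p nonneg by (intro nn_integral_cong) (simp flip: ennreal_mult)
  also have "\<dots> = ennreal (a * p)"
    using p a by (subst nn_integral_cmult) (auto simp: ennreal_mult mult.commute)
  finally have Ua: "(\<integral>\<^sup>+x. ennreal (U x) \<partial>lborel) = ennreal (a * p)" .
  have "(\<integral>\<^sup>+x. ennreal (V x) \<partial>lborel) = (\<integral>\<^sup>+x. ennreal q * ennreal (V x / q) \<partial>lborel)"
    using q nonneg by (intro nn_integral_cong) (simp flip: ennreal_mult)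
  also have "\<dots> = ennreal (b * q)"
    using q b by (subst nn_integral_cmult) (auto simp: ennreal_mult mult.commute)
  finally have Vb: "(\<integral>\<^sup>+x. ennreal (V x) \<partial>lborel) = ennreal (b * q)" .
  show ?thesis
    unfolding U_int V_int Ua Vb using ab a b p q by (simp flip: ennreal_mult)
qed

section \<open>Standard Gaussian vectors and tensorization\<close>

abbreviation gauss :: "nat \<Rightarrow> (nat \<Rightarrow> real) measure" where
  "gauss n \<equiv> Pi\<^sub>M {..<n} (\<lambda>_. std_normal_distribution)"

lemma prob_space_std_normal: "prob_space std_normal_distribution"
  using real_dist_normal_dist by (simp add: real_distribution_def)

lemma product_sigma_finite_std_normal: "product_sigma_finite (\<lambda>_. std_normal_distribution)"
  using prob_space_std_normal
  by (intro product_sigma_finite.intro prob_space_imp_sigma_finite)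

lemma prob_space_gauss: "prob_space (gauss n)"
  by (intro prob_space_PiM prob_space_std_normal)

text \<open>Tensorization: for fixed last coordinates \<open>s\<close> and \<open>t\<close> the
  factor exp(-(s - t)^2 / 4), moved into \<open>u\<close>, gives the hypothesis in dimension
  \<open>n\<close>. The induction hypothesis then says that the partial integrals over the other
  coordinates satisfy the one-dimensional hypothesis.\<close>

lemma maurey_property:
  fixes u v :: "(nat \<Rightarrow> real) \<Rightarrow> ennreal"
  assumes "u \<in> borel_measurable (gauss n)" "v \<in> borel_measurable (gauss n)"
    and "\<And>x y. x \<in> space (gauss n) \<Longrightarrow> y \<in> space (gauss n) \<Longrightarrow>
           u x * v y \<le> ennreal (exp ((\<Sum>i<n. (x i - y i)\<^sup>2) / 4))"
  shows "(\<integral>\<^sup>+x. u x \<partial>gauss n) * (\<integral>\<^sup>+x. v x \<partial>gauss n) \<le> 1"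
  using assms
proof (induction n arbitrary: u v)
  case 0
  then show ?case by (simp add: PiM_empty nn_integral_count_space_finite)
next
  case (Suc n)
  note [measurable] = Suc.prems(1,2)
  have ins: "{..<Suc n} = insert n {..<n}" by auto
  note [measurable] = Suc.prems(1,2)[unfolded ins]
  define U where "U s = (\<integral>\<^sup>+x. u (x(n := s)) \<partial>gauss n)" for s
  define V where "V s = (\<integral>\<^sup>+x. v (x(n := s)) \<partial>gauss n)" for s
  have upd: "(\<lambda>x. x(n := s)) \<in> measurable (gauss n) (Pi\<^sub>M (insert n {..<n}) (\<lambda>_. std_normal_distribution))" for s
    by (rule measurable_fun_upd[where J = "{..<n}"]) auto
  have um: "(\<lambda>x. u (x(n := s))) \<in> borel_measurable (gauss n)"
    and vm: "(\<lambda>x. v (x(n := s))) \<in> borel_measurable (gauss n)" for s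
    using measurable_compose[OF upd Suc.prems(1)[unfolded ins]] measurable_compose[OF upd Suc.prems(2)[unfolded ins]]
    by auto
  note [measurable] = um vm
  have UV: "U s * V t \<le> ennreal (exp ((s - t)\<^sup>2 / 4))" for s t
  proof -
    define c where "c = exp (- ((s - t)\<^sup>2 / 4))"
    have "(\<integral>\<^sup>+x. u (x(n := s)) * ennreal c \<partial>gauss n) * (\<integral>\<^sup>+x. v (x(n := t)) \<partial>gauss n) \<le> 1"
    proof (rule Suc.IH)
      fix x y assume xy: "x \<in> space (gauss n)" "y \<in> space (gauss n)"
      have "u (x(n := s)) * v (y(n := t)) \<le> ennreal (exp ((\<Sum>i<Suc n. ((x(n := s)) i - (y(n := t)) i)\<^sup>2) / 4))"
        using xy by (intro Suc.prems(3)) (auto simp: space_PiM PiE_def extensional_def Pi_def less_Suc_eq)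
      also have "(\<Sum>i<Suc n. ((x(n := s)) i - (y(n := t)) i)\<^sup>2) = (\<Sum>i<n. (x i - y i)\<^sup>2) + (s - t)\<^sup>2"
        by simp
      finally have "u (x(n := s)) * v (y(n := t)) * ennreal c
          \<le> ennreal (exp (((\<Sum>i<n. (x i - y i)\<^sup>2) + (s - t)\<^sup>2) / 4)) * ennreal c"
        by (rule mult_right_mono) simp
      also have "\<dots> = ennreal (exp (((\<Sum>i<n. (x i - y i)\<^sup>2)) / 4))"
        by (simp add: c_def add_divide_distrib exp_add flip: ennreal_mult exp_add)
      finally show "u (x(n := s)) * ennreal c * v (y(n := t)) \<le> \<dots>" by (simp add: ac_simps)
    qed measurable
    then have "U s * V t * ennreal c \<le> 1"
      unfolding U_def V_def by (subst (asm) nn_integral_multc) (auto simp: ac_simps)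
    then have "U s * V t * ennreal c * ennreal (exp ((s - t)\<^sup>2 / 4)) \<le> 1 * ennreal (exp ((s - t)\<^sup>2 / 4))"
      by (rule mult_right_mono) simp
    moreover have "ennreal c * ennreal (exp ((s - t)\<^sup>2 / 4)) = 1"
      by (simp add: c_def flip: ennreal_mult exp_add)
    ultimately show ?thesis by (simp add: mult.assoc)
  qed
  have [measurable]: "U \<in> borel_measurable borel" "V \<in> borel_measurable borel"
  proof -
    interpret prob_space "gauss n" by (rule prob_space_gauss)
    have "(\<lambda>(s, x). x(n := s)) \<in> measurable (std_normal_distribution \<Otimes>\<^sub>M gauss n) (Pi\<^sub>M (insert n {..<n}) (\<lambda>_. std_normal_distribution))"
      by measurable
    from measurable_compose[OF this Suc.prems(1)[unfolded ins]] measurable_compose[OF this Suc.prems(2)[unfolded ins]]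
    have "(\<lambda>(s, x). u (x(n := s))) \<in> borel_measurable (std_normal_distribution \<Otimes>\<^sub>M gauss n)"
      "(\<lambda>(s, x). v (x(n := s))) \<in> borel_measurable (std_normal_distribution \<Otimes>\<^sub>M gauss n)"
      by (simp_all add: case_prod_beta)
    from this[THEN borel_measurable_nn_integral]
    show "U \<in> borel_measurable borel" "V \<in> borel_measurable borel"
      by (simp_all add: U_def[abs_def] V_def[abs_def] measurable_def)
  qed
  have "(\<integral>\<^sup>+x. u x \<partial>gauss (Suc n)) = (\<integral>\<^sup>+s. U s \<partial>std_normal_distribution)"
    unfolding ins U_def by (rule product_sigma_finite.product_nn_integral_insert_rev[OF product_sigma_finite_std_normal]) auto
  moreover have "(\<integral>\<^sup>+x. v x \<partial>gauss (Suc n)) = (\<integral>\<^sup>+s. V s \<partial>std_normal_distribution)"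
    unfolding ins V_def by (rule product_sigma_finite.product_nn_integral_insert_rev[OF product_sigma_finite_std_normal]) auto
  ultimately show ?case using maurey_property_1d[OF _ _ UV] by simp
qed

lemma iexp_gauss:
  "(LINT x|gauss n. iexp (\<Sum>i<n. x i * c i)) = complex_of_real (exp (- (\<Sum>i<n. (c i)\<^sup>2) / 2))"
proof -
  have "(LINT x|gauss n. iexp (\<Sum>i<n. x i * c i)) = (LINT x|gauss n. (\<Prod>i<n. iexp (c i * x i)))"
    by (simp add: sum_distrib_left exp_sum mult.commute)
  also have "\<dots> = (\<Prod>i<n. LINT s|std_normal_distribution. iexp (c i * s))"
  proof (rule product_sigma_finite.product_integral_prod[OF product_sigma_finite_std_normal])
    fix i
    interpret prob_space std_normal_distribution by (rule prob_space_std_normal)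
    show "integrable std_normal_distribution (\<lambda>s. iexp (c i * s))"
      by (rule integrable_const_bound[where B = 1]) auto
  qed simp
  also have "\<dots> = (\<Prod>i<n. char std_normal_distribution (c i))" by (simp add: char_def)
  also have "\<dots> = complex_of_real (exp (- (\<Sum>i<n. (c i)\<^sup>2) / 2))"
    unfolding char_std_normal_distribution
    by (simp add: sum_divide_distrib exp_sum flip: exp_of_real sum_negf)
  finally show ?thesis .
qed

lemma measurable_gauss_component [measurable (raw)]:
  "i < n \<Longrightarrow> (\<lambda>x. x i) \<in> borel_measurable (gauss n)"
  using measurable_component_singleton[of i "{..<n}" "\<lambda>_. std_normal_distribution"]
    measurable_cong_sets[OF refl sets_density[of lborel std_normal_density], of "gauss n"]
  by (auto simp: measurable_lborel1)

lemma integrable_gauss_sum_squares: "integrable (gauss n) (\<lambda>x. \<Sum>i<n. (x i)\<^sup>2)"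
proof (rule Bochner_Integration.integrable_sum)
  fix i assume i: "i \<in> {..<n}"
  have "integrable (distr (gauss n) std_normal_distribution (\<lambda>x. x i)) (\<lambda>s. s\<^sup>2)"
    using distr_PiM_component[of "{..<n}" "\<lambda>_. std_normal_distribution" i] i prob_space_std_normal
      integrable_std_normal_distribution_moment[of 2] by simp
  then show "integrable (gauss n) (\<lambda>x. (x i)\<^sup>2)"
    using i by (subst (asm) integrable_distr_eq) (auto simp: measurable_component_singleton)
qed

text \<open>Jensen's inequality from the tangent of exp at the mean. With a nonnegative integral on
  the right, integrability of exp of \<open>f\<close> is not presupposed.\<close>

lemma exp_le_nn_integral_exp:
  assumes "prob_space M" and f: "integrable M f"
  shows "ennreal (exp (integral\<^sup>L M f)) \<le> (\<integral>\<^sup>+x. ennreal (exp (f x)) \<partial>M)"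
proof (cases "(\<integral>\<^sup>+x. ennreal (exp (f x)) \<partial>M) = \<infinity>")
  case False
  interpret prob_space M by fact
  have [measurable]: "f \<in> borel_measurable M" using f by auto
  have int: "integrable M (\<lambda>x. exp (f x))"
    using False by (intro integrableI_nonneg) (auto simp: less_top)
  define m where "m = integral\<^sup>L M f"
  have "exp m = (LINT x|M. exp m * (1 + (f x - m)))"
    using f by (simp add: m_def prob_space)
  also have "\<dots> \<le> (LINT x|M. exp (f x))"
  proof (intro integral_mono int)
    fix x
    have "exp m * (1 + (f x - m)) \<le> exp m * exp (f x - m)"
      by (intro mult_left_mono) auto
    then show "exp m * (1 + (f x - m)) \<le> exp (f x)" by (simp flip: exp_add)
  qed (use f in auto)
  finally show ?thesis by (subst nn_integral_eq_integral[OF int]) (auto simp: m_def intro: ennreal_leI)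
qed auto

lemma borel_measurable_blinfun_apply [measurable (raw)]:
  "f \<in> borel_measurable M \<Longrightarrow> (\<lambda>x. blinfun_apply l (f x)) \<in> borel_measurable M"
  by (rule measurable_compose[of f M borel])
    (auto intro!: borel_measurable_continuous_onI linear_continuous_on blinfun.bounded_linear_right)

lemma borel_measurable_cis [measurable (raw)]:
  "f \<in> borel_measurable M \<Longrightarrow> (\<lambda>x. cis (f x)) \<in> borel_measurable M"
  by (rule measurable_compose[of f M borel])
    (auto intro!: borel_measurable_continuous_onI continuous_intros)

lemma integrable_bounded:
  fixes f :: "'a \<Rightarrow> 'b::{banach, second_countable_topology}"
  assumes "prob_space M" "f \<in> borel_measurable M" "\<And>x. norm (f x) \<le> B"
  shows "integrable M f"
  using assms by (intro finite_measure.integrable_const_bound[of M f B]) (auto simp: prob_space.finite_measure)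

lemma Fubini_bounded:
  fixes f :: "'a \<Rightarrow> 'b \<Rightarrow> 'c::{banach, second_countable_topology}"
  assumes "prob_space M" "prob_space N" "case_prod f \<in> borel_measurable (M \<Otimes>\<^sub>M N)" "\<And>x y. norm (f x y) \<le> B"
  shows "(LINT y|N. LINT x|M. f x y) = (LINT x|M. LINT y|N. f x y)"
proof -
  interpret M: prob_space M by fact
  interpret N: prob_space N by fact
  interpret P: pair_prob_space M N ..
  have "prob_space (M \<Otimes>\<^sub>M N)" by (rule P.P.prob_space_axioms)
  then show ?thesis
    using assms by (intro P.Fubini_integral integrable_bounded[where B = B]) auto
qed

text \<open>Scaling covers the point mass at variance 0 too, which spares later computations the
  case distinction of \<open>normal_law\<close>.\<close>

lemma normal_law_conv_std_normal:
  assumes "0 \<le> v"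
  shows "normal_law 0 v = distr std_normal_distribution borel (\<lambda>s. sqrt v * s)"
proof (cases "v = 0")
  case True
  interpret prob_space std_normal_distribution by (rule prob_space_std_normal)
  show ?thesis using True by (simp add: normal_law_def distr_const)
next
  case False
  interpret prob_space std_normal_distribution by (rule prob_space_std_normal)
  have "distributed std_normal_distribution lborel (\<lambda>s. s) std_normal_density"
    by (auto simp: distributed_def distr_id2)
  from normal_density_affine[OF this, of "sqrt v" 0] False assms
  have "distributed std_normal_distribution lborel (\<lambda>s. sqrt v * s) (normal_density 0 (sqrt v))" by simp
  then have "distr std_normal_distribution lborel (\<lambda>s. sqrt v * s) = density lborel (normal_density 0 (sqrt v))"
    by (simp add: distributed_def)
  moreover have "distr std_normal_distribution lborel (\<lambda>s. sqrt v * s) = distr std_normal_distribution borel (\<lambda>s. sqrt v * s)"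
    by (rule distr_cong) auto
  ultimately show ?thesis using False by (simp add: normal_law_def)
qed

lemma iexp_normal_law:
  assumes "0 \<le> v"
  shows "(LINT s|normal_law 0 v. iexp (r * s)) = exp (- (complex_of_real (r\<^sup>2) * complex_of_real (v / 2)))"
proof -
  have "(LINT s|normal_law 0 v. iexp (r * s)) = (LINT s|std_normal_distribution. iexp (r * (sqrt v * s)))"
    unfolding normal_law_conv_std_normal[OF assms] by (subst integral_distr) auto
  also have "\<dots> = char std_normal_distribution (r * sqrt v)"
    by (simp add: char_def mult.assoc)
  also have "\<dots> = complex_of_real (exp (- (r\<^sup>2 * (v / 2))))"
    using assms by (simp add: char_std_normal_distribution power_mult_distrib)
  also have "\<dots> = exp (- (complex_of_real (r\<^sup>2) * complex_of_real (v / 2)))"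
    by (simp flip: exp_of_real)
  finally show ?thesis .
qed

lemma second_moment_normal_law:
  assumes "0 \<le> v"
  shows "(\<integral>\<^sup>+s. ennreal (s\<^sup>2) \<partial>normal_law 0 v) = ennreal v"
proof -
  have "(\<integral>\<^sup>+s. ennreal (s\<^sup>2) \<partial>normal_law 0 v) = (\<integral>\<^sup>+s. ennreal v * ennreal (s\<^sup>2) \<partial>std_normal_distribution)"
    unfolding normal_law_conv_std_normal[OF assms] using assms
    by (subst nn_integral_distr) (auto simp: power_mult_distrib ennreal_mult)
  also have "\<dots> = ennreal v * (\<integral>\<^sup>+s. ennreal (s\<^sup>2) \<partial>std_normal_distribution)"
    by (rule nn_integral_cmult) simp
  also have "(\<integral>\<^sup>+s. ennreal (s\<^sup>2) \<partial>std_normal_distribution) = ennreal (LINT s|std_normal_distribution. s\<^sup>2)"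
    by (intro nn_integral_eq_integral integrable_std_normal_distribution_moment) simp
  also have "(LINT s|std_normal_distribution. s\<^sup>2) = 1"
    using std_normal_distribution_even_moments(1)[of 1] by simp
  finally show ?thesis by simp
qed

lemma integral_exp_square_std_normal:
  "(LINT s|std_normal_distribution. exp (- (s\<^sup>2 / 2))) = 1 / sqrt 2"
proof -
  have "(LINT s|std_normal_distribution. exp (- (s\<^sup>2 / 2)))
      = (LINT s|lborel. std_normal_density s * exp (- (s\<^sup>2 / 2)))"
    by (subst integral_density) auto
  also have "\<dots> = (LINT s|lborel. 1 / sqrt 2 * normal_density 0 (1 / sqrt 2) s)"
  proof (intro Bochner_Integration.integral_cong refl)
    fix s :: real
    have "exp (- s\<^sup>2 / 2) * exp (- (s\<^sup>2 / 2)) = exp (- s\<^sup>2)" by (simp flip: exp_add)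
    then show "std_normal_density s * exp (- (s\<^sup>2 / 2)) = 1 / sqrt 2 * normal_density 0 (1 / sqrt 2) s"
      by (simp add: normal_density_def power_divide real_sqrt_mult)
  qed
  also have "\<dots> = 1 / sqrt 2" by (simp add: integral_normal_density)
  finally show ?thesis .
qed

section \<open>Orthonormal separating functionals\<close>

definition sublinear :: "('e::real_vector \<Rightarrow> real) \<Rightarrow> bool" where
  "sublinear p \<longleftrightarrow> p 0 = 0 \<and> (\<forall>x y. p (x + y) \<le> p x + p y) \<and> (\<forall>c>0. \<forall>x. p (c *\<^sub>R x) \<le> c * p x)"

text \<open>Scaling back by \<open>inverse c\<close> yields the reverse inequality; the definition
  asks only for the one that is easy to check for infima.\<close>

lemma sublinear_scaleR:
  assumes "sublinear p" "0 \<le> c"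
  shows "p (c *\<^sub>R x) = c * p x"
proof (cases "c = 0")
  case True
  with assms show ?thesis by (simp add: sublinear_def)
next
  case False
  with assms have "p (c *\<^sub>R x) \<le> c * p x" by (simp add: sublinear_def)
  moreover have "p (inverse c *\<^sub>R (c *\<^sub>R x)) \<le> inverse c * p (c *\<^sub>R x)"
    using assms False unfolding sublinear_def by (metis inverse_positive_iff_positive less_le)
  ultimately show ?thesis using False assms by (simp add: field_simps)
qed

lemma sublinear_minus:
  assumes "sublinear p"
  shows "- p (- x) \<le> p x"
proof -
  have "p (x + - x) \<le> p x + p (- x)" "p 0 = 0" using assms unfolding sublinear_def by blast+
  then show ?thesis by simp
qed

text \<open>Tilting a sublinear functional along \<open>y\<close>; a minimal sublinear functional is a fixed
  point for every \<open>y\<close>, which makes it additive.\<close>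

definition tilt :: "('e::real_vector \<Rightarrow> real) \<Rightarrow> 'e \<Rightarrow> 'e \<Rightarrow> real" where
  "tilt q y x = (INF t\<in>{0..}. q (x + t *\<^sub>R y) - t * q y)"

lemma tilt:
  assumes q: "sublinear q"
  shows "sublinear (tilt q y)" "tilt q y x \<le> q x" "tilt q y x \<le> q (x + y) - q y"
proof -
  have add: "q (a + b) \<le> q a + q b" for a b using q by (simp add: sublinear_def)
  have bdd: "bdd_below ((\<lambda>t. q (x + t *\<^sub>R y) - t * q y) ` {0..})" for x
  proof (intro bdd_belowI2)
    fix t :: real assume "t \<in> {0..}"
    then show "- q (- x) \<le> q (x + t *\<^sub>R y) - t * q y"
      using add[of "x + t *\<^sub>R y" "- x"] sublinear_scaleR[OF q, of t y] by simp
  qed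
  have le: "tilt q y x \<le> q (x + t *\<^sub>R y) - t * q y" if "0 \<le> t" for x t
    unfolding tilt_def using that by (intro cINF_lower bdd) auto
  have ge: "c \<le> tilt q y x" if "\<And>t. 0 \<le> t \<Longrightarrow> c \<le> q (x + t *\<^sub>R y) - t * q y" for x c
    unfolding tilt_def using that by (intro cINF_greatest) auto
  show "tilt q y x \<le> q x" "tilt q y x \<le> q (x + y) - q y"
    using le[of 0 x] le[of 1 x] by auto
  have "tilt q y 0 \<le> 0" using le[of 0 0] q by (simp add: sublinear_def)
  moreover have "0 \<le> tilt q y 0" using sublinear_scaleR[OF q] by (intro ge) simp
  moreover have "tilt q y (a + b) \<le> tilt q y a + tilt q y b" for a b
  proof -
    have "tilt q y (a + b) - tilt q y b \<le> tilt q y a"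
    proof (rule ge)
      fix s :: real assume "0 \<le> s"
      have "tilt q y (a + b) - (q (a + s *\<^sub>R y) - s * q y) \<le> tilt q y b"
      proof (rule ge)
        fix t :: real assume "0 \<le> t"
        have "tilt q y (a + b) \<le> q (a + b + (s + t) *\<^sub>R y) - (s + t) * q y"
          using \<open>0 \<le> s\<close> \<open>0 \<le> t\<close> by (intro le) simp
        also have "a + b + (s + t) *\<^sub>R y = (a + s *\<^sub>R y) + (b + t *\<^sub>R y)" by (simp add: algebra_simps)
        also have "q \<dots> \<le> q (a + s *\<^sub>R y) + q (b + t *\<^sub>R y)" by (rule add)
        finally show "tilt q y (a + b) - (q (a + s *\<^sub>R y) - s * q y) \<le> q (b + t *\<^sub>R y) - t * q y"
          by (simp add: algebra_simps)
      qed
      then show "tilt q y (a + b) - tilt q y b \<le> q (a + s *\<^sub>R y) - s * q y" by simp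
    qed
    then show ?thesis by simp
  qed
  moreover have "tilt q y (c *\<^sub>R a) \<le> c * tilt q y a" if "0 < c" for c a
  proof -
    have "tilt q y (c *\<^sub>R a) / c \<le> tilt q y a"
    proof (rule ge)
      fix t :: real assume "0 \<le> t"
      have "tilt q y (c *\<^sub>R a) \<le> q (c *\<^sub>R a + (c * t) *\<^sub>R y) - (c * t) * q y"
        using \<open>0 < c\<close> \<open>0 \<le> t\<close> by (intro le) simp
      also have "c *\<^sub>R a + (c * t) *\<^sub>R y = c *\<^sub>R (a + t *\<^sub>R y)" by (simp add: algebra_simps)
      also have "q \<dots> = c * q (a + t *\<^sub>R y)" using q \<open>0 < c\<close> by (simp add: sublinear_scaleR)
      finally show "tilt q y (c *\<^sub>R a) / c \<le> q (a + t *\<^sub>R y) - t * q y"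
        using \<open>0 < c\<close> by (simp add: field_simps)
    qed
    then show ?thesis using \<open>0 < c\<close> by (simp add: field_simps)
  qed
  ultimately show "sublinear (tilt q y)" unfolding sublinear_def by force
qed

text \<open>Zorn's lemma is applied to sublinear functionals below \<open>p\<close>, ordered
  downwards, instead of to partial extensions. The pointwise infimum of a chain stays real because
  each member satisfies q x >= - q (- x) >= - p (- x).\<close>

lemma hahn_banach_sublinear:
  fixes p :: "'e::real_vector \<Rightarrow> real"
  assumes "sublinear p"
  obtains f where "linear f" "\<And>x. f x \<le> p x"
proof -
  define A where "A = {q. sublinear q \<and> q \<le> p}"
  have "\<exists>m\<in>A. \<forall>a\<in>A. m \<ge> a \<longrightarrow> a = m"
  proof (rule predicate_Zorn)
    show "partial_order_on A (relation_of (\<ge>) A)"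
      by (rule partial_order_on_relation_ofI) auto
    fix C assume "C \<in> Chains (relation_of (\<ge>) A)"
    then have CA: "C \<subseteq> A" and chain: "\<And>a b. a \<in> C \<Longrightarrow> b \<in> C \<Longrightarrow> a \<le> b \<or> b \<le> a"
      by (auto simp: Chains_def relation_of_def)
    show "\<exists>u\<in>A. \<forall>a\<in>C. a \<ge> u"
    proof (cases "C = {}")
      case True
      then show ?thesis using assms by (auto simp: A_def)
    next
      case False
      define u where "u x = (INF q\<in>C. q x)" for x
      have subl: "sublinear q" and qp: "q \<le> p" if "q \<in> C" for q using that CA by (auto simp: A_def)
      have bdd: "bdd_below ((\<lambda>q. q x) ` C)" for x
      proof (intro bdd_belowI2)
        fix q assume "q \<in> C"
        show "- p (- x) \<le> q x"
          using sublinear_minus[OF subl[OF \<open>q \<in> C\<close>], of x] le_funD[OF qp[OF \<open>q \<in> C\<close>], of "- x"] by simp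
      qed
      have le: "u x \<le> q x" if "q \<in> C" for x q unfolding u_def using that by (intro cINF_lower bdd)
      have ge: "c \<le> u x" if "\<And>q. q \<in> C \<Longrightarrow> c \<le> q x" for x c
        unfolding u_def using that False by (intro cINF_greatest) auto
      have "u 0 = 0"
      proof -
        have "(\<lambda>q. q 0) ` C = {0::real}" using False subl by (force simp: sublinear_def)
        then show ?thesis by (simp add: u_def)
      qed
      moreover have "u (x + y) \<le> u x + u y" for x y
      proof -
        have "u (x + y) - u y \<le> u x"
        proof (rule ge)
          fix q1 assume q1: "q1 \<in> C"
          have "u (x + y) - q1 x \<le> u y"
          proof (rule ge)
            fix q2 assume q2: "q2 \<in> C"
            \<comment> \<open>Subadditivity passes to the infimum because a chain contains a member
              below both \<open>q1\<close> and \<open>q2\<close>.\<close>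
            obtain q where q: "q \<in> C" "q \<le> q1" "q \<le> q2" using chain[OF q1 q2] q1 q2 by auto
            have "u (x + y) \<le> q x + q y"
              using le[OF q(1), of "x + y"] subl[OF q(1)] by (auto simp: sublinear_def intro: order.trans)
            also have "\<dots> \<le> q1 x + q2 y" using q by (intro add_mono) (auto dest: le_funD)
            finally show "u (x + y) - q1 x \<le> q2 y" by simp
          qed
          then show "u (x + y) - u y \<le> q1 x" by simp
        qed
        then show ?thesis by simp
      qed
      moreover have "u (c *\<^sub>R x) \<le> c * u x" if "0 < c" for c x
      proof -
        have "u (c *\<^sub>R x) / c \<le> u x"
        proof (rule ge)
          fix q assume "q \<in> C"
          then show "u (c *\<^sub>R x) / c \<le> q x"
            using le[of q "c *\<^sub>R x"] sublinear_scaleR[OF subl, of q c x] \<open>0 < c\<close> by (simp add: field_simps)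
        qed
        then show ?thesis using \<open>0 < c\<close> by (simp add: field_simps)
      qed
      ultimately have "sublinear u" by (simp add: sublinear_def)
      moreover have "u \<le> p" using False le qp by (meson ex_in_conv le_fun_def order.trans)
      ultimately show ?thesis using le by (auto simp: A_def le_fun_def)
    qed
  qed
  then obtain f where f: "sublinear f" "f \<le> p" and min: "\<And>q. sublinear q \<Longrightarrow> q \<le> f \<Longrightarrow> q = f"
    unfolding A_def by (auto intro: order.trans)
  have "tilt f y = f" for y
    using tilt[OF f(1)] by (intro min) (auto simp: le_fun_def)
  then have super: "f x + f y \<le> f (x + y)" for x y
    using tilt(3)[OF f(1), of y x] by simp
  then have add: "f (x + y) = f x + f y" for x y
    using f(1) by (auto simp: sublinear_def intro: antisym)
  have neg: "f (- x) = - f x" for x using add[of x "- x"] f(1) by (simp add: sublinear_def)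
  have "linear f"
  proof (rule linearI)
    fix c x
    show "f (c *\<^sub>R x) = c *\<^sub>R f x"
    proof (cases "0 \<le> c")
      case True
      then show ?thesis using sublinear_scaleR[OF f(1)] by simp
    next
      case False
      then have "f (- ((- c) *\<^sub>R x)) = c * f x" unfolding neg using sublinear_scaleR[OF f(1), of "- c" x] by simp
      then show ?thesis by simp
    qed
  qed (rule add)
  with f(2) show thesis by (intro that) (auto simp: le_fun_def)
qed

text \<open>Domination by \<open>tilt norm x\<close> rather than by \<open>norm\<close> forces f (-
  x) <= norm 0 - norm x, which fixes the value at \<open>x\<close>; no functional has to be extended
  from the line through \<open>x\<close>.\<close>

lemma norming_functional:
  fixes x :: "'e::real_normed_vector"
  obtains l :: "'e \<Rightarrow>\<^sub>L real" where "\<And>y. \<bar>blinfun_apply l y\<bar> \<le> norm y" "blinfun_apply l x = norm x"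
proof -
  have n: "sublinear (norm :: 'e \<Rightarrow> real)"
    unfolding sublinear_def by (auto intro: norm_triangle_ineq)
  obtain f where f: "linear f" "\<And>y. f y \<le> tilt norm x y"
    using hahn_banach_sublinear[OF tilt(1)[OF n, of x]] by blast
  interpret linear f by fact
  have le: "f y \<le> norm y" for y using f(2)[of y] tilt(2)[OF n, of x y] by linarith
  have abs_le: "\<bar>f y\<bar> \<le> norm y" for y using le[of y] le[of "- y"] by (simp add: neg abs_le_iff)
  have "f (- x) \<le> - norm x" using f(2)[of "- x"] tilt(3)[OF n, of x "- x"] by simp
  then have "f x = norm x" using le[of x] by (simp add: neg)
  moreover have "bounded_linear f"
    using abs_le by (intro bounded_linear_intro[of _ 1] add scale) auto
  ultimately show thesis
    using abs_le by (intro that[of "Blinfun f"]) (auto simp: bounded_linear_Blinfun_apply)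
qed

text \<open>Norming functionals of a countable dense set suffice: if all of them vanish at x, then
  each dense d has norm d = l (d - x) <= norm (d - x), so norm x <= 2 * norm (x - d), which can be
  made arbitrarily small.\<close>

lemma separating_functionals:
  obtains l :: "nat \<Rightarrow> 'e::{real_normed_vector, second_countable_topology} \<Rightarrow>\<^sub>L real"
  where "\<And>x. (\<And>k. blinfun_apply (l k) x = 0) \<Longrightarrow> x = 0"
proof -
  obtain D :: "'e set" where D: "countable D" "\<And>X. open X \<Longrightarrow> X \<noteq> {} \<Longrightarrow> \<exists>d\<in>D. d \<in> X"
    using countable_dense_setE[where 'a = 'e] by blast
  then have "D \<noteq> {}" using D(2)[of UNIV] by auto
  have "\<forall>k. \<exists>l :: 'e \<Rightarrow>\<^sub>L real. (\<forall>y. \<bar>blinfun_apply l y\<bar> \<le> norm y)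
      \<and> blinfun_apply l (from_nat_into D k) = norm (from_nat_into D k)"
  proof
    fix k
    show "\<exists>l :: 'e \<Rightarrow>\<^sub>L real. (\<forall>y. \<bar>blinfun_apply l y\<bar> \<le> norm y)
      \<and> blinfun_apply l (from_nat_into D k) = norm (from_nat_into D k)"
      using norming_functional[of "from_nat_into D k"] by blast
  qed
  from choice[OF this] obtain l :: "nat \<Rightarrow> 'e \<Rightarrow>\<^sub>L real" where l: "\<And>k y. \<bar>blinfun_apply (l k) y\<bar> \<le> norm y"
    "\<And>k. blinfun_apply (l k) (from_nat_into D k) = norm (from_nat_into D k)" by blast
  show thesis
  proof (rule that)
    fix x assume zero: "\<And>k. blinfun_apply (l k) x = 0"
    have "norm x \<le> 0"
    proof (rule field_le_epsilon)
      fix e :: real assume "0 < e"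
      then obtain d where d: "d \<in> D" "d \<in> ball x (e / 2)" using D(2)[of "ball x (e / 2)"] by auto
      then obtain k where k: "d = from_nat_into D k"
        using D(1) by (metis from_nat_into_surj)
      have "norm d = blinfun_apply (l k) (d - x)"
        using l(2)[of k] zero[of k] by (simp add: k blinfun.diff_right)
      also have "\<dots> \<le> norm (d - x)" using l(1)[of k "d - x"] by linarith
      finally have "norm d \<le> norm (d - x)" .
      then have "norm x \<le> 2 * norm (x - d)" using norm_triangle_sub[of x d] by (simp add: norm_minus_commute)
      also have "\<dots> \<le> 0 + e" using d by (simp add: dist_norm)
      finally show "norm x \<le> 0 + e" .
    qed
    then show "x = 0" by simp
  qed
qed

section \<open>The dual embedding and orthonormalization of functionals\<close>

lemma dual_emb_inner:
  fixes j :: "'h::{real_inner, complete_space} \<Rightarrow> 'e::real_normed_vector"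
  assumes "bounded_linear j"
  shows "inner (dual_emb j l) x = blinfun_apply l (j x)"
  using dual_emb_iff[OF assms, of l "dual_emb j l"] by auto

lemma linear_dual_emb:
  fixes j :: "'h::{real_inner, complete_space} \<Rightarrow> 'e::real_normed_vector"
  assumes "bounded_linear j"
  shows "linear (dual_emb j)"
  by (intro linearI)
    (auto simp: dual_emb_iff[OF assms] dual_emb_inner[OF assms] inner_add_left blinfun.add_left blinfun.scaleR_left)

text \<open>Density of H in E enters here: a functional vanishing on H vanishes on its
  closure.\<close>

lemma dual_emb_eq_0:
  fixes j :: "'h::{real_inner, complete_space} \<Rightarrow> 'e::real_normed_vector"
  assumes j: "dense_embedding j" and 0: "dual_emb j l = 0"
  shows "l = 0"
proof -
  have bl: "bounded_linear j" and dense: "closure (range j) = UNIV" using j by (auto simp: dense_embedding_def)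
  have "blinfun_apply l (j x) = 0" for x using dual_emb_inner[OF bl, of l x] 0 by simp
  then have "range j \<subseteq> {z. blinfun_apply l z = 0}" by auto
  moreover have "closed {z. blinfun_apply l z = 0}"
    by (intro closed_Collect_eq continuous_intros)
  ultimately have "closure (range j) \<subseteq> {z. blinfun_apply l z = 0}" by (rule closure_minimal)
  then show ?thesis using dense by (intro blinfun_eqI) auto
qed

text \<open>The Gram-Schmidt procedure for the inner product pulled back along \<open>T\<close>. It
  acts on functionals and not on their images, so the results can still be evaluated at all points
  of E. If \<open>T r\<close> is 0, division by zero makes the new functional 0.\<close>

fun gram_schmidt :: "('e::real_normed_vector \<Rightarrow>\<^sub>L real \<Rightarrow> 'h::real_inner) \<Rightarrow> (nat \<Rightarrow> 'e \<Rightarrow>\<^sub>L real) \<Rightarrow> nat \<Rightarrow> 'e \<Rightarrow>\<^sub>L real" where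
  "gram_schmidt T l n =
    (let r = l n - (\<Sum>i<n. inner (T (l n)) (T (gram_schmidt T l i)) *\<^sub>R gram_schmidt T l i)
     in r /\<^sub>R norm (T r))"

declare gram_schmidt.simps [simp del]

text \<open>Functionals already in the span of their predecessors yield zeros in the sequence below.\<close>

lemma orthonormal_functionals:
  fixes j :: "'h::{real_inner, complete_space} \<Rightarrow> 'e::{real_normed_vector, second_countable_topology}"
  assumes j: "dense_embedding j"
  obtains L :: "nat \<Rightarrow> 'e \<Rightarrow>\<^sub>L real"
  where "\<And>i k. i \<noteq> k \<Longrightarrow> inner (dual_emb j (L i)) (dual_emb j (L k)) = 0"
    and "\<And>i. L i = 0 \<or> norm (dual_emb j (L i)) = 1"
    and "\<And>x. (\<And>k. blinfun_apply (L k) x = 0) \<Longrightarrow> x = 0"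
proof -
  have bl: "bounded_linear j" using j by (auto simp: dense_embedding_def)
  define T where "T = dual_emb j"
  interpret T: linear T unfolding T_def by (rule linear_dual_emb[OF bl])
  have T0: "l = 0" if "T l = 0" for l using dual_emb_eq_0[OF j] that by (simp add: T_def)
  obtain l :: "nat \<Rightarrow> 'e \<Rightarrow>\<^sub>L real" where sep: "\<And>x. (\<And>k. blinfun_apply (l k) x = 0) \<Longrightarrow> x = 0"
    using separating_functionals[where 'e = 'e] by blast
  define L where "L = gram_schmidt T l"
  define r where "r n = l n - (\<Sum>i<n. inner (T (l n)) (T (L i)) *\<^sub>R L i)" for n
  have L: "L n = r n /\<^sub>R norm (T (r n))" for n
    unfolding L_def r_def by (subst gram_schmidt.simps) (simp add: Let_def)
  have L01: "L n = 0 \<or> norm (T (L n)) = 1" for n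
    using T0[of "r n"] by (auto simp: L T.scale)
  have orth: "\<forall>k<n. inner (T (L n)) (T (L k)) = 0" for n
  proof (induction n rule: less_induct)
    case (less n)
    have "inner (T (r n)) (T (L k)) = 0" if "k < n" for k
    proof -
      have *: "inner (T (L i)) (T (L k)) = (if i = k then inner (T (L k)) (T (L k)) else 0)" if "i < n" for i
      proof (cases i k rule: linorder_cases)
        case less
        then have "inner (T (L k)) (T (L i)) = 0" using less.IH[OF \<open>k < n\<close>] by blast
        then show ?thesis using less by (simp add: inner_commute)
      next
        case greater
        then have "inner (T (L i)) (T (L k)) = 0" using less.IH[OF \<open>i < n\<close>] by blast
        then show ?thesis using greater by simp
      qed simp
      have "inner (T (r n)) (T (L k)) = inner (T (l n)) (T (L k)) - (\<Sum>i<n. inner (T (l n)) (T (L i)) * inner (T (L i)) (T (L k)))"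
        by (simp add: r_def T.diff T.sum T.scale inner_diff_left inner_sum_left)
      also have "(\<Sum>i<n. inner (T (l n)) (T (L i)) * inner (T (L i)) (T (L k)))
          = (\<Sum>i<n. if i = k then inner (T (l n)) (T (L k)) * inner (T (L k)) (T (L k)) else 0)"
      proof (intro sum.cong refl)
        fix i assume "i \<in> {..<n}"
        then have "i < n" by simp
        from *[OF this] show "inner (T (l n)) (T (L i)) * inner (T (L i)) (T (L k))
          = (if i = k then inner (T (l n)) (T (L k)) * inner (T (L k)) (T (L k)) else 0)"
          by (cases "i = k") simp_all
      qed
      also have "\<dots> = inner (T (l n)) (T (L k)) * inner (T (L k)) (T (L k))"
        using that by (subst sum.delta) auto
      also have "\<dots> = inner (T (l n)) (T (L k))"
        using L01[of k]
      proof
        assume "L k = 0"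
        then show ?thesis by (simp add: T.zero)
      next
        assume "norm (T (L k)) = 1"
        then show ?thesis by (simp add: dot_square_norm)
      qed
      finally show ?thesis by simp
    qed
    then show ?case by (auto simp: L T.scale)
  qed
  show thesis
  proof (rule that[of L])
    show "inner (dual_emb j (L i)) (dual_emb j (L k)) = 0" if "i \<noteq> k" for i k
    proof (cases i k rule: linorder_cases)
      case less
      then have "inner (T (L k)) (T (L i)) = 0" using orth[of k] by blast
      then show ?thesis by (simp add: T_def inner_commute)
    next
      case greater
      then have "inner (T (L i)) (T (L k)) = 0" using orth[of i] by blast
      then show ?thesis by (simp add: T_def)
    qed (use that in simp)
    show "L i = 0 \<or> norm (dual_emb j (L i)) = 1" for i using L01 by (simp add: T_def)
    fix x assume zero: "\<And>k. blinfun_apply (L k) x = 0"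
    show "x = 0"
    proof (rule sep)
      fix n
      \<comment> \<open>The recursion is inverted to see that the new functionals still separate
        points; for T (r n) = 0 the identity holds because \<open>T\<close> is injective and hence r
        n = 0.\<close>
      have "r n = norm (T (r n)) *\<^sub>R L n" using T0[of "r n"] by (cases "T (r n) = 0") (auto simp: L)
      moreover have "l n = r n + (\<Sum>i<n. inner (T (l n)) (T (L i)) *\<^sub>R L i)" by (simp add: r_def)
      ultimately have "l n = norm (T (r n)) *\<^sub>R L n + (\<Sum>i<n. inner (T (l n)) (T (L i)) *\<^sub>R L i)" by simp
      then have "blinfun_apply (l n) x = blinfun_apply (norm (T (r n)) *\<^sub>R L n + (\<Sum>i<n. inner (T (l n)) (T (L i)) *\<^sub>R L i)) x"
        by (rule arg_cong)
      also have "\<dots> = 0"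
        unfolding blinfun.add_left blinfun.scaleR_left blinfun.sum_left by (simp add: zero)
      finally show "blinfun_apply (l n) x = 0" .
    qed
  qed
qed

section \<open>Excessive functions and polar sets\<close>

text \<open>The hypothesis concerns just the one family \<open>q\<close>, for which P_t q_s =
  q_{s+t} will be read off from an explicit Fourier formula; a semigroup law for the measures
  themselves is not among the assumptions.\<close>

lemma excessive_potential:
  fixes \<nu> :: "real \<Rightarrow> 'e::{real_normed_vector, second_countable_topology} measure"
    and q :: "real \<Rightarrow> 'e \<Rightarrow> ennreal"
  assumes prob: "\<And>t. 0 \<le> t \<Longrightarrow> prob_space (\<nu> t)" and sets: "\<And>t. 0 \<le> t \<Longrightarrow> sets (\<nu> t) = sets borel"
    and q[measurable]: "case_prod q \<in> borel_measurable (borel \<Otimes>\<^sub>M borel)"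
    and entrance: "\<And>s t y. 0 \<le> s \<Longrightarrow> 0 \<le> t \<Longrightarrow> transition \<nu> t (q s) y = q (s + t) y"
  shows "0 \<le> t \<Longrightarrow> transition \<nu> t (\<lambda>y. \<integral>\<^sup>+s\<in>{0..}. ennreal (exp (- \<beta> * s)) * q s y \<partial>lborel) y
      = (\<integral>\<^sup>+s\<in>{0..}. ennreal (exp (- \<beta> * s)) * q (s + t) y \<partial>lborel)"
    and "excessive \<nu> \<beta> (\<lambda>y. \<integral>\<^sup>+s\<in>{0..}. ennreal (exp (- \<beta> * s)) * q s y \<partial>lborel)"
proof -
  have trans: "transition \<nu> t (\<lambda>y. \<integral>\<^sup>+s\<in>{0..}. ennreal (exp (- \<beta> * s)) * q s y \<partial>lborel) y
      = (\<integral>\<^sup>+s\<in>{0..}. ennreal (exp (- \<beta> * s)) * q (s + t) y \<partial>lborel)" if t: "0 \<le> t" for t y \<beta>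
  proof -
    interpret prob_space "\<nu> t" by (rule prob[OF t])
    interpret pair_sigma_finite "\<nu> t" lborel by standard
    note [measurable_cong] = sets[OF t]
    have "transition \<nu> t (\<lambda>y. \<integral>\<^sup>+s\<in>{0..}. ennreal (exp (- \<beta> * s)) * q s y \<partial>lborel) y
        = (\<integral>\<^sup>+s. (\<integral>\<^sup>+w. ennreal (exp (- \<beta> * s)) * q s (y + w) * indicator {0..} s \<partial>\<nu> t) \<partial>lborel)"
      unfolding transition_def by (rule Fubini'[symmetric]) measurable
    also have "\<dots> = (\<integral>\<^sup>+s\<in>{0..}. ennreal (exp (- \<beta> * s)) * q (s + t) y \<partial>lborel)"
    proof (intro nn_integral_cong)
      fix s :: real
      show "(\<integral>\<^sup>+w. ennreal (exp (- \<beta> * s)) * q s (y + w) * indicator {0..} s \<partial>\<nu> t)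
          = ennreal (exp (- \<beta> * s)) * q (s + t) y * indicator {0..} s"
      proof (cases "0 \<le> s")
        case True
        then show ?thesis
          using entrance[OF True t, of y] by (simp add: transition_def nn_integral_cmult)
      qed simp
    qed
    finally show ?thesis .
  qed
  show "0 \<le> t \<Longrightarrow> transition \<nu> t (\<lambda>y. \<integral>\<^sup>+s\<in>{0..}. ennreal (exp (- \<beta> * s)) * q s y \<partial>lborel) y
      = (\<integral>\<^sup>+s\<in>{0..}. ennreal (exp (- \<beta> * s)) * q (s + t) y \<partial>lborel)"
    by (rule trans)
  define w where "w y = (\<integral>\<^sup>+s\<in>{0..}. ennreal (exp (- \<beta> * s)) * q s y \<partial>lborel)" for y
  define I where "I \<alpha> y = (\<integral>\<^sup>+r\<in>{0<..}. ennreal (1 - exp (- \<alpha> * r)) * (ennreal (exp (- \<beta> * r)) * q r y) \<partial>lborel)" for \<alpha> y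
  \<comment> \<open>At r = 0 the factor 1 - exp(-\<alpha> r) is 0 for every \<alpha>, so convergence
    of \<open>I \<alpha>\<close> to \<open>w\<close> requires removing this null point.\<close>
  have w_pos: "w y = (\<integral>\<^sup>+s\<in>{0<..}. ennreal (exp (- \<beta> * s)) * q s y \<partial>lborel)" for y
    unfolding w_def by (rule nn_integral_cong_AE, rule AE_mp[OF AE_lborel_singleton[of 0] AE_I2])
      (auto split: split_indicator)
  \<comment> \<open>With r = s + t and Fubini, the time t survives only in the integral of
    exp(-\<alpha> t) over [0, r]. The result is visibly at most \<open>w\<close> and increasing in
    \<alpha>, which is what excessiveness demands.\<close>
  have res: "ennreal \<alpha> * resolvent \<nu> (\<beta> + \<alpha>) w y = I \<alpha> y" if "0 < \<alpha>" for \<alpha> y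
  proof -
    have "resolvent \<nu> (\<beta> + \<alpha>) w y = (\<integral>\<^sup>+t. (\<integral>\<^sup>+r. (ennreal (exp (- \<beta> * r)) * q r y * indicator {0..} r)
        * ennreal (if 0 \<le> t \<and> t \<le> r then exp (- \<alpha> * t) else 0) \<partial>lborel) \<partial>lborel)"
      unfolding resolvent_def
    proof (intro nn_integral_cong)
      fix t :: real
      show "ennreal (exp (- (\<beta> + \<alpha>) * t)) * transition \<nu> t w y * indicator {0..} t
          = (\<integral>\<^sup>+r. (ennreal (exp (- \<beta> * r)) * q r y * indicator {0..} r)
              * ennreal (if 0 \<le> t \<and> t \<le> r then exp (- \<alpha> * t) else 0) \<partial>lborel)"
      proof (cases "0 \<le> t")
        case True
        have "(\<integral>\<^sup>+r. (ennreal (exp (- \<beta> * r)) * q r y * indicator {0..} r)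
              * ennreal (if 0 \<le> t \<and> t \<le> r then exp (- \<alpha> * t) else 0) \<partial>lborel)
          = (\<integral>\<^sup>+s. (ennreal (exp (- \<beta> * (t + 1 * s))) * q (t + 1 * s) y * indicator {0..} (t + 1 * s))
              * ennreal (if 0 \<le> t \<and> t \<le> t + 1 * s then exp (- \<alpha> * t) else 0) \<partial>lborel)"
          by (subst nn_integral_real_affine[where c = 1 and t = t]) auto
        also have "\<dots> = (\<integral>\<^sup>+s. ennreal (exp (- (\<beta> + \<alpha>) * t)) * (ennreal (exp (- \<beta> * s)) * q (s + t) y * indicator {0..} s) \<partial>lborel)"
          using True
          by (intro nn_integral_cong)
            (auto split: split_indicator simp: ac_simps mult_exp_exp algebra_simps simp flip: ennreal_mult ennreal_mult'' intro!: arg_cong[where f = ennreal])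
        also have "\<dots> = ennreal (exp (- (\<beta> + \<alpha>) * t)) * (\<integral>\<^sup>+s\<in>{0..}. ennreal (exp (- \<beta> * s)) * q (s + t) y \<partial>lborel)"
          by (rule nn_integral_cmult) measurable
        also have "(\<integral>\<^sup>+s\<in>{0..}. ennreal (exp (- \<beta> * s)) * q (s + t) y \<partial>lborel) = transition \<nu> t w y"
          unfolding w_def[abs_def] by (rule trans[OF True, symmetric])
        finally show ?thesis using True by simp
      qed (simp add: indicator_def)
    qed
    also have "\<dots> = (\<integral>\<^sup>+r. (\<integral>\<^sup>+t. (ennreal (exp (- \<beta> * r)) * q r y * indicator {0..} r)
        * ennreal (if 0 \<le> t \<and> t \<le> r then exp (- \<alpha> * t) else 0) \<partial>lborel) \<partial>lborel)"
      by (rule lborel_pair.Fubini') measurable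
    also have "\<dots> = (\<integral>\<^sup>+r. ennreal (1 / \<alpha>) * (ennreal (1 - exp (- \<alpha> * r)) * (ennreal (exp (- \<beta> * r)) * q r y) * indicator {0<..} r) \<partial>lborel)"
    proof (intro nn_integral_cong)
      fix r :: real
      show "(\<integral>\<^sup>+t. (ennreal (exp (- \<beta> * r)) * q r y * indicator {0..} r)
        * ennreal (if 0 \<le> t \<and> t \<le> r then exp (- \<alpha> * t) else 0) \<partial>lborel)
        = ennreal (1 / \<alpha>) * (ennreal (1 - exp (- \<alpha> * r)) * (ennreal (exp (- \<beta> * r)) * q r y) * indicator {0<..} r)"
      proof (cases "0 \<le> r")
        case True
        have "(\<integral>\<^sup>+t. ennreal (if 0 \<le> t \<and> t \<le> r then exp (- \<alpha> * t) else 0) \<partial>lborel)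
          = (\<integral>\<^sup>+t. ennreal (exp (- \<alpha> * t)) * indicator {0..r} t \<partial>lborel)"
          by (intro nn_integral_cong) (auto split: split_indicator)
        also have "\<dots> = ennreal (- exp (- \<alpha> * r) / \<alpha> - - exp (- \<alpha> * 0) / \<alpha>)"
          using True \<open>0 < \<alpha>\<close> by (intro nn_integral_FTC_Icc) (auto intro!: derivative_eq_intros)
        also have "\<dots> = ennreal (1 / \<alpha>) * ennreal (1 - exp (- \<alpha> * r))"
          using \<open>0 < \<alpha>\<close> True by (simp add: field_simps flip: ennreal_mult)
        finally have "(\<integral>\<^sup>+t. ennreal (if 0 \<le> t \<and> t \<le> r then exp (- \<alpha> * t) else 0) \<partial>lborel) = \<dots>" .
        then show ?thesis
          using True by (subst nn_integral_cmult) (auto split: split_indicator simp: ac_simps)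
      qed simp
    qed
    also have "\<dots> = ennreal (1 / \<alpha>) * I \<alpha> y" unfolding I_def by (rule nn_integral_cmult) measurable
    finally have "ennreal \<alpha> * resolvent \<nu> (\<beta> + \<alpha>) w y = (ennreal \<alpha> * ennreal (1 / \<alpha>)) * I \<alpha> y" by (simp add: mult.assoc)
    also have "ennreal \<alpha> * ennreal (1 / \<alpha>) = 1" using that by (simp flip: ennreal_mult)
    finally show ?thesis by simp
  qed
  have I_le: "I \<alpha> y \<le> w y" for \<alpha> y
    unfolding I_def w_pos
  proof (intro nn_integral_mono mult_right_mono)
    fix r :: real
    have "ennreal (1 - exp (- \<alpha> * r)) \<le> 1" by (simp flip: ennreal_1)
    from mult_right_mono[OF this] show "ennreal (1 - exp (- \<alpha> * r)) * (ennreal (exp (- \<beta> * r)) * q r y) \<le> ennreal (exp (- \<beta> * r)) * q r y"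
      by simp
  qed auto
  have I_mono: "I \<alpha> y \<le> I \<alpha>' y" if "\<alpha> \<le> \<alpha>'" for \<alpha> \<alpha>' y
    unfolding I_def using that
    by (intro nn_integral_mono) (auto split: split_indicator intro!: mult_right_mono ennreal_leI)
  have I_lim: "(\<lambda>n. I (real n) y) \<longlonglongrightarrow> w y" for y
    unfolding I_def w_pos
  proof (rule nn_integral_LIMSEQ)
    show "incseq (\<lambda>n r. ennreal (1 - exp (- real n * r)) * (ennreal (exp (- \<beta> * r)) * q r y) * indicator {0<..} r)"
      by (auto simp: incseq_def le_fun_def split: split_indicator intro!: mult_right_mono ennreal_leI)
    fix r :: real
    show "(\<lambda>n. ennreal (1 - exp (- real n * r)) * (ennreal (exp (- \<beta> * r)) * q r y) * indicator {0<..} r)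
      \<longlonglongrightarrow> ennreal (exp (- \<beta> * r)) * q r y * indicator {0<..} r"
    proof (cases "0 < r")
      case True
      have "(\<lambda>n. 1 - exp (- r) ^ n) \<longlonglongrightarrow> 1 - 0"
        using True by (intro tendsto_intros LIMSEQ_power_zero) auto
      then have "(\<lambda>n. 1 - exp (- real n * r)) \<longlonglongrightarrow> 1" by (simp add: exp_of_nat_mult[symmetric])
      then have *: "(\<lambda>n. ennreal (1 - exp (- real n * r))) \<longlonglongrightarrow> ennreal 1" by (rule tendsto_ennrealI)
      show ?thesis
      \<comment> \<open>An infinite value makes the product infinite as soon as n > 0, hence
        eventually constant; continuity of multiplication is invoked for finite values.\<close>
      proof (cases "ennreal (exp (- \<beta> * r)) * q r y = \<top>")
        case top: True
        have "eventually (\<lambda>n. ennreal (1 - exp (- real n * r)) * (ennreal (exp (- \<beta> * r)) * q r y) * indicator {0<..} r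
            = ennreal (exp (- \<beta> * r)) * q r y * indicator {0<..} r) sequentially"
          using eventually_gt_at_top[of 0]
          by eventually_elim (unfold top, use True in \<open>auto simp: ennreal_mult_top\<close>)
        then show ?thesis by (rule tendsto_eventually)
      next
        case False
        then have "ennreal (exp (- \<beta> * r)) * q r y < \<top>" by (simp add: less_top)
        from ennreal_tendsto_cmult[OF this *] show ?thesis using True by (simp add: mult.commute)
      qed
    qed simp
  qed measurable
  have "w \<in> borel_measurable borel" unfolding w_def[abs_def] by measurable
  moreover have "((\<lambda>\<alpha>. I \<alpha> y) \<longlongrightarrow> w y) at_top" for y
  proof (rule increasing_tendsto)
    fix x assume "x < w y"
    then have "eventually (\<lambda>n. x < I (real n) y) sequentially" using order_tendstoD(1)[OF I_lim] by blast
    then obtain n where "x < I (real n) y" by (auto simp: eventually_sequentially)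
    then show "eventually (\<lambda>\<alpha>. x < I \<alpha> y) at_top"
      using I_mono[of "real n"] by (intro eventually_mono[OF eventually_ge_at_top[of "real n"]]) (auto intro: less_le_trans)
  qed (simp add: I_le)
  then have "((\<lambda>\<alpha>. ennreal \<alpha> * resolvent \<nu> (\<beta> + \<alpha>) w y) \<longlongrightarrow> w y) at_top" for y
    by (rule Lim_transform_eventually)
      (auto intro!: eventually_mono[OF eventually_gt_at_top[of 0]] simp: res)
  ultimately show "excessive \<nu> \<beta> (\<lambda>y. \<integral>\<^sup>+s\<in>{0..}. ennreal (exp (- \<beta> * s)) * q s y \<partial>lborel)"
    unfolding excessive_def w_def[abs_def, symmetric] using I_le res by auto
qed

text \<open>The reduced function is at least 1 on \<open>M\<close>, so vanishing can be expected for
  positive times only; the resolvent does not see the single time 0.\<close>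

lemma polarI:
  fixes \<nu> :: "real \<Rightarrow> 'e::real_normed_vector measure"
  assumes "M \<in> sets borel"
    and "\<And>\<beta> t y. 0 < \<beta> \<Longrightarrow> 0 < t \<Longrightarrow> transition \<nu> t (reduced \<nu> \<beta> M) y = 0"
  shows "polar \<nu> M"
proof -
  have "resolvent \<nu> (\<beta> + \<alpha>) (reduced \<nu> \<beta> M) y = 0" if "0 < \<beta>" for \<alpha> \<beta> y
  proof -
    have "resolvent \<nu> (\<beta> + \<alpha>) (reduced \<nu> \<beta> M) y = (\<integral>\<^sup>+(t::real). 0 \<partial>lborel)"
      unfolding resolvent_def
      by (rule nn_integral_cong_AE, rule AE_mp[OF AE_lborel_singleton[of 0] AE_I2])
        (use assms(2)[OF that] in \<open>auto simp: indicator_def\<close>)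
    then show ?thesis by simp
  qed
  then show ?thesis using assms(1) by (auto simp: polar_def regularized_reduced_def)
qed

section \<open>Coordinates given by orthonormal functionals\<close>

locale cylinder =
  fixes j :: "'h::{real_inner, complete_space, second_countable_topology} \<Rightarrow>
              'e::{real_normed_vector, second_countable_topology}"
    and L :: "nat \<Rightarrow> 'e \<Rightarrow>\<^sub>L real"
  assumes bounded_linear_j: "bounded_linear j"
    and orthogonal: "i \<noteq> k \<Longrightarrow> inner (dual_emb j (L i)) (dual_emb j (L k)) = 0"
    and normalized: "L i = 0 \<or> norm (dual_emb j (L i)) = 1"
    and separating: "(\<And>k. blinfun_apply (L k) z = 0) \<Longrightarrow> z = 0"
begin

text \<open>For \<open>x\<close> distributed by \<open>gauss n\<close>, this is the vector g_n of
  the overview; \<open>pairing n x y\<close> is its pairing with a point of E, and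
  \<open>sq n y\<close> is |y|_n^2. Coordinates with L i = 0 are drawn but have no effect.\<close>

definition lin :: "nat \<Rightarrow> (nat \<Rightarrow> real) \<Rightarrow> 'h" where
  "lin n x = (\<Sum>i<n. x i *\<^sub>R dual_emb j (L i))"

definition pairing :: "nat \<Rightarrow> (nat \<Rightarrow> real) \<Rightarrow> 'e \<Rightarrow> real" where
  "pairing n x y = (\<Sum>i<n. x i * blinfun_apply (L i) y)"

definition sq :: "nat \<Rightarrow> 'e \<Rightarrow> real" where
  "sq n y = (\<Sum>i<n. (blinfun_apply (L i) y)\<^sup>2)"

lemma dual_emb_sum: "dual_emb j (\<Sum>i<n. x i *\<^sub>R L i) = lin n x"
  using linear_dual_emb[OF bounded_linear_j] by (simp add: lin_def linear_sum linear_scale)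

lemma apply_sum: "blinfun_apply (\<Sum>i<n. x i *\<^sub>R L i) y = pairing n x y"
  by (simp add: pairing_def blinfun.sum_left blinfun.scaleR_left)

lemma inner_lin: "inner (lin n x) h = pairing n x (j h)"
  by (simp add: lin_def pairing_def inner_sum_left dual_emb_inner[OF bounded_linear_j])

lemma dual_emb_0: "dual_emb j 0 = 0"
  using linear_dual_emb[OF bounded_linear_j] by (rule linear_0)

lemma inner_dual_emb: "inner (dual_emb j (L i)) (dual_emb j (L k)) = (if i = k \<and> L i \<noteq> 0 then 1 else 0)"
  using orthogonal[of i k] normalized[of i] by (auto simp: dual_emb_0 dot_square_norm)

lemma L_lin: "blinfun_apply (L k) (j (lin n x)) = (if k < n \<and> L k \<noteq> 0 then x k else 0)"
proof -
  have "blinfun_apply (L k) (j (lin n x)) = inner (dual_emb j (L k)) (lin n x)"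
    by (simp add: dual_emb_inner[OF bounded_linear_j])
  also have "\<dots> = (\<Sum>i<n. x i * (if k = i \<and> L k \<noteq> 0 then 1 else 0))"
    unfolding lin_def inner_sum_right inner_scaleR_right inner_dual_emb ..
  also have "\<dots> = (\<Sum>i<n. if k = i then x i * (if L k \<noteq> 0 then 1 else 0) else 0)"
    by (intro sum.cong) auto
  also have "\<dots> = (if k < n \<and> L k \<noteq> 0 then x k else 0)" by (subst sum.delta') auto
  finally show ?thesis .
qed

lemma norm_lin_eq: "(norm (lin n x))\<^sup>2 = (\<Sum>i<n. if L i \<noteq> 0 then (x i)\<^sup>2 else 0)"
proof -
  have "(norm (lin n x))\<^sup>2 = (\<Sum>i<n. x i * blinfun_apply (L i) (j (lin n x)))"
    unfolding dot_square_norm[symmetric] inner_lin pairing_def ..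
  also have "\<dots> = (\<Sum>i<n. if L i \<noteq> 0 then (x i)\<^sup>2 else 0)"
    by (intro sum.cong) (auto simp: L_lin power2_eq_square)
  finally show ?thesis .
qed

lemma norm_lin: "(norm (lin n x))\<^sup>2 \<le> (\<Sum>i<n. (x i)\<^sup>2)"
  unfolding norm_lin_eq by (intro sum_mono) simp

lemma pairing_Cauchy_Schwarz: "(pairing n x y)\<^sup>2 \<le> (\<Sum>i<n. (x i)\<^sup>2) * sq n y"
  unfolding pairing_def sq_def by (rule Cauchy_Schwarz_ineq_sum)

lemma sq_nonneg: "0 \<le> sq n y" by (simp add: sq_def sum_nonneg)

lemma sq_mono: "m \<le> n \<Longrightarrow> sq m y \<le> sq n y"
  unfolding sq_def by (intro sum_mono2) auto

lemma sq_add: "sq n (x + y) \<le> 2 * sq n x + 2 * sq n y"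
proof -
  have "(a + b)\<^sup>2 \<le> 2 * a\<^sup>2 + 2 * b\<^sup>2" for a b :: real
    using zero_le_power2[of "a - b"] by (simp add: power2_eq_square algebra_simps)
  then show ?thesis
    unfolding sq_def by (simp add: sum_distrib_left blinfun.add_right flip: sum.distrib) (intro sum_mono)
qed

text \<open>Bessel's inequality: the truncated expansion u of h satisfies |u|^2 <= sq n (j h) = <u,
  h>, and 2 <u, h> <= |u|^2 + |h|^2.\<close>

lemma sq_j: "sq n (j h) \<le> (norm h)\<^sup>2"
proof -
  define u where "u = lin n (\<lambda>i. blinfun_apply (L i) (j h))"
  have s: "sq n (j h) = inner u h" unfolding u_def inner_lin sq_def pairing_def by (simp add: power2_eq_square)
  have "(norm u)\<^sup>2 \<le> sq n (j h)" using norm_lin[of n "\<lambda>i. blinfun_apply (L i) (j h)"] by (simp add: u_def sq_def)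
  moreover have "2 * inner u h \<le> (norm u)\<^sup>2 + (norm h)\<^sup>2"
    using inner_ge_zero[of "u - h"] by (simp add: dot_square_norm[symmetric] inner_diff inner_commute)
  ultimately show ?thesis using s by simp
qed

text \<open>The Riesz-Fischer argument: bounded square sums make the partial expansions Cauchy in H,
  and the image of their limit has the same coordinates as \<open>y\<close>, hence equals
  \<open>y\<close> by separation.\<close>

lemma sq_bounded_range:
  assumes "\<And>n. sq n y \<le> B"
  shows "y \<in> range j"
proof -
  define h where "h n = lin n (\<lambda>i. blinfun_apply (L i) y)" for n
  have diff: "(norm (h n - h m))\<^sup>2 \<le> sq n y - sq m y" if "m \<le> n" for m n
  proof -
    define x where "x i = (if i < m then 0 else blinfun_apply (L i) y)" for i
    have *: "{..<n} = {..<m} \<union> {m..<n}" using that by auto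
    have hn: "h n = h m + (\<Sum>i=m..<n. blinfun_apply (L i) y *\<^sub>R dual_emb j (L i))"
      unfolding h_def lin_def * by (rule sum.union_disjoint) auto
    have "h n - h m = lin n x"
      unfolding hn unfolding lin_def * by (subst sum.union_disjoint) (auto simp: x_def intro!: sum.cong)
    moreover have "(\<Sum>i<n. (x i)\<^sup>2) = sq n y - sq m y"
      unfolding sq_def * by (subst (1 2) sum.union_disjoint) (auto simp: x_def intro!: sum.cong)
    ultimately show ?thesis using norm_lin[of n x] by simp
  qed
  have "convergent (\<lambda>n. sq n y)"
    using assms sq_mono by (intro Bseq_mono_convergent BseqI'[where K = B]) (auto simp: sq_nonneg)
  then have cau: "Cauchy (\<lambda>n. sq n y)" by (rule convergent_Cauchy)
  have "Cauchy h"
  proof (rule CauchyI')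
    fix e :: real assume "0 < e"
    then obtain M where M: "\<And>m n. m \<ge> M \<Longrightarrow> n \<ge> M \<Longrightarrow> norm (sq m y - sq n y) < e\<^sup>2"
      using CauchyD[OF cau, of "e\<^sup>2"] by auto
    have "norm (h m - h n) < e" if "m \<ge> M" "m < n" for m n
    proof -
      have "(norm (h m - h n))\<^sup>2 < e\<^sup>2"
        using diff[of m n] M[of m n] that by (simp add: norm_minus_commute)
      then show ?thesis using \<open>0 < e\<close> by (simp add: power2_less_imp_less)
    qed
    then show "\<exists>M. \<forall>m\<ge>M. \<forall>n>m. dist (h m) (h n) < e" unfolding dist_norm by blast
  qed
  then obtain g where g: "h \<longlonglongrightarrow> g" using Cauchy_convergent convergent_def by blast
  have "blinfun_apply (L k) (y - j g) = 0" for k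
  proof -
    have "(\<lambda>n. blinfun_apply (L k) (j (h n))) \<longlonglongrightarrow> blinfun_apply (L k) (j g)"
      by (intro tendsto_intros bounded_linear.tendsto[OF bounded_linear_j] g)
    moreover have "eventually (\<lambda>n. blinfun_apply (L k) y = blinfun_apply (L k) (j (h n))) sequentially"
      using eventually_gt_at_top[of k] by eventually_elim (auto simp: h_def L_lin)
    then have "(\<lambda>n. blinfun_apply (L k) (j (h n))) \<longlonglongrightarrow> blinfun_apply (L k) y"
      by (rule Lim_transform_eventually[OF tendsto_const])
    ultimately show ?thesis using LIMSEQ_unique by (fastforce simp: blinfun.diff_right)
  qed
  then have "y = j g" using separating[of "y - j g"] by simp
  then show ?thesis by simp
qed

lemma sq_at_top:
  assumes "y \<notin> range j"
  shows "filterlim (\<lambda>n. sq n y) at_top sequentially"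
  unfolding filterlim_at_top
proof
  fix B
  have "\<exists>m. B < sq m y" using sq_bounded_range[of y B] assms by (meson linorder_not_le)
  then obtain m where "B < sq m y" ..
  then show "eventually (\<lambda>n. B \<le> sq n y) sequentially"
    using sq_mono[of m _ y] by (intro eventually_sequentiallyI[of m]) (auto intro: less_imp_le less_le_trans)
qed

lemma measurable_sq [measurable]: "sq n \<in> borel_measurable borel"
  unfolding sq_def[abs_def] by measurable

lemma range_j_eq: "range j = (\<Union>B::nat. {y. \<forall>n. sq n y \<le> real B})"
proof (intro equalityI subsetI)
  fix y assume "y \<in> range j"
  then obtain h where h: "y = j h" by auto
  obtain B :: nat where "(norm h)\<^sup>2 \<le> real B" using real_arch_simple by blast
  then show "y \<in> (\<Union>B::nat. {y. \<forall>n. sq n y \<le> real B})" using sq_j[of _ h] h by (auto intro: order.trans)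
qed (use sq_bounded_range in auto)

lemma range_j_borel: "range j \<in> sets borel"
  unfolding range_j_eq by measurable

lemma measurable_lin [measurable]: "lin n \<in> borel_measurable (gauss n)"
  unfolding lin_def[abs_def] by (intro borel_measurable_sum) auto

lemma measurable_pairing [measurable]:
  "f \<in> borel_measurable M \<Longrightarrow> g \<in> measurable M (gauss n) \<Longrightarrow> (\<lambda>w. pairing n (g w) (f w)) \<in> borel_measurable M"
  unfolding pairing_def
  by (intro borel_measurable_sum borel_measurable_times measurable_compose[OF _ measurable_gauss_component]
      borel_measurable_blinfun_apply) auto

text \<open>A Gaussian function of the coordinates is an average of characters. This converts
  integrals over E into Gaussian integrals of the exponent.\<close>

lemma iexp_pairing: "(LINT x|gauss n. cis (\<kappa> * pairing n x y)) = complex_of_real (exp (- (\<kappa>\<^sup>2 * sq n y / 2)))"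
  using iexp_gauss[of n "\<lambda>i. \<kappa> * blinfun_apply (L i) y"]
  unfolding cis_conv_exp
  by (simp add: pairing_def sq_def sum_distrib_left power_mult_distrib mult.left_commute)

lemma measurable_pairing_fixed [measurable]: "pairing n x \<in> borel_measurable borel"
  unfolding pairing_def[abs_def] by measurable

text \<open>With finitely many nonzero functionals, each h would share all coordinates with a finite
  expansion, and the corresponding vectors would span H.\<close>

lemma infinite_functionals:
  assumes inj: "inj j" and dim: "\<not> (\<exists>B::'h set. finite B \<and> span B = UNIV)"
  shows "infinite {i. L i \<noteq> 0}"
proof
  assume fin: "finite {i. L i \<noteq> 0}"
  then obtain N where N: "\<And>i. L i \<noteq> 0 \<Longrightarrow> i < N"
    unfolding finite_nat_set_iff_bounded by auto
  interpret j: bounded_linear j by (rule bounded_linear_j)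
  have "h \<in> span (dual_emb j ` L ` {..<N})" for h
  proof -
    define g where "g = lin N (\<lambda>i. blinfun_apply (L i) (j h))"
    have "blinfun_apply (L k) (j h - j g) = 0" for k
      using N[of k] by (cases "L k = 0") (auto simp: g_def L_lin blinfun.diff_right)
    then have "j h = j g" using separating[of "j h - j g"] by simp
    then have "h = g" using inj by (rule injD[rotated])
    moreover have "g \<in> span (dual_emb j ` L ` {..<N})"
      unfolding g_def lin_def by (intro span_sum span_scale span_base) auto
    ultimately show ?thesis by simp
  qed
  then have "span (dual_emb j ` L ` {..<N}) = UNIV" by blast
  moreover have "finite (dual_emb j ` L ` {..<N})" by simp
  ultimately show False using dim by metis
qed

lemma gauss_exp_norm_lin:
  "(LINT x|gauss n. exp (- ((norm (lin n x))\<^sup>2 / 2))) = (1 / sqrt 2) ^ card {i\<in>{..<n}. L i \<noteq> 0}"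
proof -
  have "(LINT x|gauss n. exp (- ((norm (lin n x))\<^sup>2 / 2)))
      = (LINT x|gauss n. (\<Prod>i<n. if L i \<noteq> 0 then exp (- ((x i)\<^sup>2 / 2)) else 1))"
  proof (intro Bochner_Integration.integral_cong refl)
    fix x
    have "- ((norm (lin n x))\<^sup>2 / 2) = (\<Sum>i<n. if L i \<noteq> 0 then - ((x i)\<^sup>2 / 2) else 0)"
      unfolding norm_lin_eq sum_divide_distrib sum_negf[symmetric] by (intro sum.cong) auto
    then have "exp (- ((norm (lin n x))\<^sup>2 / 2)) = (\<Prod>i<n. exp (if L i \<noteq> 0 then - ((x i)\<^sup>2 / 2) else 0))"
      by (simp add: exp_sum)
    also have "\<dots> = (\<Prod>i<n. if L i \<noteq> 0 then exp (- ((x i)\<^sup>2 / 2)) else 1)"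
      by (intro prod.cong) auto
    finally show "exp (- ((norm (lin n x))\<^sup>2 / 2)) = \<dots>" .
  qed
  also have "\<dots> = (\<Prod>i<n. LINT s|std_normal_distribution. (if L i \<noteq> 0 then exp (- (s\<^sup>2 / 2)) else 1))"
  proof (rule product_sigma_finite.product_integral_prod[OF product_sigma_finite_std_normal])
    show "integrable std_normal_distribution (\<lambda>s. if L i \<noteq> 0 then exp (- (s\<^sup>2 / 2)) else 1)" for i
      by (rule integrable_bounded[where B = 1, OF prob_space_std_normal]) auto
  qed simp
  also have "\<dots> = (\<Prod>i<n. if L i \<noteq> 0 then 1 / sqrt 2 else 1)"
    using prob_space.prob_space[OF prob_space_std_normal]
    by (intro prod.cong refl) (simp add: integral_exp_square_std_normal)
  also have "\<dots> = (1 / sqrt 2) ^ card {i\<in>{..<n}. L i \<noteq> 0}"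
    by (simp add: prod.If_cases Int_def)
  finally show ?thesis .
qed

text \<open>The mean of exp(-|.|_n^2 / 2) contributes a factor 1 / sqrt 2 for each nonzero
  functional and so tends to 0, whereas on the set where all |.|_n^2 are at most B the integrand is
  at least exp(-B/2).\<close>

lemma gaussian_null_range:
  assumes "prob_space \<mu>" and sets_\<mu>: "sets \<mu> = sets borel"
    and char_\<mu>: "\<And>\<xi>. (LINT z|\<mu>. iexp (blinfun_apply \<xi> z)) = complex_of_real (exp (- ((norm (dual_emb j \<xi>))\<^sup>2 / 2)))"
    and inf: "infinite {i. L i \<noteq> 0}"
  shows "emeasure \<mu> (range j) = 0"
proof -
  interpret prob_space \<mu> by fact
  note [measurable_cong] = sets_\<mu>
  have int: "(LINT z|\<mu>. exp (- (sq n z / 2))) = (1 / sqrt 2) ^ card {i\<in>{..<n}. L i \<noteq> 0}" for n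
  proof -
    have "complex_of_real (LINT z|\<mu>. exp (- (sq n z / 2))) = (LINT z|\<mu>. LINT x|gauss n. cis (1 * pairing n x z))"
      unfolding iexp_pairing by simp
    also have "\<dots> = (LINT x|gauss n. LINT z|\<mu>. cis (1 * pairing n x z))"
      by (rule Fubini_bounded[where B = 1]) (use prob_space_gauss prob_space_axioms in auto)
    also have "\<dots> = (LINT x|gauss n. complex_of_real (exp (- ((norm (lin n x))\<^sup>2 / 2))))"
    proof (intro Bochner_Integration.integral_cong refl)
      fix x
      show "(LINT z|\<mu>. cis (1 * pairing n x z)) = complex_of_real (exp (- ((norm (lin n x))\<^sup>2 / 2)))"
        using char_\<mu>[of "\<Sum>i<n. x i *\<^sub>R L i"] unfolding apply_sum dual_emb_sum cis_conv_exp by simp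
    qed
    also have "\<dots> = complex_of_real ((1 / sqrt 2) ^ card {i\<in>{..<n}. L i \<noteq> 0})"
      by (simp only: integral_complex_of_real gauss_exp_norm_lin)
    finally show ?thesis by (simp only: of_real_eq_iff)
  qed
  have "filterlim (\<lambda>n. card {i\<in>{..<n}. L i \<noteq> 0}) at_top sequentially"
    unfolding filterlim_at_top
  proof
    fix m
    obtain B where B: "finite B" "card B = m" "B \<subseteq> {i. L i \<noteq> 0}"
      using infinite_arbitrarily_large[OF inf] by blast
    obtain k where k: "\<And>i. i \<in> B \<Longrightarrow> i < k" using B(1) unfolding finite_nat_set_iff_bounded by auto
    have "m \<le> card {i\<in>{..<n}. L i \<noteq> 0}" if "k \<le> n" for n
      unfolding B(2)[symmetric] using B(3) k that by (intro card_mono) (auto intro: less_le_trans)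
    then show "eventually (\<lambda>n. m \<le> card {i\<in>{..<n}. L i \<noteq> 0}) sequentially"
      by (auto simp: eventually_sequentially)
  qed
  then have "(\<lambda>n. (1 / sqrt 2) ^ card {i\<in>{..<n}. L i \<noteq> 0}) \<longlonglongrightarrow> (0::real)"
    by (rule filterlim_compose[rotated]) (auto intro!: LIMSEQ_power_zero)
  note lim = this[folded int]
  have "emeasure \<mu> {y. \<forall>n. sq n y \<le> real B} = 0" for B
  proof -
    let ?A = "{y. \<forall>n. sq n y \<le> real B}"
    have [measurable]: "?A \<in> sets \<mu>" by measurable
    have "exp (- (real B / 2)) * prob ?A \<le> (LINT z|\<mu>. exp (- (sq n z / 2)))" for n
    proof -
      have "exp (- (real B / 2)) * prob ?A = (LINT z|\<mu>. exp (- (real B / 2)) * indicator ?A z)" by simp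
      also have "\<dots> \<le> (LINT z|\<mu>. exp (- (sq n z / 2)))"
      proof (rule integral_mono)
        show "integrable \<mu> (\<lambda>z. exp (- (sq n z / 2)))"
          by (rule integrable_bounded[where B = 1, OF prob_space_axioms]) (auto simp: sq_nonneg)
        show "exp (- (real B / 2)) * indicator ?A z \<le> exp (- (sq n z / 2))" for z
          by (auto split: split_indicator)
      qed (auto intro!: integrable_real_mult_indicator simp: emeasure_eq_measure)
      finally show ?thesis .
    qed
    with lim have "exp (- (real B / 2)) * prob ?A \<le> 0" by (intro LIMSEQ_le_const) auto
    then have "prob ?A = 0" using measure_nonneg[of \<mu> ?A] by (simp add: mult_le_0_iff)
    then show ?thesis by (simp add: emeasure_eq_measure)
  qed
  then show ?thesis
    unfolding range_j_eq using sets_\<mu> by (intro emeasure_UN_eq_0) auto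
qed

end

section \<open>Semigroups with a Fourier exponent\<close>

text \<open>The common ground of the Gaussian and the Levy case. Of negative definiteness only
  estimates for the real part are kept; the quadratic one is stated on the image of the dual, where
  it follows from second moments of functionals.\<close>

locale cylindrical_semigroup = cylinder j L
  for j :: "'h::{real_inner, complete_space, second_countable_topology} \<Rightarrow>
              'e::{real_normed_vector, second_countable_topology}"
    and L :: "nat \<Rightarrow> 'e \<Rightarrow>\<^sub>L real" +
  fixes \<psi> :: "'h \<Rightarrow> complex"
    and \<nu> :: "real \<Rightarrow> 'e measure"
    and K C :: real
  assumes prob: "0 < t \<Longrightarrow> prob_space (\<nu> t)"
    and sets_\<nu>': "0 < t \<Longrightarrow> sets (\<nu> t) = sets borel"
    and \<nu>_0: "\<nu> 0 = return borel 0"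
    and char': "0 < t \<Longrightarrow> (LINT z|\<nu> t. iexp (blinfun_apply \<xi> z)) = exp (- (complex_of_real t * \<psi> (dual_emb j \<xi>)))"
    and continuous_\<psi>: "continuous_on UNIV \<psi>"
    and \<psi>_0: "\<psi> 0 = 0"
    and Re_\<psi>_nonneg: "0 \<le> Re (\<psi> x)"
    and Re_\<psi>_dual_emb: "Re (\<psi> (dual_emb j \<xi>)) \<le> 2 * Re (\<psi> (dual_emb j \<eta>)) + K * (norm (dual_emb j \<xi> - dual_emb j \<eta>))\<^sup>2"
    and Re_\<psi>_double: "Re (\<psi> (2 *\<^sub>R x)) \<le> 4 * Re (\<psi> x)"
    and K_pos: "0 < K" and C_pos: "0 < C"
    and moment: "0 < t \<Longrightarrow> (\<integral>\<^sup>+z. ennreal ((blinfun_apply \<xi> z)\<^sup>2) \<partial>\<nu> t)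
          \<le> ennreal (C * (1 + t\<^sup>2) * (norm (dual_emb j \<xi>))\<^sup>2)"
    and null: "0 < t \<Longrightarrow> emeasure (\<nu> t) (range j) = 0"
begin

lemma prob_\<nu>: "0 \<le> t \<Longrightarrow> prob_space (\<nu> t)"
  using prob[of t] \<nu>_0 prob_space_return[of 0 borel] by (cases "t = 0") auto

lemma sets_\<nu>: "0 \<le> t \<Longrightarrow> sets (\<nu> t) = sets borel"
  using sets_\<nu>'[of t] \<nu>_0 by (cases "t = 0") auto

lemma measurable_\<psi> [measurable]: "\<psi> \<in> borel_measurable borel"
  using continuous_\<psi> by (rule borel_measurable_continuous_onI)

lemma Re_\<psi>_lin:
  "Re (\<psi> (\<kappa> *\<^sub>R lin n x)) \<le> 2 * Re (\<psi> (\<kappa> *\<^sub>R lin n y)) + K * (norm (\<kappa> *\<^sub>R lin n x - \<kappa> *\<^sub>R lin n y))\<^sup>2"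
  using Re_\<psi>_dual_emb[of "\<kappa> *\<^sub>R (\<Sum>i<n. x i *\<^sub>R L i)" "\<kappa> *\<^sub>R (\<Sum>i<n. y i *\<^sub>R L i)"]
  by (simp add: linear_scale[OF linear_dual_emb[OF bounded_linear_j]] dual_emb_sum)

lemma lin_0: "lin n (\<lambda>_. 0) = 0"
  by (simp add: lin_def)

text \<open>Equal to \<open>heat\<close> for s >= 0. Joint measurability in \<open>s\<close> and
  \<open>y\<close> is evident for this expression, which involves \<psi>, but not for
  \<open>heat\<close>, which involves the family \<nu>; potentials are therefore built from this
  one.\<close>

definition fourier :: "real \<Rightarrow> nat \<Rightarrow> real \<Rightarrow> 'e \<Rightarrow> complex" where
  "fourier \<kappa> n s y =
     (LINT x|gauss n. cis (\<kappa> * pairing n x y) * exp (- (complex_of_real s * \<psi> (\<kappa> *\<^sub>R lin n x))))"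

definition heat :: "real \<Rightarrow> nat \<Rightarrow> real \<Rightarrow> 'e \<Rightarrow> real" where
  "heat \<kappa> n s y = (LINT w|\<nu> s. exp (- (\<kappa>\<^sup>2 * sq n (y + w) / 2)))"

definition phi :: "real \<Rightarrow> nat \<Rightarrow> real \<Rightarrow> real" where
  "phi \<kappa> n s = (LINT x|gauss n. exp (- (s * Re (\<psi> (\<kappa> *\<^sub>R lin n x)))))"

lemma norm_exp_\<psi>: "norm (exp (- (complex_of_real s * \<psi> u))) = exp (- (s * Re (\<psi> u)))"
  by simp

lemma norm_exp_\<psi>_le: "0 \<le> s \<Longrightarrow> norm (exp (- (complex_of_real s * \<psi> u))) \<le> 1"
  using Re_\<psi>_nonneg by simp

lemma char:
  assumes "0 \<le> t"
  shows "(LINT z|\<nu> t. cis (\<kappa> * pairing n x z)) = exp (- (complex_of_real t * \<psi> (\<kappa> *\<^sub>R lin n x)))"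
proof (cases "t = 0")
  case True
  have "pairing n x 0 = 0" by (simp add: pairing_def)
  then show ?thesis using True
    by (simp add: \<nu>_0 integral_return)
next
  case False
  have "pairing n (\<lambda>i. \<kappa> * x i) z = \<kappa> * pairing n x z" for z
    by (simp add: pairing_def sum_distrib_left mult.assoc)
  moreover have "lin n (\<lambda>i. \<kappa> * x i) = \<kappa> *\<^sub>R lin n x"
    by (simp add: lin_def scaleR_sum_right)
  ultimately show ?thesis
    using char'[of t "\<Sum>i<n. (\<kappa> * x i) *\<^sub>R L i"] assms False
    unfolding dual_emb_sum apply_sum cis_conv_exp by simp
qed

lemma fourier_eq_heat:
  assumes s: "0 \<le> s"
  shows "fourier \<kappa> n s y = complex_of_real (heat \<kappa> n s y)"
proof -
  note [measurable_cong] = sets_\<nu>[OF s]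
  have "complex_of_real (heat \<kappa> n s y) = (LINT w|\<nu> s. LINT x|gauss n. cis (\<kappa> * pairing n x (y + w)))"
    unfolding heat_def iexp_pairing by (rule integral_complex_of_real[symmetric])
  also have "\<dots> = (LINT x|gauss n. LINT w|\<nu> s. cis (\<kappa> * pairing n x (y + w)))"
    by (rule Fubini_bounded[where B = 1]) (use prob_space_gauss prob_\<nu>[OF s] in auto)
  also have "\<dots> = fourier \<kappa> n s y"
    unfolding fourier_def
  proof (intro Bochner_Integration.integral_cong refl)
    fix x
    have "pairing n x (y + w) = pairing n x y + pairing n x w" for w
      by (simp add: pairing_def blinfun.add_right algebra_simps sum.distrib)
    then have "(LINT w|\<nu> s. cis (\<kappa> * pairing n x (y + w))) = (LINT w|\<nu> s. cis (\<kappa> * pairing n x y) * cis (\<kappa> * pairing n x w))"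
      by (simp add: cis_mult distrib_left)
    then show "(LINT w|\<nu> s. cis (\<kappa> * pairing n x (y + w)))
        = cis (\<kappa> * pairing n x y) * exp (- (complex_of_real s * \<psi> (\<kappa> *\<^sub>R lin n x)))"
      by (simp add: char[OF s])
  qed
  finally show ?thesis ..
qed

lemma measurable_fourier [measurable]: "case_prod (fourier \<kappa> n) \<in> borel_measurable (borel \<Otimes>\<^sub>M borel)"
proof -
  interpret prob_space "gauss n" by (rule prob_space_gauss)
  have "(\<lambda>p. LINT x|gauss n. cis (\<kappa> * pairing n x (snd p)) * exp (- (complex_of_real (fst p) * \<psi> (\<kappa> *\<^sub>R lin n x))))
      \<in> borel_measurable (borel \<Otimes>\<^sub>M borel)"
    by measurable
  then show ?thesis by (simp add: fourier_def case_prod_beta')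
qed

lemma heat_nonneg: "0 \<le> heat \<kappa> n s y"
  unfolding heat_def by (intro Bochner_Integration.integral_nonneg) simp

lemma integrable_exp_sq:
  "0 \<le> s \<Longrightarrow> 0 \<le> c \<Longrightarrow> integrable (\<nu> s) (\<lambda>w. exp (- (c * sq n (y + w))))"
  using sets_\<nu>[of s] prob_\<nu>[of s]
  by (intro integrable_bounded[where B = 1]) (auto simp: sq_nonneg cong: measurable_cong_sets)

text \<open>Absolute values inside the Gaussian integral remove the character and the imaginary part
  of \<psi>, and with them all dependence on \<open>y\<close>.\<close>

lemma heat_le_phi:
  assumes s: "0 \<le> s"
  shows "heat \<kappa> n s y \<le> phi \<kappa> n s"
proof -
  have "heat \<kappa> n s y = norm (fourier \<kappa> n s y)" using heat_nonneg by (simp add: fourier_eq_heat[OF s])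
  also have "\<dots> \<le> (LINT x|gauss n. norm (cis (\<kappa> * pairing n x y) * exp (- (complex_of_real s * \<psi> (\<kappa> *\<^sub>R lin n x)))))"
    unfolding fourier_def by (rule integral_norm_bound)
  also have "\<dots> = phi \<kappa> n s" unfolding phi_def norm_mult norm_exp_\<psi> by simp
  finally show ?thesis .
qed

lemma norm_fourier_integrand:
  "0 \<le> s \<Longrightarrow> norm (cis a * exp (- (complex_of_real s * \<psi> u))) \<le> 1"
  using norm_exp_\<psi>_le[of s u] by (simp add: norm_mult)

text \<open>Characters are eigenfunctions of P_t with eigenvalue exp(-t \<psi>), so P_t just adds t
  to the time parameter.\<close>

lemma fourier_shift:
  assumes s: "0 \<le> s" and t: "0 \<le> t"
  shows "(LINT w|\<nu> t. fourier \<kappa> n s (y + w)) = fourier \<kappa> n (s + t) y"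
proof -
  note [measurable_cong] = sets_\<nu>[OF t]
  have "(LINT w|\<nu> t. fourier \<kappa> n s (y + w))
      = (LINT x|gauss n. LINT w|\<nu> t. cis (\<kappa> * pairing n x (y + w)) * exp (- (complex_of_real s * \<psi> (\<kappa> *\<^sub>R lin n x))))"
    unfolding fourier_def
    by (rule Fubini_bounded[where B = 1]) (use prob_space_gauss prob_\<nu>[OF t] norm_fourier_integrand[OF s] in auto)
  also have "\<dots> = fourier \<kappa> n (s + t) y"
    unfolding fourier_def
  proof (intro Bochner_Integration.integral_cong refl)
    fix x
    let ?e = "\<lambda>r. exp (- (complex_of_real r * \<psi> (\<kappa> *\<^sub>R lin n x)))"
    have "pairing n x (y + w) = pairing n x y + pairing n x w" for w
      by (simp add: pairing_def blinfun.add_right algebra_simps sum.distrib)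
    then have "(LINT w|\<nu> t. cis (\<kappa> * pairing n x (y + w)) * ?e s)
        = (LINT w|\<nu> t. (cis (\<kappa> * pairing n x y) * ?e s) * cis (\<kappa> * pairing n x w))"
      by (intro Bochner_Integration.integral_cong refl) (simp add: distrib_left mult.commute mult.left_commute flip: cis_mult)
    also have "\<dots> = (cis (\<kappa> * pairing n x y) * ?e s) * ?e t"
      unfolding char[OF t, symmetric] by simp
    also have "\<dots> = cis (\<kappa> * pairing n x y) * ?e (s + t)"
      by (simp add: mult.assoc mult_exp_exp algebra_simps)
    finally show "(LINT w|\<nu> t. cis (\<kappa> * pairing n x (y + w)) * ?e s) = cis (\<kappa> * pairing n x y) * ?e (s + t)" .
  qed
  finally show ?thesis .
qed

lemma measurable_heat [measurable]:
  assumes "0 \<le> s"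
  shows "heat \<kappa> n s \<in> borel_measurable borel"
proof -
  have "(\<lambda>y. Re (fourier \<kappa> n s y)) \<in> borel_measurable borel" by measurable
  then show ?thesis using fourier_eq_heat[OF assms] by simp
qed

lemma heat_le_1:
  assumes s: "0 \<le> s"
  shows "heat \<kappa> n s y \<le> 1"
proof -
  interpret prob_space "\<nu> s" by (rule prob_\<nu>[OF s])
  have "heat \<kappa> n s y \<le> (LINT w|\<nu> s. 1)"
    unfolding heat_def using integrable_exp_sq[OF s, of "\<kappa>\<^sup>2 / 2" n y]
    by (intro integral_mono) (auto simp: sq_nonneg)
  then show ?thesis by (simp add: prob_space)
qed

lemma transition_fourier:
  assumes s: "0 \<le> s" and t: "0 \<le> t"
  shows "transition \<nu> t (\<lambda>y. ennreal (Re (fourier \<kappa> n s y))) y = ennreal (Re (fourier \<kappa> n (s + t) y))"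
proof -
  note [measurable_cong] = sets_\<nu>[OF t]
  have int: "integrable (\<nu> t) (\<lambda>w. fourier \<kappa> n s (y + w))"
  proof (rule integrable_bounded[where B = 1])
    show "(\<lambda>w. fourier \<kappa> n s (y + w)) \<in> borel_measurable (\<nu> t)" by measurable
  qed (use heat_le_1[OF s] heat_nonneg prob_\<nu>[OF t] in \<open>auto simp: fourier_eq_heat[OF s]\<close>)
  have "transition \<nu> t (\<lambda>y. ennreal (Re (fourier \<kappa> n s y))) y = ennreal (LINT w|\<nu> t. Re (fourier \<kappa> n s (y + w)))"
    unfolding transition_def using heat_nonneg
    by (intro nn_integral_eq_integral integrable_Re int) (auto simp: fourier_eq_heat[OF s])
  also have "(LINT w|\<nu> t. Re (fourier \<kappa> n s (y + w))) = Re (fourier \<kappa> n (s + t) y)"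
    using int fourier_shift[OF s t] by (simp add: integral_Re)
  finally show ?thesis .
qed

text \<open>Symmetrization: the difference of two independent variables with law
  \<open>\<nu> s\<close> has characteristic function exp(-2 s Re \<psi>). The identity carries
  limits from \<open>heat\<close> to \<open>phi\<close>, and lower bounds on \<open>phi\<close> back
  to some value of \<open>heat\<close>.\<close>

lemma phi_double:
  assumes s: "0 \<le> s"
  shows "(LINT w|\<nu> s. heat \<kappa> n s (- w)) = phi \<kappa> n (2 * s)"
proof -
  note [measurable_cong] = sets_\<nu>[OF s]
  have "complex_of_real (LINT w|\<nu> s. heat \<kappa> n s (- w)) = (LINT w|\<nu> s. fourier \<kappa> n s (- w))"
    by (simp add: fourier_eq_heat[OF s])
  also have "\<dots> = (LINT x|gauss n. LINT w|\<nu> s. cis (\<kappa> * pairing n x (- w)) * exp (- (complex_of_real s * \<psi> (\<kappa> *\<^sub>R lin n x))))"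
    unfolding fourier_def
    by (rule Fubini_bounded[where B = 1]) (use prob_space_gauss prob_\<nu>[OF s] norm_fourier_integrand[OF s] in auto)
  also have "\<dots> = (LINT x|gauss n. complex_of_real (exp (- (2 * s * Re (\<psi> (\<kappa> *\<^sub>R lin n x))))))"
  proof (intro Bochner_Integration.integral_cong refl)
    fix x
    let ?e = "exp (- (complex_of_real s * \<psi> (\<kappa> *\<^sub>R lin n x)))"
    have "pairing n x (- w) = - pairing n x w" for w
      by (simp add: pairing_def blinfun.minus_right sum_negf)
    then have "(LINT w|\<nu> s. cis (\<kappa> * pairing n x (- w)) * ?e) = (LINT w|\<nu> s. cnj (cis (\<kappa> * pairing n x w))) * ?e"
      by (simp add: cis_cnj)
    also have "(LINT w|\<nu> s. cnj (cis (\<kappa> * pairing n x w))) = cnj ?e"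
      by (simp only: Bochner_Integration.integral_cnj char[OF s])
    also have "cnj ?e * ?e = complex_of_real ((norm ?e)\<^sup>2)"
      by (metis complex_norm_square mult.commute)
    also have "(norm ?e)\<^sup>2 = exp (- (2 * s * Re (\<psi> (\<kappa> *\<^sub>R lin n x))))"
      unfolding norm_exp_\<psi> by (simp flip: exp_double)
    finally show "(LINT w|\<nu> s. cis (\<kappa> * pairing n x (- w)) * ?e) = complex_of_real (exp (- (2 * s * Re (\<psi> (\<kappa> *\<^sub>R lin n x)))))" .
  qed
  also have "\<dots> = complex_of_real (phi \<kappa> n (2 * s))" unfolding phi_def by (rule integral_complex_of_real)
  finally show ?thesis by (simp only: of_real_eq_iff)
qed

text \<open>The second moment of the functional in the direction of \<open>y\<close> controls how far \<open>y\<close> can be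
  from the bulk of the law; no dependence on \<open>n\<close> enters.\<close>

lemma sq_bound:
  assumes t: "0 < t" and c: "0 < c" and p: "0 < p" and le: "p \<le> (LINT w|\<nu> t. exp (- (c * sq n (y + w))))"
  shows "sq n y \<le> (4 * C * (1 + t\<^sup>2) + 4 / c) / p"
proof (cases "sq n y = 0")
  case True
  then show ?thesis using C_pos c p by simp
next
  case False
  then have r: "0 < sq n y" using sq_nonneg[of n y] by simp
  note [measurable_cong] = sets_\<nu>'[OF t]
  interpret prob_space "\<nu> t" by (rule prob[OF t])
  define a where "a i = blinfun_apply (L i) y" for i
  \<comment> \<open>The functional with the coordinates of \<open>y\<close>: it has the value
    |y|_n^2 at \<open>y\<close>, and its squared norm in H is at most that same number.\<close>
  define l where "l = (\<Sum>i<n. a i *\<^sub>R L i)"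
  have a: "(\<Sum>i<n. (a i)\<^sup>2) = sq n y" by (simp add: a_def sq_def)
  have lw: "blinfun_apply l w = pairing n a w" for w unfolding l_def by (rule apply_sum)
  have ly: "blinfun_apply l y = sq n y" unfolding lw by (simp add: pairing_def sq_def a_def power2_eq_square)
  have CS: "(sq n y + blinfun_apply l w)\<^sup>2 \<le> sq n y * sq n (y + w)" for w
    using pairing_Cauchy_Schwarz[of n a "y + w"] by (simp add: a ly blinfun.add_right flip: lw)
  have "(norm (dual_emb j l))\<^sup>2 \<le> sq n y"
    unfolding l_def dual_emb_sum using norm_lin[of n a] by (simp add: a)
  then have "(\<integral>\<^sup>+z. ennreal ((blinfun_apply l z)\<^sup>2) \<partial>\<nu> t) \<le> ennreal (C * (1 + t\<^sup>2) * sq n y)"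
    using C_pos by (intro order.trans[OF moment[OF t]] ennreal_leI mult_left_mono) auto
  moreover from this have int: "integrable (\<nu> t) (\<lambda>z. (blinfun_apply l z)\<^sup>2)"
    by (intro integrableI_nonneg) (auto simp: less_top intro: le_less_trans)
  ultimately have E: "(LINT z|\<nu> t. (blinfun_apply l z)\<^sup>2) \<le> C * (1 + t\<^sup>2) * sq n y"
    using C_pos r by (subst (asm) nn_integral_eq_integral) auto
  \<comment> \<open>Either \<open>w\<close> moves the functional by at least half of |y|_n^2, which
    the second moment controls, or by Cauchy-Schwarz |y + w|_n^2 is still at least |y|_n^2 / 4 and
    exp(-a) <= 1/a applies.\<close>
  have pt: "exp (- (c * sq n (y + w))) * sq n y \<le> 4 / sq n y * (blinfun_apply l w)\<^sup>2 + 4 / c" for w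
  proof (cases "sq n y / 2 \<le> \<bar>blinfun_apply l w\<bar>")
    case True
    then have "(sq n y / 2)\<^sup>2 \<le> \<bar>blinfun_apply l w\<bar>\<^sup>2" using r by (intro power_mono) auto
    then have "sq n y \<le> 4 / sq n y * (blinfun_apply l w)\<^sup>2"
      using r by (simp add: field_simps power2_eq_square)
    moreover have "exp (- (c * sq n (y + w))) * sq n y \<le> 1 * sq n y"
      using c r sq_nonneg by (intro mult_right_mono) auto
    moreover have "0 \<le> 4 / c" using c by simp
    ultimately show ?thesis by linarith
  next
    case False
    then have "sq n y / 2 \<le> sq n y + blinfun_apply l w" by linarith
    then have "(sq n y / 2)\<^sup>2 \<le> (sq n y + blinfun_apply l w)\<^sup>2" using r by (intro power_mono) auto
    also have "\<dots> \<le> sq n y * sq n (y + w)" by (rule CS)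
    finally have "sq n y / 4 \<le> sq n (y + w)" using r by (simp add: power2_eq_square field_simps)
    then have "exp (- (c * sq n (y + w))) \<le> exp (- (c * (sq n y / 4)))" using c by simp
    also have "\<dots> \<le> 1 / (c * (sq n y / 4))"
    proof -
      have "c * (sq n y / 4) \<le> exp (c * (sq n y / 4))" using exp_ge_add_one_self[of "c * (sq n y / 4)"] by linarith
      then show ?thesis using c r unfolding exp_minus inverse_eq_divide by (intro divide_left_mono) auto
    qed
    finally have "exp (- (c * sq n (y + w))) * sq n y \<le> 4 / c" using c r by (simp add: field_simps)
    moreover have "0 \<le> 4 / sq n y * (blinfun_apply l w)\<^sup>2" using r by simp
    ultimately show ?thesis by linarith
  qed
  have int_exp: "integrable (\<nu> t) (\<lambda>w. exp (- (c * sq n (y + w))))"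
    using t c by (intro integrable_exp_sq) auto
  have "p * sq n y \<le> (LINT w|\<nu> t. exp (- (c * sq n (y + w)))) * sq n y"
    using le r by (intro mult_right_mono) auto
  also have "\<dots> = (LINT w|\<nu> t. exp (- (c * sq n (y + w))) * sq n y)" by simp
  also have "\<dots> \<le> (LINT w|\<nu> t. 4 / sq n y * (blinfun_apply l w)\<^sup>2 + 4 / c)"
    using int int_exp by (intro integral_mono pt) auto
  also have "\<dots> = 4 / sq n y * (LINT w|\<nu> t. (blinfun_apply l w)\<^sup>2) + 4 / c"
    using int by (simp add: prob_space)
  also have "\<dots> \<le> 4 / sq n y * (C * (1 + t\<^sup>2) * sq n y) + 4 / c"
    using E r by (intro add_right_mono mult_left_mono) auto
  also have "\<dots> = 4 * C * (1 + t\<^sup>2) + 4 / c" using r by simp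
  finally show ?thesis using p by (simp add: field_simps)
qed

text \<open>For \<open>y\<close> in H, adding \<open>y\<close> cannot bring a point outside H into
  H, so nullness of H lets the integrand tend to 0 almost surely. For \<open>y\<close> outside H,
  \<open>sq_bound\<close> with the heat value itself as \<open>p\<close> gives a bound of order 1 /
  |y|_n^2.\<close>

lemma heat_tendsto_0:
  assumes t: "0 < t" and \<kappa>: "0 < \<kappa>"
  shows "(\<lambda>n. heat \<kappa> n t y) \<longlonglongrightarrow> 0"
proof (cases "y \<in> range j")
  case True
  note [measurable_cong] = sets_\<nu>'[OF t]
  interpret prob_space "\<nu> t" by (rule prob[OF t])
  have "(\<lambda>n. heat \<kappa> n t y) \<longlonglongrightarrow> (LINT w|\<nu> t. 0)"
    unfolding heat_def
  proof (rule integral_dominated_convergence[where w = "\<lambda>_. 1"])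
    have "AE w in \<nu> t. w \<notin> range j"
      using null[OF t] range_j_borel sets_\<nu>'[OF t] by (intro AE_not_in null_setsI) auto
    then show "AE w in \<nu> t. (\<lambda>n. exp (- (\<kappa>\<^sup>2 * sq n (y + w) / 2))) \<longlonglongrightarrow> 0"
    proof eventually_elim
      case (elim w)
      interpret j: bounded_linear j by (rule bounded_linear_j)
      have "y + w \<notin> range j"
      proof
        assume "y + w \<in> range j"
        then obtain g h where "y + w = j g" "y = j h" using True by auto
        then have "w = j (g - h)" by (simp add: j.diff algebra_simps)
        then show False using elim by simp
      qed
      from sq_at_top[OF this]
      have "filterlim (\<lambda>n. \<kappa>\<^sup>2 / 2 * sq n (y + w)) at_top sequentially"
        using \<kappa> by (intro filterlim_tendsto_pos_mult_at_top[OF tendsto_const]) auto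
      then have "filterlim (\<lambda>n. - (\<kappa>\<^sup>2 / 2 * sq n (y + w))) at_bot sequentially"
        by (simp add: filterlim_uminus_at_bot)
      from filterlim_compose[OF exp_at_bot this] show ?case by simp
    qed
  qed (auto simp: sq_nonneg)
  then show ?thesis by simp
next
  case False
  define D where "D = 4 * C * (1 + t\<^sup>2) + 4 / (\<kappa>\<^sup>2 / 2)"
  note lim = sq_at_top[OF False]
  have "eventually (\<lambda>n. heat \<kappa> n t y \<le> D / sq n y) sequentially"
    using lim[unfolded filterlim_at_top_dense, rule_format, of 0]
  proof eventually_elim
    case (elim n)
    have "0 < 1 + t\<^sup>2" by (rule add_pos_nonneg) simp_all
    then have "0 < 4 * C * (1 + t\<^sup>2)" using C_pos by simp
    moreover have "0 < 4 / (\<kappa>\<^sup>2 / 2)" using \<kappa> by simp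
    ultimately have "0 < D" unfolding D_def by (rule add_pos_pos)
    show ?case
    proof (cases "heat \<kappa> n t y = 0")
      case True
      then show ?thesis using elim \<open>0 < D\<close> by simp
    next
      case False
      then have h: "0 < heat \<kappa> n t y" using heat_nonneg[of \<kappa> n t y] by simp
      have "sq n y \<le> D / heat \<kappa> n t y"
        unfolding D_def using \<kappa> by (intro sq_bound t h) (auto simp: heat_def)
      then show ?thesis using h elim by (simp add: field_simps)
    qed
  qed
  moreover have "(\<lambda>n. D / sq n y) \<longlonglongrightarrow> 0" by (rule real_tendsto_divide_at_top[OF tendsto_const lim])
  ultimately show ?thesis
    by (rule tendsto_sandwich[OF always_eventually[OF allI[OF heat_nonneg]] _ tendsto_const])
qed

lemma phi_tendsto_0:
  assumes t: "0 < t" and \<kappa>: "0 < \<kappa>"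
  shows "(\<lambda>n. phi \<kappa> n t) \<longlonglongrightarrow> 0"
proof -
  have t2: "0 < t / 2" "0 \<le> t / 2" using t by auto
  note [measurable_cong] = sets_\<nu>[OF t2(2)]
  note [measurable] = measurable_heat[OF t2(2)]
  interpret prob_space "\<nu> (t / 2)" by (rule prob[OF t2(1)])
  have "(\<lambda>n. LINT w|\<nu> (t / 2). heat \<kappa> n (t / 2) (- w)) \<longlonglongrightarrow> (LINT w|\<nu> (t / 2). 0)"
  proof (rule integral_dominated_convergence[where w = "\<lambda>_. 1"])
    show "(\<lambda>w. heat \<kappa> n (t / 2) (- w)) \<in> borel_measurable (\<nu> (t / 2))" for n
      by measurable
  qed (use heat_tendsto_0[OF t2(1) \<kappa>] heat_le_1[OF t2(2)] heat_nonneg in auto)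
  then show ?thesis using phi_double[OF t2(2)] by simp
qed

section \<open>Mean of the exponent and concentration\<close>

definition mean :: "real \<Rightarrow> nat \<Rightarrow> real" where
  "mean \<kappa> n = (LINT x|gauss n. Re (\<psi> (\<kappa> *\<^sub>R lin n x)))"

lemma integrable_Re_\<psi>: "integrable (gauss n) (\<lambda>x. Re (\<psi> (\<kappa> *\<^sub>R lin n x)))"
proof (rule Bochner_Integration.integrable_bound)
  show "integrable (gauss n) (\<lambda>x. K * \<kappa>\<^sup>2 * (\<Sum>i<n. (x i)\<^sup>2))"
    by (intro integrable_mult_right integrable_gauss_sum_squares)
  have "Re (\<psi> (\<kappa> *\<^sub>R lin n x)) \<le> K * \<kappa>\<^sup>2 * (\<Sum>i<n. (x i)\<^sup>2)" for x
  proof -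
    have "Re (\<psi> (\<kappa> *\<^sub>R lin n x)) \<le> K * \<kappa>\<^sup>2 * (norm (lin n x))\<^sup>2"
      using Re_\<psi>_lin[of \<kappa> n x "\<lambda>_. 0"] by (simp add: lin_0 \<psi>_0 power_mult_distrib)
    also have "\<dots> \<le> K * \<kappa>\<^sup>2 * (\<Sum>i<n. (x i)\<^sup>2)"
      using K_pos norm_lin by (intro mult_left_mono) auto
    finally show ?thesis .
  qed
  then show "AE x in gauss n. norm (Re (\<psi> (\<kappa> *\<^sub>R lin n x))) \<le> norm (K * \<kappa>\<^sup>2 * (\<Sum>i<n. (x i)\<^sup>2))"
    using Re_\<psi>_nonneg K_pos by (auto simp: sum_nonneg)
qed measurable

lemma mean_nonneg: "0 \<le> mean \<kappa> n"
  unfolding mean_def using Re_\<psi>_nonneg by (intro Bochner_Integration.integral_nonneg) auto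

lemma mean_le: "mean 1 n \<le> 4 * mean (1 / 2) n"
proof -
  have "mean 1 n \<le> (LINT x|gauss n. 4 * Re (\<psi> ((1 / 2) *\<^sub>R lin n x)))"
    unfolding mean_def using Re_\<psi>_double[of "(1 / 2) *\<^sub>R lin n x" for x]
    by (intro integral_mono integrable_Re_\<psi> integrable_mult_right) auto
  then show ?thesis by (simp add: mean_def)
qed

lemma nn_integral_phi:
  "(\<integral>\<^sup>+x. ennreal (exp (- (s * Re (\<psi> (\<kappa> *\<^sub>R lin n x))))) \<partial>gauss n) = ennreal (phi \<kappa> n s)" if "0 \<le> s"
  unfolding phi_def using that Re_\<psi>_nonneg
  by (intro nn_integral_eq_integral integrable_bounded[where B = 1] prob_space_gauss) auto

lemma phi_nonneg: "0 \<le> phi \<kappa> n s"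
  unfolding phi_def by (intro Bochner_Integration.integral_nonneg) simp

lemma phi_antimono:
  assumes "0 \<le> s" "s \<le> t"
  shows "phi \<kappa> n t \<le> phi \<kappa> n s"
proof -
  have "ennreal (phi \<kappa> n t) \<le> ennreal (phi \<kappa> n s)"
    unfolding nn_integral_phi[OF assms(1), symmetric] nn_integral_phi[OF order.trans[OF assms], symmetric]
    using assms Re_\<psi>_nonneg by (intro nn_integral_mono) (auto intro: mult_right_mono)
  then show ?thesis using phi_nonneg by simp
qed

lemma phi_ge:
  assumes s: "0 \<le> s"
  shows "exp (- (s * mean \<kappa> n)) \<le> phi \<kappa> n s"
proof -
  have "ennreal (exp (LINT x|gauss n. - s * Re (\<psi> (\<kappa> *\<^sub>R lin n x))))
      \<le> (\<integral>\<^sup>+x. ennreal (exp (- s * Re (\<psi> (\<kappa> *\<^sub>R lin n x)))) \<partial>gauss n)"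
    by (intro exp_le_nn_integral_exp prob_space_gauss integrable_mult_right integrable_Re_\<psi>)
  then show ?thesis using s phi_nonneg by (simp add: nn_integral_phi mean_def)
qed

text \<open>The reverse of the Jensen bound \<open>phi_ge\<close>, up to a factor 2. Maurey's
  inequality is used with u = exp(s \<rho> / 2) and v = exp(-s \<rho>); the unequal exponents match
  the factor 2 in the estimate for \<rho>, and s K <= 1 keeps the quadratic error within the
  admissible exponent. Jensen then bounds the integral of u from below.\<close>

lemma phi_half_le:
  assumes s: "0 < s" "s * K \<le> 1"
  shows "phi (1 / 2) n s \<le> exp (- (s * mean (1 / 2) n / 2))"
proof -
  define \<rho> where "\<rho> x = Re (\<psi> ((1 / 2) *\<^sub>R lin n x))" for x
  have [measurable]: "\<rho> \<in> borel_measurable (gauss n)" unfolding \<rho>_def by measurable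
  have maurey: "(\<integral>\<^sup>+x. ennreal (exp (s / 2 * \<rho> x)) \<partial>gauss n) * (\<integral>\<^sup>+x. ennreal (exp (- (s * \<rho> x))) \<partial>gauss n) \<le> 1"
  proof (rule maurey_property)
    fix x y
    have "lin n x - lin n y = lin n (\<lambda>i. x i - y i)"
      by (simp add: lin_def scaleR_diff_left sum_subtractf)
    then have "(norm ((1 / 2) *\<^sub>R lin n x - (1 / 2) *\<^sub>R lin n y))\<^sup>2 = (norm (lin n (\<lambda>i. x i - y i)))\<^sup>2 / 4"
      by (simp add: power_divide flip: scaleR_diff_right)
    also have "\<dots> \<le> (\<Sum>i<n. (x i - y i)\<^sup>2) / 4" using norm_lin[of n "\<lambda>i. x i - y i"] by simp
    finally have "K * (norm ((1 / 2) *\<^sub>R lin n x - (1 / 2) *\<^sub>R lin n y))\<^sup>2 \<le> K * ((\<Sum>i<n. (x i - y i)\<^sup>2) / 4)"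
      by (rule mult_left_mono) (use K_pos in simp)
    then have "\<rho> x \<le> 2 * \<rho> y + K * ((\<Sum>i<n. (x i - y i)\<^sup>2) / 4)"
      using Re_\<psi>_lin[of "1 / 2" n x y]
      unfolding \<rho>_def by linarith
    then have "s / 2 * \<rho> x \<le> s / 2 * (2 * \<rho> y + K * ((\<Sum>i<n. (x i - y i)\<^sup>2) / 4))"
      using s by (intro mult_left_mono) auto
    also have "\<dots> = s * \<rho> y + (s * K) * ((\<Sum>i<n. (x i - y i)\<^sup>2) / 8)" by (simp add: algebra_simps)
    also have "(s * K) * ((\<Sum>i<n. (x i - y i)\<^sup>2) / 8) \<le> 1 * ((\<Sum>i<n. (x i - y i)\<^sup>2) / 8)"
      using s by (intro mult_right_mono) (auto simp: sum_nonneg)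
    finally have "s / 2 * \<rho> x + - (s * \<rho> y) \<le> (\<Sum>i<n. (x i - y i)\<^sup>2) / 4"
      using sum_nonneg[of "{..<n}" "\<lambda>i. (x i - y i)\<^sup>2"] by simp
    then show "ennreal (exp (s / 2 * \<rho> x)) * ennreal (exp (- (s * \<rho> y))) \<le> ennreal (exp ((\<Sum>i<n. (x i - y i)\<^sup>2) / 4))"
      by (simp flip: ennreal_mult exp_add)
  qed measurable
  have v: "(\<integral>\<^sup>+x. ennreal (exp (- (s * \<rho> x))) \<partial>gauss n) = ennreal (phi (1 / 2) n s)"
    unfolding \<rho>_def using s by (simp add: nn_integral_phi)
  have "ennreal (exp (s / 2 * mean (1 / 2) n)) \<le> (\<integral>\<^sup>+x. ennreal (exp (s / 2 * \<rho> x)) \<partial>gauss n)"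
    unfolding mean_def \<rho>_def integral_mult_right_zero[symmetric]
    by (intro exp_le_nn_integral_exp prob_space_gauss integrable_mult_right integrable_Re_\<psi>)
  from order.trans[OF mult_right_mono[OF this] maurey]
  have "ennreal (exp (s / 2 * mean (1 / 2) n)) * ennreal (phi (1 / 2) n s) \<le> 1"
    unfolding v by simp
  then have "exp (s / 2 * mean (1 / 2) n) * phi (1 / 2) n s \<le> 1"
    using phi_nonneg by (simp flip: ennreal_mult)
  then show ?thesis by (simp add: exp_minus field_simps)
qed

text \<open>One square root of \<open>phi\<close> pays for the mean through the exponential bound,
  while the other tends to 0.\<close>

lemma mean_phi_tendsto_0:
  assumes t: "0 < t"
  shows "(\<lambda>n. (1 + mean 1 n) * phi (1 / 2) n t) \<longlonglongrightarrow> 0"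
proof -
  \<comment> \<open>Concentration works for times up to 1 / K only; \<open>phi\<close> decreases in
    time, so passing from \<open>t\<close> to \<open>s\<close> is harmless.\<close>
  define s where "s = min t (1 / K)"
  have s: "0 < s" "s \<le> t" "s * K \<le> 1" using t K_pos by (auto simp: s_def min_def field_simps)
  have le: "(1 + mean 1 n) * phi (1 / 2) n t \<le> (1 + 16 / s) * sqrt (phi (1 / 2) n s)" for n
  proof -
    define b where "b = mean (1 / 2) n"
    have b: "0 \<le> b" by (simp add: b_def mean_nonneg)
    have "sqrt (phi (1 / 2) n s) \<le> sqrt (exp (- (s * b / 2)))"
      using phi_half_le[OF s(1,3)] by (simp add: b_def)
    also have "- (s * b / 2) = - (s * b / 4) + - (s * b / 4)" by simp
    also have "sqrt (exp \<dots>) = exp (- (s * b / 4))"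
      unfolding exp_add by simp
    finally have sq: "sqrt (phi (1 / 2) n s) \<le> exp (- (s * b / 4))" .
    \<comment> \<open>From x exp(-x) <= 1 at x = s b / 4; the constant 16 / s combines this 4 with
      the one in \<open>mean_le\<close>.\<close>
    have "s * b / 4 \<le> exp (s * b / 4)" using exp_ge_add_one_self[of "s * b / 4"] by linarith
    then have 1: "4 * b * exp (- (s * b / 4)) \<le> 16 / s"
      using s(1) by (simp add: exp_minus field_simps)
    have 2: "exp (- (s * b / 4)) \<le> 1" using s b by simp
    have "(1 + mean 1 n) * phi (1 / 2) n t \<le> (1 + 4 * b) * phi (1 / 2) n s"
      using mean_le[of n] phi_antimono[of s t] s phi_nonneg mean_nonneg
      by (intro mult_mono) (auto simp: b_def)
    also have "\<dots> = ((1 + 4 * b) * sqrt (phi (1 / 2) n s)) * sqrt (phi (1 / 2) n s)"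
      using phi_nonneg by simp
    also have "\<dots> \<le> ((1 + 4 * b) * exp (- (s * b / 4))) * sqrt (phi (1 / 2) n s)"
      using b sq phi_nonneg by (intro mult_right_mono mult_left_mono) auto
    also have "\<dots> \<le> (1 + 16 / s) * sqrt (phi (1 / 2) n s)"
    proof (intro mult_right_mono)
      show "(1 + 4 * b) * exp (- (s * b / 4)) \<le> 1 + 16 / s"
        unfolding distrib_right mult_1 by (rule add_mono[OF 2 1])
    qed (use phi_nonneg in simp)
    finally show ?thesis .
  qed
  have "(\<lambda>n. (1 + 16 / s) * sqrt (phi (1 / 2) n s)) \<longlonglongrightarrow> (1 + 16 / s) * sqrt 0"
    using s by (intro tendsto_intros phi_tendsto_0) auto
  then have lim: "(\<lambda>n. (1 + 16 / s) * sqrt (phi (1 / 2) n s)) \<longlonglongrightarrow> 0" by simp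
  have "0 \<le> (1 + mean 1 n) * phi (1 / 2) n t" for n
    by (intro mult_nonneg_nonneg phi_nonneg add_nonneg_nonneg mean_nonneg zero_le_one)
  then show ?thesis
    by (intro tendsto_sandwich[OF _ _ tendsto_const lim] always_eventually allI le)
qed

text \<open>Symmetrization provides a centre, depending on n and s, around which the law has mass
  not small; \<open>sq_bound\<close> places that centre in a ball independent of n. Moving from
  there to \<open>j h\<close> costs a factor 4 in the exponent, hence the change of scale from 1 to
  1/2.\<close>

lemma heat_ge:
  assumes s: "0 < s" "s \<le> 1" "s * mean 1 n \<le> 1" and h: "norm h \<le> R"
  shows "exp (- (3 + R\<^sup>2 / 4 + (4 * C + 4) * exp 3)) \<le> heat (1 / 2) n s (j h)"
proof -
  note [measurable_cong] = sets_\<nu>'[OF s(1)]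
  have s0: "0 \<le> s" using s by simp
  interpret prob_space "\<nu> s" by (rule prob[OF s(1)])
  \<comment> \<open>The average over \<open>w\<close> is \<open>phi 1 n (2 * s)\<close>, which
    Jensen keeps above exp(-2); any constant larger than 2 would serve in place of 3.\<close>
  have "\<exists>w. exp (- 3) \<le> heat 1 n s (- w)"
  proof (rule ccontr)
    assume "\<not> ?thesis"
    then have less: "heat 1 n s (- w) \<le> exp (- 3)" for w by (meson linorder_linear)
    have "(LINT w|\<nu> s. heat 1 n s (- w)) \<le> (LINT w|\<nu> s. exp (- 3))"
    proof (intro integral_mono less)
      have "(\<lambda>w. heat 1 n s (- w)) \<in> borel_measurable (\<nu> s)"
        using measurable_heat[OF s0] by measurable
      then show "integrable (\<nu> s) (\<lambda>w. heat 1 n s (- w))"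
        using heat_le_1[OF s0] heat_nonneg by (intro integrable_bounded[where B = 1] prob_space_axioms) auto
    qed simp
    then have "phi 1 n (2 * s) \<le> exp (- 3)" by (simp add: phi_double[OF s0] prob_space)
    moreover have "exp (- 2) \<le> exp (- (2 * s * mean 1 n))" using s by simp
    moreover have "\<dots> \<le> phi 1 n (2 * s)" using s by (intro phi_ge) simp
    moreover have "exp (- 3) < exp (- 2 :: real)" by simp
    ultimately show False by linarith
  qed
  then obtain w where w: "exp (- 3) \<le> heat 1 n s (- w)" ..
  have sqw: "sq n (- w) \<le> (8 * C + 8) * exp 3"
  proof -
    have "sq n (- w) \<le> (4 * C * (1 + s\<^sup>2) + 4 / (1 / 2)) / exp (- 3)"
      using w by (intro sq_bound s) (auto simp: heat_def)
    also have "\<dots> \<le> (8 * C + 8) / exp (- 3)"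
    proof (rule divide_right_mono)
      have "s\<^sup>2 \<le> 1" using s by (simp add: power_le_one)
      then have "4 * C * (1 + s\<^sup>2) \<le> 4 * C * 2" using C_pos by simp
      then show "4 * C * (1 + s\<^sup>2) + 4 / (1 / 2) \<le> 8 * C + 8" by simp
    qed simp
    finally show ?thesis by (simp add: exp_minus field_simps)
  qed
  have sqh: "sq n (j h) \<le> R\<^sup>2" using sq_j[of n h] h by (meson norm_ge_zero order.trans power_mono)
  define c where "c = exp (- (R\<^sup>2 / 4 + (4 * C + 4) * exp 3))"
  have "exp (- (3 + R\<^sup>2 / 4 + (4 * C + 4) * exp 3)) = c * exp (- 3)"
    by (simp add: c_def mult_exp_exp)
  also have "\<dots> \<le> c * heat 1 n s (- w)" using w by (intro mult_left_mono) (auto simp: c_def)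
  also have "\<dots> = (LINT z|\<nu> s. c * exp (- (1\<^sup>2 * sq n (- w + z) / 2)))"
    unfolding heat_def by simp
  also have "\<dots> \<le> (LINT z|\<nu> s. exp (- ((1 / 2)\<^sup>2 * sq n (j h + z) / 2)))"
  proof (intro integral_mono)
    fix z
    \<comment> \<open>Two uses of \<open>sq_add\<close> produce the coefficient 4 of |z - w|_n^2;
      division by 8 leaves the 1/2 of scale 1.\<close>
    have "sq n (j h + z) \<le> 2 * sq n (j h) + 2 * sq n z" by (rule sq_add)
    moreover have "sq n z \<le> 2 * sq n w + 2 * sq n (- w + z)" using sq_add[of n w "- w + z"] by simp
    moreover have "sq n w = sq n (- w)" by (simp add: sq_def blinfun.minus_right)
    ultimately have "sq n (j h + z) / 8 \<le> R\<^sup>2 / 4 + (4 * C + 4) * exp 3 + sq n (- w + z) / 2"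
      using sqw sqh by (simp add: algebra_simps)
    then show "c * exp (- (1\<^sup>2 * sq n (- w + z) / 2)) \<le> exp (- ((1 / 2)\<^sup>2 * sq n (j h + z) / 2))"
      by (simp add: c_def mult_exp_exp power_divide)
  next
    show "integrable (\<nu> s) (\<lambda>z. exp (- ((1 / 2)\<^sup>2 * sq n (j h + z) / 2)))"
      using integrable_exp_sq[OF s0, of "1 / 8" n "j h"] by (simp add: power_divide)
    show "integrable (\<nu> s) (\<lambda>z. c * exp (- (1\<^sup>2 * sq n (- w + z) / 2)))"
      using integrable_exp_sq[OF s0, of "1 / 2" n "- w"] by simp
  qed
  finally show ?thesis by (simp add: heat_def)
qed

theorem polar_range: "polar \<nu> (range j)"
proof (rule polarI)
  show "range j \<in> sets borel" by (rule range_j_borel)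
  fix \<beta> t y
  assume \<beta>: "(0::real) < \<beta>" and t: "(0::real) < t"
  show "transition \<nu> t (reduced \<nu> \<beta> (range j)) y = 0"
  proof -
    have "transition \<nu> t (reduced \<nu> \<beta> (range j)) y \<le> 0"
    proof (rule ennreal_le_epsilon)
      fix \<epsilon> :: real assume \<epsilon>: "0 < \<epsilon>"
      \<comment> \<open>The reciprocal of the bound in \<open>heat_ge\<close> for radius R, times
        exp \<beta> to offset the discount exp(-\<beta> s) for s <= 1.\<close>
      define c where "c R = exp (\<beta> + (3 + (real R)\<^sup>2 / 4 + (4 * C + 4) * exp 3))" for R :: nat
      have c: "0 < c R" for R by (simp add: c_def)
      \<comment> \<open>Each ball gets its own dimension, chosen so that the images under P_t have
        geometrically decreasing bounds, with sum \<epsilon> after the \<beta>-discounted time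
        integral.\<close>
      have "\<exists>n. c R * ((1 + mean 1 n) * phi (1 / 2) n t) < \<beta> * \<epsilon> * (1 / 2) ^ Suc R" for R
      proof -
        have "(\<lambda>n. c R * ((1 + mean 1 n) * phi (1 / 2) n t)) \<longlonglongrightarrow> c R * 0"
          by (intro tendsto_intros mean_phi_tendsto_0 t)
        then have "eventually (\<lambda>n. c R * ((1 + mean 1 n) * phi (1 / 2) n t) < \<beta> * \<epsilon> * (1 / 2) ^ Suc R) sequentially"
          using \<beta> \<epsilon> by (intro order_tendstoD(2)) auto
        then show ?thesis by (auto simp: eventually_sequentially)
      qed
      then obtain N where N: "\<And>R. c R * ((1 + mean 1 (N R)) * phi (1 / 2) (N R) t) < \<beta> * \<epsilon> * (1 / 2) ^ Suc R"
        by metis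
      define a where "a R = c R * (1 + mean 1 (N R))" for R
      have a: "0 < a R" for R using c mean_nonneg[of 1 "N R"] by (simp add: a_def)
      define F where "F R s y = Re (fourier (1 / 2) (N R) s y)" for R s y
      have F: "F R s y = heat (1 / 2) (N R) s y" if "0 \<le> s" for R s y
        using fourier_eq_heat[OF that] by (simp add: F_def)
      have [measurable]: "case_prod (F R) \<in> borel_measurable (borel \<Otimes>\<^sub>M borel)" for R
        unfolding F_def by measurable
      define q where "q s y = (\<Sum>R. ennreal (a R) * ennreal (F R s y))" for s y
      have q[measurable]: "case_prod q \<in> borel_measurable (borel \<Otimes>\<^sub>M borel)"
        unfolding q_def by measurable
      have entrance: "transition \<nu> t (q s) y = q (s + t) y" if s: "0 \<le> s" and t: "0 \<le> t" for s t y
      proof -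
        note [measurable_cong] = sets_\<nu>[OF t]
        have "transition \<nu> t (q s) y = (\<Sum>R. \<integral>\<^sup>+w. ennreal (a R) * ennreal (F R s (y + w)) \<partial>\<nu> t)"
          unfolding transition_def q_def by (rule nn_integral_suminf) measurable
        also have "\<dots> = (\<Sum>R. ennreal (a R) * transition \<nu> t (\<lambda>y. ennreal (F R s y)) y)"
          unfolding transition_def by (intro suminf_cong nn_integral_cmult) measurable
        also have "\<dots> = q (s + t) y"
          unfolding q_def F_def transition_fourier[OF s t] ..
        finally show ?thesis .
      qed
      define u where "u y = (\<integral>\<^sup>+s\<in>{0..}. ennreal (exp (- \<beta> * s)) * q s y \<partial>lborel)" for y
      have exc: "excessive \<nu> \<beta> u"
        unfolding u_def[abs_def] by (rule excessive_potential(2)) (use prob_\<nu> sets_\<nu> q entrance in auto)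
      have "1 \<le> u (j h)" for h
      proof -
        obtain R :: nat where R: "norm h \<le> real R" using real_arch_simple by blast
        \<comment> \<open>\<open>heat_ge\<close> applies on (0, \<tau>] because \<tau> <= 1 and
          \<tau> times the mean is at most 1; this length gives the constant 1 + mean the integral
          1.\<close>
        define \<tau> where "\<tau> = 1 / (1 + mean 1 (N R))"
        have \<tau>: "0 < \<tau>" "\<tau> \<le> 1" "\<tau> * (1 + mean 1 (N R)) = 1"
          using mean_nonneg[of 1 "N R"] by (auto simp: \<tau>_def)
        have "1 = ennreal ((1 + mean 1 (N R)) * \<tau>)" using \<tau>(3) by (simp add: mult.commute)
        also have "\<dots> = ennreal (1 + mean 1 (N R)) * ennreal \<tau>"
          using \<tau> mean_nonneg[of 1 "N R"] by (intro ennreal_mult) auto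
        also have "\<dots> = (\<integral>\<^sup>+s. ennreal (1 + mean 1 (N R)) * indicator {0<..\<tau>} s \<partial>lborel)"
          using \<tau> by (subst nn_integral_cmult) auto
        also have "\<dots> \<le> u (j h)"
          unfolding u_def
        proof (intro nn_integral_mono)
          fix s :: real
          show "ennreal (1 + mean 1 (N R)) * indicator {0<..\<tau>} s \<le> ennreal (exp (- \<beta> * s)) * q s (j h) * indicator {0..} s"
          proof (cases "s \<in> {0<..\<tau>}")
            case True
            then have s: "0 < s" "s \<le> \<tau>" "s \<le> 1" using \<tau> by auto
            have "s * mean 1 (N R) \<le> \<tau> * (1 + mean 1 (N R))"
              using s mean_nonneg[of 1 "N R"] by (intro mult_mono) auto
            then have "exp (- (3 + (real R)\<^sup>2 / 4 + (4 * C + 4) * exp 3)) \<le> heat (1 / 2) (N R) s (j h)"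
              using s \<tau> R by (intro heat_ge) auto
            then have "c R * exp (- (3 + (real R)\<^sup>2 / 4 + (4 * C + 4) * exp 3)) \<le> c R * heat (1 / 2) (N R) s (j h)"
              using c[of R] by (intro mult_left_mono) auto
            then have "exp \<beta> \<le> c R * heat (1 / 2) (N R) s (j h)"
              by (simp add: c_def mult_exp_exp)
            then have "exp \<beta> * (1 + mean 1 (N R)) \<le> a R * F R s (j h)"
              using mult_right_mono[of "exp \<beta>" "c R * heat (1 / 2) (N R) s (j h)" "1 + mean 1 (N R)"] s mean_nonneg[of 1 "N R"]
              by (simp add: a_def F ac_simps)
            then have "exp (- \<beta> * s) * (exp \<beta> * (1 + mean 1 (N R))) \<le> exp (- \<beta> * s) * (a R * F R s (j h))"
              by (rule mult_left_mono) simp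
            moreover have "1 + mean 1 (N R) \<le> exp (- \<beta> * s) * (exp \<beta> * (1 + mean 1 (N R)))"
            proof -
              have "1 \<le> exp (- \<beta> * s) * exp \<beta>"
                using s \<beta> mult_left_mono[of s 1 \<beta>] by (simp flip: exp_add)
              from mult_right_mono[OF this, of "1 + mean 1 (N R)"] show ?thesis
                using mean_nonneg[of 1 "N R"] by (simp add: mult.assoc)
            qed
            ultimately have "ennreal (1 + mean 1 (N R)) \<le> ennreal (exp (- \<beta> * s) * (a R * F R s (j h)))"
              by (intro ennreal_leI) linarith
            also have "\<dots> = ennreal (exp (- \<beta> * s)) * (ennreal (a R) * ennreal (F R s (j h)))"
              using a[of R] s heat_nonneg by (simp add: ennreal_mult F less_imp_le)
            also have "ennreal (a R) * ennreal (F R s (j h)) \<le> q s (j h)"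
              unfolding q_def
              using sum_le_suminf[OF _ _ , of "\<lambda>R. ennreal (a R) * ennreal (F R s (j h))" "{R}"] by simp
            finally show ?thesis using True by (simp add: mult_left_mono)
          qed simp
        qed
        finally show ?thesis .
      qed
      then have "reduced \<nu> \<beta> (range j) z \<le> u z" for z
        unfolding reduced_def using exc by (intro INF_lower) auto
      then have "transition \<nu> t (reduced \<nu> \<beta> (range j)) y \<le> transition \<nu> t u y"
        unfolding transition_def by (intro nn_integral_mono) auto
      also have "\<dots> = (\<integral>\<^sup>+s\<in>{0..}. ennreal (exp (- \<beta> * s)) * q (s + t) y \<partial>lborel)"
        unfolding u_def[abs_def]
        by (rule excessive_potential(1)) (use prob_\<nu> sets_\<nu> q entrance t in auto)
      also have "\<dots> \<le> (\<integral>\<^sup>+s. ennreal (\<beta> * \<epsilon>) * ennreal (exp (- \<beta> * s) * indicator {0..} s) \<partial>lborel)"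
      proof (intro nn_integral_mono)
        fix s :: real
        show "ennreal (exp (- \<beta> * s)) * q (s + t) y * indicator {0..} s
          \<le> ennreal (\<beta> * \<epsilon>) * ennreal (exp (- \<beta> * s) * indicator {0..} s)"
        proof (cases "0 \<le> s")
          case True
          \<comment> \<open>The bound by \<open>phi\<close> does not see \<open>y\<close>, and all
            times here are at least \<open>t\<close>, so the choice of \<open>N R\<close> controls
            every term uniformly in s.\<close>
          have "q (s + t) y \<le> (\<Sum>R. ennreal (\<beta> * \<epsilon> * (1 / 2) ^ Suc R))"
            unfolding q_def
          proof (intro suminf_le)
            fix R
            have "F R (s + t) y \<le> phi (1 / 2) (N R) t"
              using True t heat_le_phi[of "s + t" "1 / 2" "N R" y] phi_antimono[of t "s + t" "1 / 2" "N R"] by (simp add: F)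
            then have "a R * F R (s + t) y \<le> a R * phi (1 / 2) (N R) t"
              using a[of R] by (intro mult_left_mono) auto
            also have "\<dots> \<le> \<beta> * \<epsilon> * (1 / 2) ^ Suc R"
              using N[of R] by (simp add: a_def mult.assoc)
            finally have "ennreal (a R * F R (s + t) y) \<le> ennreal (\<beta> * \<epsilon> * (1 / 2) ^ Suc R)"
              by (rule ennreal_leI)
            then show "ennreal (a R) * ennreal (F R (s + t) y) \<le> ennreal (\<beta> * \<epsilon> * (1 / 2) ^ Suc R)"
              using a[of R] True t heat_nonneg by (simp add: F ennreal_mult less_imp_le)
          qed auto
          also have "\<dots> = ennreal (\<beta> * \<epsilon>)"
            using sums_mult[OF power_half_series, of "\<beta> * \<epsilon>"] \<beta> \<epsilon> by (intro suminf_ennreal_eq) auto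
          finally show ?thesis
            using True mult_left_mono[of "q (s + t) y" "ennreal (\<beta> * \<epsilon>)" "ennreal (exp (- \<beta> * s))"] by (simp add: mult.commute)
        qed simp
      qed
      also have "\<dots> = ennreal (\<beta> * \<epsilon>) * (\<integral>\<^sup>+s. ennreal (exp (- \<beta> * s) * indicator {0..} s) \<partial>lborel)"
        by (rule nn_integral_cmult) measurable
      also have "(\<integral>\<^sup>+s. ennreal (exp (- \<beta> * s) * indicator {0..} s) \<partial>lborel) = ennreal (1 / \<beta>)"
      proof -
        have "(\<integral>\<^sup>+s. ennreal (exp (- \<beta> * s) * indicator {0..} s) \<partial>lborel) = (\<integral>\<^sup>+s. ennreal (exp (- \<beta> * s)) * indicator {0..} s \<partial>lborel)"
          by (intro nn_integral_cong) (auto split: split_indicator)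
        also have "\<dots> = ennreal (0 - - exp (- \<beta> * 0) / \<beta>)"
        proof (rule nn_integral_FTC_atLeast)
          have "((\<lambda>x. exp (- \<beta> * x)) \<longlongrightarrow> 0) at_top"
            using \<beta> by (intro filterlim_compose[OF exp_at_bot] filterlim_tendsto_neg_mult_at_bot[OF tendsto_const]) (auto simp: filterlim_ident)
          from tendsto_divide[OF tendsto_minus[OF this] tendsto_const[of \<beta>]] \<beta>
          show "((\<lambda>x. - exp (- \<beta> * x) / \<beta>) \<longlongrightarrow> 0) at_top" by simp
        qed (use \<beta> in \<open>auto intro!: derivative_eq_intros\<close>)
        finally show ?thesis by simp
      qed
      also have "ennreal (\<beta> * \<epsilon>) * ennreal (1 / \<beta>) = 0 + ennreal \<epsilon>"
        using \<beta> \<epsilon> by (simp flip: ennreal_mult)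
      finally show "transition \<nu> t (reduced \<nu> \<beta> (range j)) y \<le> 0 + ennreal \<epsilon>" .
    qed
    then show ?thesis by simp
  qed
qed

end

section \<open>Levy and Gaussian semigroups\<close>

text \<open>The points x and 0 are tested with coefficients 1 and d. The form is then affine in the
  complex number d with slope D, and it could take the value -1 unless D = 0.\<close>

lemma negative_definite_symmetric:
  assumes \<psi>: "negative_definite \<psi>" "\<psi> 0 = 0"
  shows "0 \<le> Re (\<psi> x)" "\<psi> (- x) = cnj (\<psi> x)"
proof -
  have two: "(\<psi> a + cnj (\<psi> a)) * c * cnj c + (\<psi> a + cnj (\<psi> b) - \<psi> (a - b)) * c * cnj d
      + ((\<psi> b + cnj (\<psi> a) - \<psi> (b - a)) * d * cnj c + (\<psi> b + cnj (\<psi> b)) * d * cnj d) \<in> \<real>\<^sub>\<ge>\<^sub>0" for a b c d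
    using \<psi>(1)[unfolded negative_definite_def, THEN spec[of _ 2],
        THEN spec[of _ "\<lambda>i. if i = 0 then a else b"], THEN spec[of _ "\<lambda>i. if i = 0 then c else d"]] \<psi>(2)
    by (simp add: numeral_2_eq_2)
  have "\<psi> x + cnj (\<psi> x) \<in> \<real>\<^sub>\<ge>\<^sub>0" using two[of x 1 0 0] by simp
  then show nonneg: "0 \<le> Re (\<psi> x)" by (simp add: complex_nonneg_Reals_iff)
  define D where "D = cnj (\<psi> x) - \<psi> (- x)"
  have *: "\<psi> x + cnj (\<psi> x) + D * d \<in> \<real>\<^sub>\<ge>\<^sub>0" for d
    using two[of x 1 0 d] \<psi>(2) by (simp add: D_def)
  have "D = 0"
  proof (rule ccontr)
    assume "D \<noteq> 0"
    then have "D * (- (\<psi> x + cnj (\<psi> x) + 1) / D) = - (\<psi> x + cnj (\<psi> x) + 1)" by simp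
    with *[of "- (\<psi> x + cnj (\<psi> x) + 1) / D"] show False by (simp add: complex_nonneg_Reals_iff)
  qed
  then show "\<psi> (- x) = cnj (\<psi> x)" by (simp add: D_def)
qed

lemma negative_definite_Re_diff:
  assumes \<psi>: "negative_definite \<psi>" "\<psi> 0 = 0"
  shows "Re (\<psi> (x - y)) \<le> 2 * Re (\<psi> x) + 2 * Re (\<psi> y)"
proof -
  have "(\<psi> x + cnj (\<psi> x)) + (\<psi> x + cnj (\<psi> y) - \<psi> (x - y))
      + ((\<psi> y + cnj (\<psi> x) - \<psi> (y - x)) + (\<psi> y + cnj (\<psi> y))) \<in> \<real>\<^sub>\<ge>\<^sub>0"
    using \<psi>(1)[unfolded negative_definite_def, THEN spec[of _ 2],
        THEN spec[of _ "\<lambda>i. if i = 0 then x else y"], THEN spec[of _ "\<lambda>i. 1"]] \<psi>(2)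
    by (simp add: numeral_2_eq_2)
  moreover have "\<psi> (y - x) = cnj (\<psi> (x - y))"
    using negative_definite_symmetric(2)[OF \<psi>, of "x - y"] by simp
  ultimately show ?thesis by (simp add: complex_nonneg_Reals_iff)
qed

lemma one_minus_half_square_le_cos: "1 - x\<^sup>2 / 2 \<le> cos (x::real)"
proof -
  have "\<bar>sin (x / 2)\<bar>\<^sup>2 \<le> \<bar>x / 2\<bar>\<^sup>2" by (intro power_mono abs_sin_x_le_abs_x) auto
  moreover have "cos x = 1 - 2 * (sin (x / 2))\<^sup>2" using cos_double_sin[of "x / 2"] by simp
  ultimately show ?thesis by (simp add: power_divide)
qed

text \<open>What has to be extracted is a quadratic bound for Re \<psi>: second moments at time 1
  give it near 0, and dyadic scaling extends it to the whole image of the dual.\<close>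

lemma polar_levy_semigroup:
  fixes j :: "'h::{real_inner, complete_space, second_countable_topology} \<Rightarrow>
              'e::{real_inner, second_countable_topology}"
  assumes levy: "levy_semigroup j \<psi> \<nu>" and H: "hypothesis_H j \<nu>"
  shows "polar \<nu> (range j)"
proof -
  have j: "dense_embedding j" "bounded_linear j" and cont: "continuous_on UNIV \<psi>"
    and \<psi>: "negative_definite \<psi>" "\<psi> 0 = 0" and \<nu>0: "\<nu> 0 = return borel 0"
    and prob: "\<And>t. 0 < t \<Longrightarrow> prob_space (\<nu> t)" and sets: "\<And>t. 0 < t \<Longrightarrow> sets (\<nu> t) = sets borel"
    and char: "\<And>t \<xi>. 0 < t \<Longrightarrow> (LINT z|\<nu> t. iexp (blinfun_apply \<xi> z)) = exp (- (complex_of_real t * \<psi> (dual_emb j \<xi>)))"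
    using levy by (auto simp: levy_semigroup_def dense_embedding_def)
  obtain C where C: "0 < C"
    and moment: "\<And>\<xi> t. 0 < t \<Longrightarrow> (\<integral>\<^sup>+z. ennreal ((blinfun_apply \<xi> z)\<^sup>2) \<partial>\<nu> t)
          \<le> ennreal (C * (1 + t\<^sup>2) * (norm (dual_emb j \<xi>))\<^sup>2)"
    and null: "\<And>t. 0 < t \<Longrightarrow> emeasure (\<nu> t) (range j) = 0"
    using H unfolding hypothesis_H_def by auto
  obtain L :: "nat \<Rightarrow> 'e \<Rightarrow>\<^sub>L real"
    where L: "\<And>i k. i \<noteq> k \<Longrightarrow> inner (dual_emb j (L i)) (dual_emb j (L k)) = 0"
      "\<And>i. L i = 0 \<or> norm (dual_emb j (L i)) = 1"
      "\<And>x. (\<And>k. blinfun_apply (L k) x = 0) \<Longrightarrow> x = 0"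
    using orthonormal_functionals[OF j(1)] by blast
  interpret T: linear "dual_emb j" by (rule linear_dual_emb[OF j(2)])
  \<comment> \<open>From 1 - x^2/2 <= cos x the characteristic function has modulus at least 1 - z,
    so exp(-r) >= 1 - z; for z <= 1/2 this yields r <= 2 z.\<close>
  have small: "Re (\<psi> (dual_emb j \<eta>)) \<le> 2 * C * (norm (dual_emb j \<eta>))\<^sup>2"
    if \<eta>: "C * (norm (dual_emb j \<eta>))\<^sup>2 \<le> 1 / 2" for \<eta>
  proof -
    interpret prob_space "\<nu> 1" by (rule prob) simp
    have s1: "sets (\<nu> 1) = sets borel" by (rule sets) simp
    note [measurable_cong] = s1
    define z where "z = C * (norm (dual_emb j \<eta>))\<^sup>2"
    define r where "r = Re (\<psi> (dual_emb j \<eta>))"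
    have z: "0 \<le> z" "z \<le> 1 / 2" using \<eta> C by (auto simp: z_def)
    have m: "(\<integral>\<^sup>+x. ennreal ((blinfun_apply \<eta> x)\<^sup>2) \<partial>\<nu> 1) \<le> ennreal (2 * z)"
      using moment[of 1 \<eta>] by (simp add: z_def ac_simps)
    then have int: "integrable (\<nu> 1) (\<lambda>x. (blinfun_apply \<eta> x)\<^sup>2)"
      by (intro integrableI_nonneg) (auto simp: less_top intro: le_less_trans)
    have "(LINT x|\<nu> 1. (blinfun_apply \<eta> x)\<^sup>2) \<le> 2 * z"
      using m z by (subst (asm) nn_integral_eq_integral[OF int]) auto
    then have "1 - z \<le> (LINT x|\<nu> 1. 1 - (blinfun_apply \<eta> x)\<^sup>2 / 2)"
      using int by (simp add: prob_space)
    also have "\<dots> \<le> (LINT x|\<nu> 1. cos (blinfun_apply \<eta> x))"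
    proof (rule integral_mono)
      show "integrable (\<nu> 1) (\<lambda>x. cos (blinfun_apply \<eta> x))"
        by (rule integrable_bounded[where B = 1, OF prob_space_axioms]) auto
    qed (use int in \<open>auto intro: one_minus_half_square_le_cos\<close>)
    also have "\<dots> = Re (LINT x|\<nu> 1. cis (blinfun_apply \<eta> x))"
    proof -
      have "integrable (\<nu> 1) (\<lambda>x. cis (blinfun_apply \<eta> x))"
        by (rule integrable_bounded[where B = 1, OF prob_space_axioms]) auto
      from integral_Re[OF this] show ?thesis by simp
    qed
    also have "\<dots> \<le> norm (exp (- \<psi> (dual_emb j \<eta>)))"
      unfolding cis_conv_exp using char[of 1 \<eta>] complex_Re_le_cmod[of "exp (- \<psi> (dual_emb j \<eta>))"] by simp
    also have "\<dots> = exp (- r)" by (simp add: r_def)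
    finally have "(1 - z) * exp r \<le> 1" by (simp add: exp_minus field_simps)
    moreover have "(1 - z) * (1 + r) \<le> (1 - z) * exp r" using z by (intro mult_left_mono) auto
    moreover have "0 \<le> r" unfolding r_def by (rule negative_definite_symmetric(1)[OF \<psi>])
    then have "1 / 2 * r \<le> (1 - z) * r" using z by (intro mult_right_mono) auto
    ultimately have "r \<le> 2 * z" by (simp add: algebra_simps)
    then show ?thesis by (simp add: r_def z_def)
  qed
  have double: "Re (\<psi> (2 *\<^sub>R x)) \<le> 4 * Re (\<psi> x)" for x
    using negative_definite_Re_diff[OF \<psi>, of x "- x"] negative_definite_symmetric(2)[OF \<psi>, of x]
    by (simp add: scaleR_2)
  have power: "Re (\<psi> (2 ^ k *\<^sub>R x)) \<le> 4 ^ k * Re (\<psi> x)" for k x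
  proof (induction k)
    case (Suc k)
    then show ?case using double[of "2 ^ k *\<^sub>R x"] by simp
  qed simp
  have bound: "Re (\<psi> (dual_emb j \<xi>)) \<le> 2 * C * (norm (dual_emb j \<xi>))\<^sup>2" for \<xi>
  proof -
    \<comment> \<open>Halving k times brings the vector into the range of \<open>small\<close>. Re
      \<psi> grows at most by 4 per doubling, as the squared norm does, so the constant 2 C is
      preserved.\<close>
    obtain k where k: "2 * C * (norm (dual_emb j \<xi>))\<^sup>2 < 4 ^ k" using real_arch_pow[of 4] by auto
    define \<eta> where "\<eta> = inverse (2 ^ k) *\<^sub>R \<xi>"
    have \<xi>: "dual_emb j \<xi> = 2 ^ k *\<^sub>R dual_emb j \<eta>" by (simp add: \<eta>_def T.scale)
    have p: "(2 ^ k)\<^sup>2 = (4 :: real) ^ k" by (simp add: power2_eq_square flip: power_mult_distrib)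
    have n: "(norm (dual_emb j \<xi>))\<^sup>2 = 4 ^ k * (norm (dual_emb j \<eta>))\<^sup>2"
      unfolding \<xi> by (simp add: power_mult_distrib p)
    have "4 ^ k * (2 * C * (norm (dual_emb j \<eta>))\<^sup>2) < 4 ^ k * 1"
      using k unfolding n by (simp only: ac_simps mult_1)
    then have "2 * C * (norm (dual_emb j \<eta>))\<^sup>2 < 1"
      by (rule mult_left_less_imp_less) simp
    then have "Re (\<psi> (dual_emb j \<eta>)) \<le> 2 * C * (norm (dual_emb j \<eta>))\<^sup>2" by (intro small) linarith
    then have "4 ^ k * Re (\<psi> (dual_emb j \<eta>)) \<le> 4 ^ k * (2 * C * (norm (dual_emb j \<eta>))\<^sup>2)"
      by (rule mult_left_mono) simp
    also have "\<dots> = 2 * C * (norm (dual_emb j \<xi>))\<^sup>2" unfolding n by simp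
    finally show ?thesis using power[of k "dual_emb j \<eta>"] unfolding \<xi>[symmetric] by linarith
  qed
  interpret cylinder j L by (intro cylinder.intro j(2)) (use L in blast)+
  interpret cylindrical_semigroup j L \<psi> \<nu> "4 * C" C
  proof (intro cylindrical_semigroup.intro cylindrical_semigroup_axioms.intro cylinder_axioms)
    \<comment> \<open>The vector is written as (\<xi> - \<eta>) - (-\<eta>); the factor 2 of
      \<open>negative_definite_Re_diff\<close> times the constant 2 C of \<open>bound\<close> gives
      4 C.\<close>
    show "Re (\<psi> (dual_emb j \<xi>)) \<le> 2 * Re (\<psi> (dual_emb j \<eta>)) + 4 * C * (norm (dual_emb j \<xi> - dual_emb j \<eta>))\<^sup>2" for \<xi> \<eta>
      using negative_definite_Re_diff[OF \<psi>, of "dual_emb j \<xi> - dual_emb j \<eta>" "- dual_emb j \<eta>"]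
        negative_definite_symmetric(2)[OF \<psi>, of "dual_emb j \<eta>"] bound[of "\<xi> - \<eta>"] by (simp add: T.diff)
  qed (use C in \<open>simp_all add: prob sets \<nu>0 char cont \<psi>(2) double moment null
        negative_definite_symmetric(1)[OF \<psi>]\<close>)
  show ?thesis by (rule polar_range)
qed

text \<open>The exponent is half the squared norm. Nullness of H, a hypothesis in the Levy case, is
  derived from infinite dimension; it carries over to all positive times because H is invariant
  under scaling.\<close>

lemma polar_gaussian_semigroup:
  fixes j :: "'h::{real_inner, complete_space, second_countable_topology} \<Rightarrow>
              'e::{real_normed_vector, second_countable_topology}"
  assumes \<mu>: "abstract_wiener_space j \<mu>" and dim: "\<not> (\<exists>B::'h set. finite B \<and> span B = UNIV)"
  shows "polar (gaussian_semigroup \<mu>) (range j)"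
proof -
  have j: "dense_embedding j" "bounded_linear j" "inj j" and "prob_space \<mu>" and sets: "sets \<mu> = sets borel"
    and law: "\<And>l. distr \<mu> borel (blinfun_apply l) = normal_law 0 ((norm (dual_emb j l))\<^sup>2)"
    using \<mu> by (auto simp: abstract_wiener_space_def dense_embedding_def)
  interpret prob_space \<mu> by fact
  note [measurable_cong] = sets
  obtain L :: "nat \<Rightarrow> 'e \<Rightarrow>\<^sub>L real"
    where L: "\<And>i k. i \<noteq> k \<Longrightarrow> inner (dual_emb j (L i)) (dual_emb j (L k)) = 0"
      "\<And>i. L i = 0 \<or> norm (dual_emb j (L i)) = 1"
      "\<And>x. (\<And>k. blinfun_apply (L k) x = 0) \<Longrightarrow> x = 0"
    using orthonormal_functionals[OF j(1)] by blast
  interpret cylinder j L by (intro cylinder.intro j(2)) (use L in blast)+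
  define \<psi> where "\<psi> h = complex_of_real ((norm h)\<^sup>2 / 2)" for h :: 'h
  let ?\<nu> = "gaussian_semigroup \<mu>"
  have char_\<mu>: "(LINT z|\<mu>. iexp (r * blinfun_apply \<xi> z)) = exp (- (complex_of_real (r\<^sup>2) * \<psi> (dual_emb j \<xi>)))" for r \<xi>
  proof -
    have "(LINT z|\<mu>. iexp (r * blinfun_apply \<xi> z)) = (LINT s|distr \<mu> borel (blinfun_apply \<xi>). iexp (r * s))"
      by (subst integral_distr) auto
    then show ?thesis unfolding law by (simp only: iexp_normal_law zero_le_power2 \<psi>_def)
  qed
  have null: "emeasure \<mu> (range j) = 0"
  proof (rule gaussian_null_range[OF \<open>prob_space \<mu>\<close> sets])
    show "(LINT z|\<mu>. iexp (blinfun_apply \<xi> z)) = complex_of_real (exp (- ((norm (dual_emb j \<xi>))\<^sup>2 / 2)))" for \<xi>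
      using char_\<mu>[of 1 \<xi>] by (simp add: \<psi>_def flip: exp_of_real)
    show "infinite {i. L i \<noteq> 0}" by (rule infinite_functionals[OF j(3) dim])
  qed
  \<comment> \<open>The difference of the two sides is |x - 2 y|^2.\<close>
  have sq2: "(norm x)\<^sup>2 \<le> 2 * (norm y)\<^sup>2 + 2 * (norm (x - y))\<^sup>2" for x y :: 'h
    using inner_ge_zero[of "x - 2 *\<^sub>R y"]
    by (simp add: dot_square_norm[symmetric] inner_diff inner_commute algebra_simps)
  interpret cylindrical_semigroup j L \<psi> ?\<nu> 1 1
  proof (intro cylindrical_semigroup.intro cylindrical_semigroup_axioms.intro cylinder_axioms)
    fix t :: real and \<xi>
    assume t: "0 < t"
    show "prob_space (?\<nu> t)" unfolding gaussian_semigroup_def by (rule prob_space_distr) measurable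
    show "sets (?\<nu> t) = sets borel" by (simp add: gaussian_semigroup_def)
    show "(LINT z|?\<nu> t. exp (\<i> * complex_of_real (blinfun_apply \<xi> z))) = exp (- (complex_of_real t * \<psi> (dual_emb j \<xi>)))"
      unfolding gaussian_semigroup_def using char_\<mu>[of "sqrt t" \<xi>] t
      by (subst integral_distr) (auto simp: blinfun.scaleR_right)
    have "(\<integral>\<^sup>+z. ennreal ((blinfun_apply \<xi> z)\<^sup>2) \<partial>?\<nu> t) = (\<integral>\<^sup>+z. ennreal t * ennreal ((blinfun_apply \<xi> z)\<^sup>2) \<partial>\<mu>)"
      unfolding gaussian_semigroup_def using t
      by (subst nn_integral_distr) (auto simp: blinfun.scaleR_right power_mult_distrib ennreal_mult)
    also have "\<dots> = ennreal t * (\<integral>\<^sup>+s. ennreal (s\<^sup>2) \<partial>distr \<mu> borel (blinfun_apply \<xi>))"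
      by (subst nn_integral_cmult, measurable) (subst nn_integral_distr; simp)
    also have "\<dots> = ennreal (t * (norm (dual_emb j \<xi>))\<^sup>2)"
      unfolding law using t by (simp add: second_moment_normal_law ennreal_mult)
    also have "\<dots> \<le> ennreal (1 * (1 + t\<^sup>2) * (norm (dual_emb j \<xi>))\<^sup>2)"
    proof (intro ennreal_leI mult_right_mono)
      show "t \<le> 1 * (1 + t\<^sup>2)" using zero_le_power2[of "t - 1"] t by (simp add: power2_eq_square algebra_simps)
    qed simp
    finally show "(\<integral>\<^sup>+z. ennreal ((blinfun_apply \<xi> z)\<^sup>2) \<partial>?\<nu> t) \<le> ennreal (1 * (1 + t\<^sup>2) * (norm (dual_emb j \<xi>))\<^sup>2)" .
    have "sqrt t *\<^sub>R z \<in> range j \<longleftrightarrow> z \<in> range j" for z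
    proof
      interpret j: bounded_linear j by (rule j(2))
      show "sqrt t *\<^sub>R z \<in> range j" if "z \<in> range j" using that by (auto simp flip: j.scaleR)
      assume "sqrt t *\<^sub>R z \<in> range j"
      then obtain h where "sqrt t *\<^sub>R z = j h" by auto
      then have "z = j (inverse (sqrt t) *\<^sub>R h)" using t by (simp add: j.scaleR flip: \<open>sqrt t *\<^sub>R z = j h\<close>)
      then show "z \<in> range j" by simp
    qed
    then have "(\<lambda>z. sqrt t *\<^sub>R z) -` range j \<inter> space \<mu> = range j"
      using sets_eq_imp_space_eq[OF sets] by auto
    then show "emeasure (?\<nu> t) (range j) = 0"
      unfolding gaussian_semigroup_def using range_j_borel null by (subst emeasure_distr) auto
  next
    have "?\<nu> 0 = distr \<mu> borel (\<lambda>_. 0)" by (simp add: gaussian_semigroup_def)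
    then show "?\<nu> 0 = return borel 0" by (simp add: distr_const)
    show "continuous_on UNIV \<psi>" unfolding \<psi>_def by (intro continuous_intros) auto
    show "Re (\<psi> (dual_emb j \<xi>)) \<le> 2 * Re (\<psi> (dual_emb j \<eta>)) + 1 * (norm (dual_emb j \<xi> - dual_emb j \<eta>))\<^sup>2" for \<xi> \<eta>
      using sq2[of "dual_emb j \<xi>" "dual_emb j \<eta>"] by (simp add: \<psi>_def)
  qed (auto simp: \<psi>_def power_mult_distrib)
  show ?thesis by (rule polar_range)
qed

theorem proposition4p8:
  fixes j\<^sub>a :: "'h::{real_inner, complete_space, second_countable_topology} \<Rightarrow>
               'e::{banach, second_countable_topology}"
    and \<mu> :: "'e measure"
    and j\<^sub>b :: "'k::{real_inner, complete_space, second_countable_topology} \<Rightarrow>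
               'f::{real_inner, banach, second_countable_topology}"
    and \<psi> :: "'k \<Rightarrow> complex"
    and \<nu> :: "real \<Rightarrow> 'f measure"
  shows "(abstract_wiener_space j\<^sub>a \<mu> \<and> \<not> (\<exists>B::'h set. finite B \<and> span B = UNIV)
            \<longrightarrow> polar (gaussian_semigroup \<mu>) (range j\<^sub>a)) \<and>
         (levy_semigroup j\<^sub>b \<psi> \<nu> \<and> hilbert_schmidt j\<^sub>b \<and> hypothesis_H j\<^sub>b \<nu>
            \<longrightarrow> polar \<nu> (range j\<^sub>b))"
  using polar_gaussian_semigroup polar_levy_semigroup by blast

end
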